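(* Let $h : [0,\infty) \to [0,\infty)$ be continuous and nondecreasing, and let $f$ be a Carathéodory function on $\Omega \times \mathbb{R}$ such that $|f(x,t)| \le c_1 |t|^{p-1} + c_2$ for a.a. $x \in \Omega$ and all $t \in \mathbb{R}$, for some constants $c_1, c_2 > 0$ and $1 < p < 2^*$. Assume that the set \[ I = \left\{t > 0 : h(t) \le S^{-2^*/2}\, t^{2^*/2-1}\right\} \] is nonempty and that the following hold: $(A_1)$ for some constants $\alpha_1, \dots, \alpha_n > 0$, $1 \le \gamma_1 < \cdots < \gamma_n < 2^*/2$, and $\mu_1 \le \lambda_1(\gamma_1), \dots, \mu_n \le \lambda_1(\gamma_n)$ with at least one of these last inequalities strict, \[ K(t) \ge \sum_{i=1}^n \alpha_i\, t^{\gamma_i} \quad \forall t \ge 0 \] and \[ F(x,t) - \frac{1}{2^*}\, t f(x,t) \le \sum_{i=1}^n \mu_i\, \alpha_i\, |t|^{2\gamma_i} \quad \text{for a.a. } x \in \Omega \text{ and all } t \in \mathbb{R}; \] $(A_2)$ $K(t_1 + t_2) \ge K(t_1) + K(t_2)$ for all $t_1, t_2 \ge 0$. Set $c^* = \inf_{t \in I} K(t)$. Then $J$ satisfies the $(\mathrm{PS})_c$ condition for all $c < c^*$. If, in addition, $(A_3)$ $h(t)/t^{2^*/2-1}$ is strictly decreasing for $t > 0$ and \[ 0 \le \lim_{t \to +\infty} \frac{h(t)}{t^{2^*/2-1}} < S^{-2^*/2} < \lim_{t \to 0} \frac{h(t)}{t^{2^*/2-1}} \le +\infty, \] then the equation $h(t)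 = S^{-2^*/2}\, t^{2^*/2-1}$ has a unique positive solution $t_0$ and $c^* = K(t_0)$; in particular, $c^* > 0$.
   Context: $\Omega$ is a bounded domain in $\mathbb{R}^N$, $N \ge 3$, and $2^* = 2N/(N-2)$. $H^1_0(\Omega)$ is normed by $\|u\|^2 = \int_\Omega |\nabla u|^2\, dx$. The best Sobolev constant is $S = \inf_{u \in H^1_0(\Omega) \setminus \{0\}} \int_\Omega |\nabla u|^2\, dx \big/ \left(\int_\Omega |u|^{2^*} dx\right)^{2/2^*}$. For $1 \le \gamma \le 2^*/2$, $\lambda_1(\gamma) = \inf_{u \in H^1_0(\Omega) \setminus \{0\}} \left(\int_\Omega |\nabla u|^2\, dx\right)^\gamma \big/ \int_\Omega |u|^{2\gamma}\, dx > 0$. Set $F(x,t) = \int_0^t f(x,s)\, ds$, $H(t) = \int_0^t h(s)\, ds$, $K(t) = \frac{1}{2} H(t) - \frac{1}{2^*}\, t h(t)$ for $t \ge 0$, and \[ J(u) = \frac{1}{2}\, H\left(\int_\Omega |\nabla u|^2\, dx\right) - \int_\Omega F(x,u)\, dx - \frac{1}{2^*} \int_\Omega |u|^{2^*} dx, \quad u \in H^1_0(\Omega). \] $J$ satisfies the $(\mathrm{PS})_c$ condition ($c \in \mathbb{R}$) if every sequence $(u_j)$ in $H^1_0(\Omega)$ with $J(u_j) \to c$ and $J'(u_j) \to 0$ has a strongly convergent subsequence. *)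

theory Defs
  imports "HOL-Analysis.Analysis"
begin

primrec C_k :: "nat \<Rightarrow> ('a::euclidean_space \<Rightarrow> real) \<Rightarrow> bool" where
  "C_k 0 \<phi> \<longleftrightarrow> continuous_on UNIV \<phi>"
| "C_k (Suc k) \<phi> \<longleftrightarrow>
     (\<exists>D. (\<forall>x. GDERIV \<phi> x :> D x) \<and> (\<forall>b\<in>Basis. C_k k (\<lambda>x. D x \<bullet> b)))"

text \<open>$C_c^\infty(\Omega)$; test functions are extended by zero to the whole space.\<close>

definition test_functions :: "'a::euclidean_space set \<Rightarrow> ('a \<Rightarrow> real) set" where
  "test_functions \<Omega> =
     {\<phi>. (\<forall>k. C_k k \<phi>) \<and> (\<exists>K. compact K \<and> K \<subseteq> \<Omega> \<and> (\<forall>x. x \<notin> K \<longrightarrow> \<phi> x = 0))}"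

text \<open>
  Elements of the function spaces below are functions on the whole space, of which only the
  values on \<open>\<Omega>\<close>, up to null sets, are relevant; equality of elements is equality almost
  everywhere on \<open>\<Omega>\<close>.
\<close>

definition L2_on :: "'a::euclidean_space set \<Rightarrow> ('a \<Rightarrow> 'b::euclidean_space) \<Rightarrow> bool" where
  "L2_on \<Omega> u \<longleftrightarrow> u \<in> borel_measurable (lebesgue_on \<Omega>) \<and>
     integrable (lebesgue_on \<Omega>) (\<lambda>x. (norm (u x))\<^sup>2)"

definition locally_integrable_on ::
    "('a::euclidean_space \<Rightarrow> 'b::euclidean_space) \<Rightarrow> 'a set \<Rightarrow> bool" where
  "locally_integrable_on u \<Omega> \<longleftrightarrow>
     (\<forall>K. compact K \<and> K \<subseteq> \<Omega> \<longrightarrow> integrable (lebesgue_on K) u)"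

definition has_weak_gradient ::
    "'a::euclidean_space set \<Rightarrow> ('a \<Rightarrow> real) \<Rightarrow> ('a \<Rightarrow> 'a) \<Rightarrow> bool" where
  "has_weak_gradient \<Omega> u g \<longleftrightarrow>
     locally_integrable_on u \<Omega> \<and> locally_integrable_on g \<Omega> \<and>
     (\<forall>\<phi>\<in>test_functions \<Omega>. \<forall>D. (\<forall>x. GDERIV \<phi> x :> D x) \<longrightarrow>
        (LINT x|lebesgue_on \<Omega>. u x *\<^sub>R D x) = - (LINT x|lebesgue_on \<Omega>. \<phi> x *\<^sub>R g x))"

text \<open>The weak gradient is unique up to null sets, so the choice below is immaterial.\<close>

definition weak_grad :: "'a::euclidean_space set \<Rightarrow> ('a \<Rightarrow> real) \<Rightarrow> 'a \<Rightarrow> 'a" where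
  "weak_grad \<Omega> u = (SOME g. has_weak_gradient \<Omega> u g)"

definition H1 :: "'a::euclidean_space set \<Rightarrow> ('a \<Rightarrow> real) set" where
  "H1 \<Omega> = {u. L2_on \<Omega> u \<and> (\<exists>g. has_weak_gradient \<Omega> u g \<and> L2_on \<Omega> g)}"

definition dirichlet :: "'a::euclidean_space set \<Rightarrow> ('a \<Rightarrow> real) \<Rightarrow> real" where
  "dirichlet \<Omega> u = (LINT x|lebesgue_on \<Omega>. (norm (weak_grad \<Omega> u x))\<^sup>2)"

definition H1_norm :: "'a::euclidean_space set \<Rightarrow> ('a \<Rightarrow> real) \<Rightarrow> real" where
  "H1_norm \<Omega> u = sqrt ((LINT x|lebesgue_on \<Omega>. (u x)\<^sup>2) + dirichlet \<Omega> u)"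

text \<open>$H^1_0(\Omega)$ is the closure of $C_c^\infty(\Omega)$ in $H^1(\Omega)$.\<close>

definition H10 :: "'a::euclidean_space set \<Rightarrow> ('a \<Rightarrow> real) set" where
  "H10 \<Omega> = {u \<in> H1 \<Omega>. \<forall>\<epsilon>>0. \<exists>\<phi>\<in>test_functions \<Omega>. H1_norm \<Omega> (\<lambda>x. u x - \<phi> x) < \<epsilon>}"

definition H10_nonzero :: "'a::euclidean_space set \<Rightarrow> ('a \<Rightarrow> real) set" where
  "H10_nonzero \<Omega> = {u \<in> H10 \<Omega>. \<not> (AE x in lebesgue_on \<Omega>. u x = 0)}"

definition H10_norm :: "'a::euclidean_space set \<Rightarrow> ('a \<Rightarrow> real) \<Rightarrow> real" where
  "H10_norm \<Omega> u = sqrt (dirichlet \<Omega> u)"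

definition crit_exp :: "nat \<Rightarrow> real" where
  "crit_exp N = 2 * real N / (real N - 2)"

definition sobolev_const :: "'a::euclidean_space set \<Rightarrow> real" where
  "sobolev_const \<Omega> =
     (INF u\<in>H10_nonzero \<Omega>. dirichlet \<Omega> u /
        (LINT x|lebesgue_on \<Omega>. \<bar>u x\<bar> powr crit_exp DIM('a)) powr (2 / crit_exp DIM('a)))"

definition lambda1 :: "'a::euclidean_space set \<Rightarrow> real \<Rightarrow> real" where
  "lambda1 \<Omega> \<gamma> =
     (INF u\<in>H10_nonzero \<Omega>. dirichlet \<Omega> u powr \<gamma> /
        (LINT x|lebesgue_on \<Omega>. \<bar>u x\<bar> powr (2 * \<gamma>)))"

definition caratheodory :: "'a::euclidean_space set \<Rightarrow> ('a \<Rightarrow> real \<Rightarrow> real) \<Rightarrow> bool" where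
  "caratheodory \<Omega> f \<longleftrightarrow>
     (\<forall>t. (\<lambda>x. f x t) \<in> borel_measurable (lebesgue_on \<Omega>)) \<and>
     (AE x in lebesgue_on \<Omega>. continuous_on UNIV (f x))"

text \<open>
  The oriented integral from 0 to \<open>t\<close>; used for both $H(t) = \int_0^t h(s)\,ds$ (with
  \<open>t \<ge> 0\<close>) and $F(x,t) = \int_0^t f(x,s)\,ds$ (with \<open>t\<close> of any sign).
\<close>

definition primitive :: "(real \<Rightarrow> real) \<Rightarrow> real \<Rightarrow> real" where
  "primitive g t = (LBINT s=0..t. g s)"

definition K_fun :: "nat \<Rightarrow> (real \<Rightarrow> real) \<Rightarrow> real \<Rightarrow> real" where
  "K_fun N h t = 1/2 * primitive h t - 1 / crit_exp N * (t * h t)"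

definition J_fun ::
    "'a::euclidean_space set \<Rightarrow> (real \<Rightarrow> real) \<Rightarrow> ('a \<Rightarrow> real \<Rightarrow> real) \<Rightarrow> ('a \<Rightarrow> real) \<Rightarrow> real" where
  "J_fun \<Omega> h f u =
     1/2 * primitive h (dirichlet \<Omega> u)
     - (LINT x|lebesgue_on \<Omega>. primitive (f x) (u x))
     - 1 / crit_exp DIM('a) * (LINT x|lebesgue_on \<Omega>. \<bar>u x\<bar> powr crit_exp DIM('a))"

definition H10_dual :: "'a::euclidean_space set \<Rightarrow> (('a \<Rightarrow> real) \<Rightarrow> real) \<Rightarrow> bool" where
  "H10_dual \<Omega> L \<longleftrightarrow>
     (\<forall>v\<in>H10 \<Omega>. \<forall>w\<in>H10 \<Omega>. L (\<lambda>x. v x + w x) = L v + L w) \<and>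
     (\<forall>a. \<forall>v\<in>H10 \<Omega>. L (\<lambda>x. a * v x) = a * L v) \<and>
     (\<exists>C. \<forall>v\<in>H10 \<Omega>. \<bar>L v\<bar> \<le> C * H10_norm \<Omega> v)"

definition H10_dual_norm :: "'a::euclidean_space set \<Rightarrow> (('a \<Rightarrow> real) \<Rightarrow> real) \<Rightarrow> real" where
  "H10_dual_norm \<Omega> L = (SUP v\<in>{v \<in> H10 \<Omega>. H10_norm \<Omega> v \<le> 1}. \<bar>L v\<bar>)"

text \<open>
  Frechet derivative on $H^1_0(\Omega)$, spelled out because $H^1_0(\Omega)$ is a set of
  representatives rather than a normed-space type.
\<close>

definition H10_has_derivative ::
    "'a::euclidean_space set \<Rightarrow> (('a \<Rightarrow> real) \<Rightarrow> real) \<Rightarrow> (('a \<Rightarrow> real) \<Rightarrow> real) \<Rightarrow>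
     ('a \<Rightarrow> real) \<Rightarrow> bool" where
  "H10_has_derivative \<Omega> J L u \<longleftrightarrow>
     H10_dual \<Omega> L \<and>
     (\<forall>\<epsilon>>0. \<exists>\<delta>>0. \<forall>v\<in>H10 \<Omega>. H10_norm \<Omega> v < \<delta> \<longrightarrow>
        \<bar>J (\<lambda>x. u x + v x) - J u - L v\<bar> \<le> \<epsilon> * H10_norm \<Omega> v)"

definition palais_smale ::
    "'a::euclidean_space set \<Rightarrow> (('a \<Rightarrow> real) \<Rightarrow> real) \<Rightarrow> real \<Rightarrow> bool" where
  "palais_smale \<Omega> J c \<longleftrightarrow>
     (\<forall>u L. (\<forall>j. u j \<in> H10 \<Omega>) \<and> (\<lambda>j. J (u j)) \<longlonglongrightarrow> c \<and>
        (\<forall>j. H10_has_derivative \<Omega> J (L j) (u j)) \<and> (\<lambda>j. H10_dual_norm \<Omega> (L j)) \<longlonglongrightarrow> 0 \<longrightarrow>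
        (\<exists>r v. strict_mono (r :: nat \<Rightarrow> nat) \<and> v \<in> H10 \<Omega> \<and>
           (\<lambda>j. H10_norm \<Omega> (\<lambda>x. u (r j) x - v x)) \<longlonglongrightarrow> 0))"

definition I_set :: "'a::euclidean_space set \<Rightarrow> (real \<Rightarrow> real) \<Rightarrow> real set" where
  "I_set \<Omega> h = {t. t > 0 \<and>
     h t \<le> sobolev_const \<Omega> powr (- (crit_exp DIM('a) / 2)) * t powr (crit_exp DIM('a) / 2 - 1)}"

definition c_star :: "'a::euclidean_space set \<Rightarrow> (real \<Rightarrow> real) \<Rightarrow> real" where
  "c_star \<Omega> h = (INF t\<in>I_set \<Omega> h. K_fun DIM('a) h t)"

end

theory Submission
  imports Defs "HOL-Complex_Analysis.Great_Picard"
begin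

text \<open>
  Along a Palais-Smale sequence, $J(u_j) - \frac{1}{2^*} J'(u_j) u_j$ is $K(\|u_j\|^2)$ minus an integral
  that (A1) keeps strictly below it, so $u_j$ is bounded. Pass to a subsequence with
  $u_j \rightharpoonup v$ and $\|u_j\|^2 \to T$, and let $s = T - \|v\|^2 = \lim \|u_j - v\|^2$.
  Testing $J'(u_j)$ with $u_j$ and with $v$ and using the Brezis-Lieb lemma gives
  $\int |u_j - v|^{2^*} \to h(T) s$, hence $h(T) s \le S^{-2^*/2} s^{2^*/2}$. If $s > 0$,
  then $h(s) \le h(T)$ puts $s$ into $I$, and by (A2)
  $c \ge K(s) + K(\|v\|^2) - \int (F(x,v) - \frac{1}{2^*} v f(x,v)) \ge K(s) \ge c^*$.

  The Sobolev inequality is obtained from a weak isoperimetric inequality, applied to the truncations of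
  a $C^1$ function between dyadic levels. The Rellich theorem compares a function with its averages over small
  balls, which form an equicontinuous family.
\<close>

section \<open>Bump functions and the fundamental lemma\<close>

text \<open>The critical embedding is not compact: a weakly convergent sequence may lose part of the
  integral of |u|^q, q the critical exponent, and the argument measures this loss. The combination
  of J and J' cancels the critical integral, which is why K carries the factor 1/q. Monotonicity of
  h turns this coefficient back into h(s), and superadditivity of K separates the share of v from
  the share of the lost part. H^1_0 is a set of representatives, so its Hilbert space theory is
  rebuilt from Fubini, Fatou and dominated convergence: the weak limit is found as an almost
  everywhere limit and placed in the space by minimising the energy over shrinking convex sets.
  Since S is defined as an infimum, the Sobolev inequality enters with some finite constant
  depending on the volume of the domain; it makes S positive and bounds the critical
  integrals.\<close>

lemma GDERIV_continuous:
  assumes "\<And>x. GDERIV \<phi> x :> D x"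
  shows "continuous_on UNIV \<phi>"
  using assms unfolding gderiv_def
  by (meson continuous_at_imp_continuous_on has_derivative_continuous)

lemma GDERIV_unique:
  assumes "GDERIV f x :> D" "GDERIV f x :> E"
  shows "D = E"
proof -
  have "(\<lambda>h. h \<bullet> D) = (\<lambda>h. h \<bullet> E)"
    using assms has_derivative_unique unfolding gderiv_def by blast
  then show ?thesis by (metis vector_eq_ldot)
qed

lemma C_k_SucD: "C_k (Suc k) \<phi> \<Longrightarrow> C_k k \<phi>"
proof (induction k arbitrary: \<phi>)
  case 0
  then show ?case using GDERIV_continuous by fastforce
next
  case (Suc k)
  from Suc.prems obtain D where "\<forall>x. GDERIV \<phi> x :> D x" "\<forall>b\<in>Basis. C_k (Suc k) (\<lambda>x. D x \<bullet> b)"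
    unfolding C_k.simps(2)[of "Suc k"] by blast
  with Suc.IH show ?case unfolding C_k.simps(2)[of k] by blast
qed

lemma C_k_SucI:
  assumes "\<And>x. GDERIV \<phi> x :> D x" "\<And>b. b \<in> Basis \<Longrightarrow> C_k k (\<lambda>x. D x \<bullet> b)"
  shows "C_k (Suc k) \<phi>"
  using assms by (auto intro!: exI[of _ D])

lemma C_k_const: "C_k k (\<lambda>x::'a::euclidean_space. c)"
proof (induction k arbitrary: c)
  case (Suc k)
  show ?case by (rule C_k_SucI[OF GDERIV_const]) (simp add: Suc)
qed simp

lemma C_k_add: "C_k k \<phi> \<Longrightarrow> C_k k \<psi> \<Longrightarrow> C_k k (\<lambda>x. \<phi> x + \<psi> x)"
proof (induction k arbitrary: \<phi> \<psi>)
  case 0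
  then show ?case by (simp add: continuous_on_add)
next
  case (Suc k)
  from Suc.prems obtain D E where D: "\<forall>x. GDERIV \<phi> x :> D x" "\<forall>b\<in>Basis. C_k k (\<lambda>x. D x \<bullet> b)"
    and E: "\<forall>x. GDERIV \<psi> x :> E x" "\<forall>b\<in>Basis. C_k k (\<lambda>x. E x \<bullet> b)"
    unfolding C_k.simps by blast
  show ?case
  proof (rule C_k_SucI)
    show "GDERIV (\<lambda>x. \<phi> x + \<psi> x) x :> D x + E x" for x using D E GDERIV_add by blast
    show "C_k k (\<lambda>x. (D x + E x) \<bullet> b)" if "b \<in> Basis" for b
      unfolding inner_add_left by (rule Suc.IH) (use D E that in auto)
  qed
qed

lemma C_k_mult: "C_k k \<phi> \<Longrightarrow> C_k k \<psi> \<Longrightarrow> C_k k (\<lambda>x. \<phi> x * \<psi> x)"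
proof (induction k arbitrary: \<phi> \<psi>)
  case 0
  then show ?case by (simp add: continuous_on_mult)
next
  case (Suc k)
  from Suc.prems obtain D E where D: "\<forall>x. GDERIV \<phi> x :> D x" "\<forall>b\<in>Basis. C_k k (\<lambda>x. D x \<bullet> b)"
    and E: "\<forall>x. GDERIV \<psi> x :> E x" "\<forall>b\<in>Basis. C_k k (\<lambda>x. E x \<bullet> b)"
    unfolding C_k.simps by blast
  have "C_k k \<phi>" "C_k k \<psi>" using Suc.prems C_k_SucD by blast+
  show ?case
  proof (rule C_k_SucI)
    show "GDERIV (\<lambda>x. \<phi> x * \<psi> x) x :> \<phi> x *\<^sub>R E x + \<psi> x *\<^sub>R D x" for x
      using D E GDERIV_mult by blast
    show "C_k k (\<lambda>x. (\<phi> x *\<^sub>R E x + \<psi> x *\<^sub>R D x) \<bullet> b)" if "b \<in> Basis" for b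
      unfolding inner_add_left inner_scaleR_left
      by (intro C_k_add Suc.IH) (use D E that \<open>C_k k \<phi>\<close> \<open>C_k k \<psi>\<close> in auto)
  qed
qed

lemma C_k_prod:
  assumes "finite A" "\<And>i. i \<in> A \<Longrightarrow> C_k k (\<phi> i)"
  shows "C_k k (\<lambda>x. \<Prod>i\<in>A. \<phi> i x)"
  using assms by (induction) (auto intro: C_k_mult C_k_const)

text \<open>The family \<open>d\<close> packages a function of one variable with all its
  derivatives. The index n stays free in the induction because the gradient of the composition is
  the composition with \<open>d (Suc n)\<close> times the constant vector w, again of the same
  form.\<close>

lemma C_k_comp_linear:
  fixes d :: "nat \<Rightarrow> real \<Rightarrow> real" and w :: "'a::euclidean_space"
  assumes "\<And>n t. (d n has_real_derivative d (Suc n) t) (at t)"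
  shows "C_k k (\<lambda>x. d n (x \<bullet> w + c))"
proof (induction k arbitrary: n)
  case 0
  have "continuous_on UNIV (d n)" for n
    using assms by (meson DERIV_isCont continuous_at_imp_continuous_on)
  then have "continuous_on UNIV (\<lambda>x::'a. d n (x \<bullet> w + c))"
    by (rule continuous_on_compose2) (auto intro!: continuous_intros)
  then show ?case by simp
next
  case (Suc k)
  have *: "GDERIV (\<lambda>x. x \<bullet> w + c) x :> w" for x
    unfolding gderiv_def by (auto intro!: derivative_eq_intros)
  show ?case
    by (rule C_k_SucI[OF GDERIV_DERIV_compose[OF * assms]]) (use C_k_mult[OF Suc C_k_const] in simp)
qed

text \<open>The standard smooth function vanishing to infinite order at 0. The parameter c makes it
  tunable: as c decreases to 0 the value tends to 1 at every t > 0 and stays 0 for t <= 0.\<close>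

definition flat :: "real \<Rightarrow> real \<Rightarrow> real" where
  "flat c t = (if t > 0 then exp (- c / t) else 0)"

text \<open>The $n$-th derivative of \<open>flat c\<close> at $t > 0$ is $P_n(1/t)\, e^{-c/t}$.\<close>

primrec flat_poly :: "real \<Rightarrow> nat \<Rightarrow> real poly" where
  "flat_poly c 0 = 1"
| "flat_poly c (Suc n) = [:0, 0, 1:] * (smult c (flat_poly c n) - pderiv (flat_poly c n))"

text \<open>The additional power s^k makes the induction on the polynomial close: in a + s P(s) the
  factor s moves into the power, leaving a monomial against an exponential and the hypothesis for P
  at k + 1.\<close>

lemma power_poly_exp_decay:
  fixes c :: real
  assumes "c > 0"
  shows "((\<lambda>s. s ^ k * poly P s * exp (- c * s)) \<longlongrightarrow> 0) at_top"
proof (induction P arbitrary: k)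
  case (pCons a P)
  have "filterlim (\<lambda>s. c * s) at_top at_top"
    using assms filterlim_tendsto_pos_mult_at_top[where f = "\<lambda>s. c" and c = c and g = "\<lambda>s. s" and F = at_top]
    by (simp add: filterlim_ident)
  then have "((\<lambda>s. (c * s) ^ k / exp (c * s)) \<longlongrightarrow> 0) at_top"
    using filterlim_compose[OF tendsto_power_div_exp_0] by blast
  then have "((\<lambda>s. a / c ^ k * ((c * s) ^ k / exp (c * s))) \<longlongrightarrow> 0) at_top"
    using tendsto_mult_right_zero by blast
  moreover have "(\<lambda>s. a / c ^ k * ((c * s) ^ k / exp (c * s))) = (\<lambda>s. s ^ k * a * exp (- c * s))"
    using assms by (auto simp: power_mult_distrib exp_minus field_simps)
  ultimately have "((\<lambda>s. s ^ k * a * exp (- c * s) + s ^ Suc k * poly P s * exp (- c * s)) \<longlongrightarrow> 0) at_top"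
    using tendsto_add[OF _ pCons.IH(1)[of "Suc k"]] by force
  then show ?case by (simp add: algebra_simps)
qed simp

text \<open>Away from 0 this is the recursion of \<open>flat_poly\<close>. At 0 the right difference
  quotient is s P(s) e^(-c s) with s = 1/t tending to infinity, so it vanishes in the limit; the
  left one is identically 0.\<close>

lemma flat_deriv_chain:
  assumes c: "c > 0"
  defines "d \<equiv> \<lambda>n t. if t > 0 then poly (flat_poly c n) (1 / t) * exp (- c / t) else 0"
  shows "(d n has_real_derivative d (Suc n) t) (at t)"
proof -
  consider "t > 0" | "t < 0" | "t = 0" by linarith
  then show ?thesis
  proof cases
    case 1
    have "((\<lambda>t. poly (flat_poly c n) (1 / t) * exp (- c / t)) has_real_derivative d (Suc n) t) (at t)"
      using 1 unfolding d_def
      by (auto intro!: derivative_eq_intros simp: field_simps power2_eq_square)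
    then show ?thesis
      by (rule has_field_derivative_transform_within_open[of _ _ _ "{0<..}"]) (use 1 in \<open>auto simp: d_def\<close>)
  next
    case 2
    have "((\<lambda>t. 0) has_real_derivative d (Suc n) t) (at t)"
      using 2 unfolding d_def by simp
    then show ?thesis
      by (rule has_field_derivative_transform_within_open[of _ _ _ "{..<0}"]) (use 2 in \<open>auto simp: d_def\<close>)
  next
    case 3
    have "((\<lambda>h. (inverse h) ^ 1 * poly (flat_poly c n) (inverse h) * exp (- c * inverse h)) \<longlongrightarrow> 0) (at_right 0)"
      using filterlim_compose[OF power_poly_exp_decay[OF c] filterlim_inverse_at_top_right] by blast
    then have "((\<lambda>h. d n h / h) \<longlongrightarrow> 0) (at_right 0)"
    proof (rule Lim_transform_eventually)
      show "\<forall>\<^sub>F x in at_right 0. inverse x ^ 1 * poly (flat_poly c n) (inverse x) * exp (- c * inverse x) = d n x / x"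
        using eventually_at_right_less[of "0::real"] by eventually_elim (auto simp: d_def field_simps)
    qed
    moreover have "((\<lambda>h. d n h / h) \<longlongrightarrow> 0) (at_left 0)"
    proof (rule Lim_transform_eventually[OF tendsto_const])
      show "\<forall>\<^sub>F x in at_left 0. 0 = d n x / x"
        by (auto simp: d_def eventually_at_filter)
    qed
    ultimately have "((\<lambda>h. d n h / h) \<longlongrightarrow> 0) (at 0)"
      by (rule filterlim_split_at[rotated])
    then show ?thesis using 3 unfolding DERIV_def by (simp add: d_def)
  qed
qed

lemma C_k_flat:
  assumes "c > 0"
  shows "C_k k (\<lambda>x::'a::euclidean_space. flat c (x \<bullet> w + b))"
proof -
  have "flat c = (\<lambda>t. if t > 0 then poly (flat_poly c 0) (1 / t) * exp (- c / t) else 0)"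
    by (auto simp: flat_def)
  then show ?thesis
    using C_k_comp_linear[where d = "\<lambda>n t. if t > 0 then poly (flat_poly c n) (1 / t) * exp (- c / t) else 0" and n = 0 and w = w and c = b and k = k]
      flat_deriv_chain[OF assms] by simp
qed

text \<open>For each coordinate one factor vanishes below the lower face of the box and one above
  the upper face, so the product is smooth, positive exactly inside the open box, and carried by the
  compact closed box.\<close>

definition box_bump :: "'a::euclidean_space \<Rightarrow> 'a \<Rightarrow> real \<Rightarrow> 'a \<Rightarrow> real" where
  "box_bump a b \<delta> x = (\<Prod>i\<in>Basis. flat \<delta> (x \<bullet> i + - (a \<bullet> i)) * flat \<delta> (x \<bullet> (- i) + b \<bullet> i))"

lemma flat_bounds: "c > 0 \<Longrightarrow> 0 \<le> flat c t" "c > 0 \<Longrightarrow> flat c t \<le> 1"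
  by (auto simp: flat_def)

lemma box_bump_bounds:
  assumes "\<delta> > 0" shows "0 \<le> box_bump a b \<delta> x" "box_bump a b \<delta> x \<le> 1"
  unfolding box_bump_def
  using assms by (auto intro!: prod_nonneg prod_le_1 mult_le_one simp: flat_bounds)

lemma box_bump_eq_0:
  assumes "x \<notin> box a b" shows "box_bump a b \<delta> x = 0"
proof -
  obtain i where "i \<in> Basis" "\<not> (a \<bullet> i < x \<bullet> i \<and> x \<bullet> i < b \<bullet> i)" using assms by (auto simp: mem_box)
  then show ?thesis unfolding box_bump_def
    by (intro prod_zero) (auto simp: flat_def intro!: bexI[of _ i])
qed

lemma box_bump_pos:
  assumes "x \<in> box a b" shows "box_bump a b \<delta> x > 0"
  using assms unfolding box_bump_def by (auto intro!: prod_pos simp: mem_box flat_def)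

lemma box_bump_in_test_functions:
  assumes "\<delta> > 0" "cbox a b \<subseteq> \<Omega>"
  shows "box_bump a b \<delta> \<in> test_functions \<Omega>"
proof -
  have "C_k k (box_bump a b \<delta>)" for k
    unfolding box_bump_def[abs_def] by (intro C_k_prod C_k_mult C_k_flat assms finite_Basis)
  moreover have "\<forall>x. x \<notin> cbox a b \<longrightarrow> box_bump a b \<delta> x = 0"
    using box_bump_eq_0 box_subset_cbox by blast
  ultimately show ?thesis
    unfolding test_functions_def mem_Collect_eq using assms(2) compact_cbox[of a b] by (intro conjI allI exI[of _ "cbox a b"]) simp_all
qed

text \<open>Together with the bound by 1 this lets dominated convergence carry identities from test
  functions to indicators of boxes.\<close>

lemma box_bump_LIMSEQ: "(\<lambda>n. box_bump a b (1 / real (Suc n)) x) \<longlonglongrightarrow> indicator (box a b) x"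
proof (cases "x \<in> box a b")
  case True
  have *: "(\<lambda>n. flat (1 / real (Suc n)) t) \<longlonglongrightarrow> 1" if "t > 0" for t
  proof -
    have "(\<lambda>n. exp (- (1 / real (Suc n)) / t)) \<longlonglongrightarrow> exp (- 0 / t)"
      using LIMSEQ_Suc[OF lim_1_over_n] that by (intro tendsto_intros) auto
    then show ?thesis using that by (simp add: flat_def)
  qed
  have "(\<lambda>n. box_bump a b (1 / real (Suc n)) x) \<longlonglongrightarrow> (\<Prod>i\<in>(Basis::'a set). 1 * 1)"
    unfolding box_bump_def by (intro tendsto_prod tendsto_mult *) (use True in \<open>auto simp: mem_box\<close>)
  then show ?thesis using True by simp
qed (simp add: box_bump_eq_0)

lemma test_functions_continuous: "\<phi> \<in> test_functions \<Omega> \<Longrightarrow> continuous_on UNIV \<phi>"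
  unfolding test_functions_def using C_k.simps(1) by blast

lemma sigma_finite_lebesgue: "sigma_finite_measure (lebesgue :: 'a::euclidean_space measure)"
proof
  obtain A :: "'a set set" where "countable A" "A \<subseteq> sets lborel" "\<Union>A = space lborel"
    "\<forall>a\<in>A. emeasure lborel a \<noteq> \<infinity>"
    using lborel.sigma_finite_countable by blast
  then show "\<exists>A::'a set set. countable A \<and> A \<subseteq> sets lebesgue \<and> \<Union>A = space lebesgue \<and>
      (\<forall>a\<in>A. emeasure lebesgue a \<noteq> \<infinity>)"
    by (intro exI[of _ A]) (auto simp: subset_iff)
qed

text \<open>Open boxes are stable under intersection and generate the Borel sets, and the Borel sets
  over which f has integral 0 form a Dynkin system; \<open>f0\<close> serves the complement step. A
  Lebesgue set differs from its Borel main part by a null set, so its integral vanishes as well, and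
  a function with vanishing integral over every measurable set is 0 almost everywhere.\<close>

lemma AE_0_if_box_integrals_0:
  fixes f :: "'a::euclidean_space \<Rightarrow> 'b::euclidean_space"
  assumes f: "integrable lebesgue f" and f0: "integral\<^sup>L lebesgue f = 0"
    and box0: "\<And>c d. (LINT x:box c d|lebesgue. f x) = 0"
  shows "AE x in lebesgue. f x = 0"
proof -
  have si: "set_integrable lebesgue A f" if "A \<in> sets lebesgue" for A
    unfolding set_integrable_def using integrable_mult_indicator[OF that f] .
  have borel0: "(LINT x:A|lebesgue. f x) = 0" if "A \<in> sets borel" for A
  proof -
    let ?G = "range (\<lambda>(a, b). box a b :: 'a set)"
    have "A \<in> sigma_sets UNIV ?G" using that by (simp add: borel_eq_box)
    have "Int_stable ?G"
      unfolding Int_stable_def by (auto simp: box_Int_box image_iff)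
    moreover have "?G \<subseteq> Pow UNIV" by simp
    ultimately show ?thesis using \<open>A \<in> sigma_sets UNIV ?G\<close>
    proof (induction rule: sigma_sets_induct_disjoint[where \<Omega> = UNIV, consumes 3])
      case (basic A) then show ?case using box0 by auto
    next
      case empty then show ?case by (simp add: set_lebesgue_integral_def)
    next
      case (compl A)
      have A: "A \<in> sets lebesgue" using compl(1) by (simp add: borel_eq_box)
      have "(LINT x:(A \<union> (UNIV - A))|lebesgue. f x) = (LINT x:A|lebesgue. f x) + (LINT x:(UNIV - A)|lebesgue. f x)"
        using A sets.compl_sets[OF A] by (intro set_integral_Un si) (auto simp: space_restrict_space)
      then show ?case using compl f0 by (simp add: set_lebesgue_integral_def)
    next
      case (union A)
      have "A i \<in> sigma_sets UNIV ?G" for i using union(2) by blast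
      then have "\<And>i. A i \<in> sets lebesgue" by (simp add: borel_eq_box)
      moreover have "A i \<inter> A j = {}" if "i \<noteq> j" for i j
        using union(1) that by (simp add: disjoint_family_on_def)
      ultimately have "(LINT x:(\<Union>i. A i)|lebesgue. f x) = (\<Sum>i. (LINT x:(A i)|lebesgue. f x))"
        by (intro lebesgue_integral_countable_add si) auto
      then show ?case using union by simp
    qed
  qed
  have "(LINT x:A|lebesgue. f x) = 0" if A: "A \<in> sets lebesgue" for A
  proof -
    have "AE x in lebesgue. x \<notin> null_part lborel A"
      using AE_completion[OF AE_notin_null_part[OF A]] .
    then have "AE x in lebesgue. x \<in> A \<longleftrightarrow> x \<in> main_part lborel A"
      using main_part_null_part_Un[OF A] by (auto elim!: eventually_mono)
    then have "(LINT x:A|lebesgue. f x) = (LINT x:main_part lborel A|lebesgue. f x)"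
      unfolding set_lebesgue_integral_def using main_part_sets[OF A]
      by (intro integral_cong_AE borel_measurable_scaleR borel_measurable_indicator borel_measurable_integrable[OF f] A)
        (auto elim!: eventually_mono simp: indicator_def)
    also have "\<dots> = 0" using borel0 main_part_sets[OF A] by simp
    finally show ?thesis .
  qed
  then show ?thesis
    by (intro sigma_finite_measure.density_zero[OF sigma_finite_lebesgue f])
qed

text \<open>Since g is only locally integrable, the argument is localised: g is cut off to a box
  whose closure lies in the domain, where bumps approximate the indicators of all smaller boxes.
  Countably many such closed boxes cover the open set.\<close>

lemma fundamental_lemma:
  fixes g :: "'a::euclidean_space \<Rightarrow> 'b::euclidean_space"
  assumes "open \<Omega>" and g: "locally_integrable_on g \<Omega>"
    and 0: "\<And>\<phi>. \<phi> \<in> test_functions \<Omega> \<Longrightarrow> (LINT x|lebesgue_on \<Omega>. \<phi> x *\<^sub>R g x) = 0"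
  shows "AE x in lebesgue_on \<Omega>. g x = 0"
proof -
  have \<Omega>: "\<Omega> \<in> sets lebesgue" using assms(1) by auto
  have intg: "integrable lebesgue (\<lambda>x. indicator (cbox a b) x *\<^sub>R g x)" if "cbox a b \<subseteq> \<Omega>" for a b
  proof -
    have "integrable (lebesgue_on (cbox a b)) g" using g that compact_cbox[of a b] unfolding locally_integrable_on_def by blast
    then show ?thesis by (subst (asm) integrable_restrict_space) auto
  qed
  have box0: "(LINT x|lebesgue. indicator (box a b) x *\<^sub>R g x) = 0" if ab: "cbox a b \<subseteq> \<Omega>" for a b
  proof -
    let ?\<phi> = "\<lambda>n. box_bump a b (1 / real (Suc n))"
    have meas: "?\<phi> n \<in> borel_measurable lebesgue" for n
      using test_functions_continuous[OF box_bump_in_test_functions[OF _ ab, of "1 / real (Suc n)"]]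
      by (intro measurable_completion) (auto intro: borel_measurable_continuous_onI)
    have eq: "?\<phi> n x *\<^sub>R (indicator (cbox a b) x *\<^sub>R g x) = indicator \<Omega> x *\<^sub>R ?\<phi> n x *\<^sub>R g x" for n x
    proof (cases "x \<in> cbox a b")
      case True then show ?thesis using ab by auto
    next
      case False
      then have "?\<phi> n x = 0" using box_bump_eq_0 box_subset_cbox by blast
      then show ?thesis by simp
    qed
    have "(LINT x|lebesgue. ?\<phi> n x *\<^sub>R (indicator (cbox a b) x *\<^sub>R g x)) = 0" for n
    proof -
      have "(LINT x|lebesgue. ?\<phi> n x *\<^sub>R (indicator (cbox a b) x *\<^sub>R g x)) = (LINT x|lebesgue_on \<Omega>. ?\<phi> n x *\<^sub>R g x)"
        unfolding eq by (rule integral_restrict_space[symmetric]) (use \<Omega> in simp)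
      also have "\<dots> = 0"
        by (intro 0 box_bump_in_test_functions ab) auto
      finally show ?thesis .
    qed
    then have "(\<lambda>n. LINT x|lebesgue. ?\<phi> n x *\<^sub>R (indicator (cbox a b) x *\<^sub>R g x)) \<longlonglongrightarrow> 0" by (simp only: tendsto_const)
    moreover have "(\<lambda>n. LINT x|lebesgue. ?\<phi> n x *\<^sub>R (indicator (cbox a b) x *\<^sub>R g x))
        \<longlonglongrightarrow> (LINT x|lebesgue. indicator (box a b) x *\<^sub>R (indicator (cbox a b) x *\<^sub>R g x))"
    proof (rule integral_dominated_convergence[where w = "\<lambda>x. norm (indicator (cbox a b) x *\<^sub>R g x)"])
      show "AE x in lebesgue. (\<lambda>n. ?\<phi> n x *\<^sub>R indicator (cbox a b) x *\<^sub>R g x)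
          \<longlonglongrightarrow> indicat_real (box a b) x *\<^sub>R indicator (cbox a b) x *\<^sub>R g x"
        by (intro AE_I2 tendsto_scaleR box_bump_LIMSEQ tendsto_const)
      show "AE x in lebesgue. norm (?\<phi> n x *\<^sub>R indicator (cbox a b) x *\<^sub>R g x)
          \<le> norm (indicator (cbox a b) x *\<^sub>R g x)" for n
        using box_bump_bounds[of "1 / real (Suc n)" a b]
        by (intro AE_I2, subst norm_scaleR, intro mult_left_le_one_le) (auto simp: abs_of_nonneg)
      show "(\<lambda>x. ?\<phi> n x *\<^sub>R indicator (cbox a b) x *\<^sub>R g x) \<in> borel_measurable lebesgue" for n
        by (intro borel_measurable_scaleR meas borel_measurable_integrable intg ab)
      show "(\<lambda>x. indicat_real (box a b) x *\<^sub>R indicator (cbox a b) x *\<^sub>R g x) \<in> borel_measurable lebesgue"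
        by (intro borel_measurable_scaleR borel_measurable_indicator borel_measurable_integrable intg ab) simp
    qed (intro integrable_norm intg ab)
    ultimately have "(LINT x|lebesgue. indicator (box a b) x *\<^sub>R (indicator (cbox a b) x *\<^sub>R g x)) = 0"
      by (rule LIMSEQ_unique[rotated])
    moreover have "indicator (box a b) x *\<^sub>R (indicator (cbox a b) x *\<^sub>R g x) = indicator (box a b) x *\<^sub>R g x" for x
      using box_subset_cbox[of a b] by (auto simp: indicator_def)
    ultimately show ?thesis by (simp only:)
  qed
  obtain \<D> where \<D>: "countable \<D>" "\<D> \<subseteq> Pow \<Omega>" "\<And>X. X \<in> \<D> \<Longrightarrow> \<exists>a b. X = cbox a b" "\<Union>\<D> = \<Omega>"
    by (rule open_countable_Union_open_cbox[OF assms(1)]) (rule that)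
  have "AE x in lebesgue. x \<in> X \<longrightarrow> g x = 0" if XD: "X \<in> \<D>" for X
  proof -
    obtain a b where X: "X = cbox a b" using \<D>(3)[OF XD] by blast
    then have ab: "cbox a b \<subseteq> \<Omega>" using \<D>(2) XD by blast
    let ?f = "\<lambda>x. indicator (box a b) x *\<^sub>R g x"
    have "?f = (\<lambda>x. indicator (box a b) x *\<^sub>R (indicator (cbox a b) x *\<^sub>R g x))"
      using box_subset_cbox[of a b] by (intro ext) (auto simp: indicator_def)
    then have int: "integrable lebesgue ?f"
      using integrable_mult_indicator[OF _ intg[OF ab], of "box a b"] by simp
    have "AE x in lebesgue. ?f x = 0"
    proof (rule AE_0_if_box_integrals_0[OF int box0[OF ab]])
      fix c d :: 'a
      \<comment> \<open>The intersection of two open boxes is a box, and its closure stays inside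
        \<open>cbox a b\<close>, hence inside the domain; so \<open>box0\<close> applies to
        it.\<close>
      obtain e k where ek: "box c d \<inter> box a b = box e k" using box_Int_box by blast
      have "(LINT x|lebesgue. indicator (box e k) x *\<^sub>R g x) = 0"
      proof (cases "box e k = {}")
        case False
        have "box e k \<subseteq> cbox a b" using Int_lower2[of "box c d" "box a b"] box_subset_cbox[of a b] unfolding ek by (rule order_trans)
        then have "cbox e k \<subseteq> cbox a b"
          using closure_minimal[OF _ closed_cbox[of a b], of "box e k"] closure_box[OF False] by simp
        then have "cbox e k \<subseteq> \<Omega>" using ab by (rule order_trans)
        then show ?thesis by (rule box0)
      qed simp
      moreover have "indicator (box c d) x *\<^sub>R ?f x = indicator (box e k) x *\<^sub>R g x" for x
        using ek[symmetric] by (auto simp: indicator_def)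
      ultimately show "(LINT x:box c d|lebesgue. ?f x) = 0"
        unfolding set_lebesgue_integral_def by (simp only:)
    qed
    \<comment> \<open>The cover is by closed boxes but the vanishing is known on open ones; the
      faces are negligible.\<close>
    moreover have "AE x in lebesgue. x \<notin> cbox a b - box a b"
      using negligible_frontier_interval[of a b] by (intro AE_not_in) (simp add: negligible_iff_null_sets)
    ultimately show ?thesis unfolding X by eventually_elim (auto simp: indicator_def)
  qed
  then have "AE x in lebesgue. \<forall>X\<in>\<D>. x \<in> X \<longrightarrow> g x = 0"
    by (subst AE_ball_countable[OF \<D>(1)]) blast
  then have "AE x in lebesgue. x \<in> \<Omega> \<longrightarrow> g x = 0"
    using \<D>(4) by (auto elim!: eventually_mono)
  then show ?thesis using \<Omega> by (simp add: AE_restrict_space_iff)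
qed

section \<open>The Sobolev inequality for $C^1$ functions\<close>

lemma nn_integral_lborel_shift:
  fixes c :: "'a::euclidean_space"
  assumes [measurable]: "F \<in> borel_measurable borel"
  shows "(\<integral>\<^sup>+x. F (x + c) \<partial>lborel) = (\<integral>\<^sup>+x. F x \<partial>lborel)"
proof -
  have "(\<integral>\<^sup>+x. F x \<partial>lborel) = (\<integral>\<^sup>+x. F x \<partial>distr lborel borel ((+) c))"
    by (simp add: lborel_distr_plus)
  also have "\<dots> = (\<integral>\<^sup>+x. F (c + x) \<partial>lborel)" by (subst nn_integral_distr) auto
  finally show ?thesis by (simp add: add.commute)
qed

lemma nn_integral_lborel_scale:
  fixes t :: "'a::euclidean_space"
  assumes [measurable]: "F \<in> borel_measurable borel" and "r > 0"
  shows "ennreal (r ^ DIM('a)) * (\<integral>\<^sup>+x. F (t + r *\<^sub>R x) \<partial>lborel) = (\<integral>\<^sup>+x. F x \<partial>lborel)"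
proof -
  have eq: "lborel = density (distr lborel borel (\<lambda>x. t + r *\<^sub>R x)) (\<lambda>_. ennreal (\<bar>r\<bar> ^ DIM('a)))"
    using lborel_affine[of r t] assms(2) by (simp add: ennreal_power)
  have "(\<integral>\<^sup>+x. F x \<partial>lborel) = (\<integral>\<^sup>+x. F x \<partial>density (distr lborel borel (\<lambda>x. t + r *\<^sub>R x)) (\<lambda>_. ennreal (\<bar>r\<bar> ^ DIM('a))))"
    by (rule arg_cong[OF eq, where f = "\<lambda>M. nn_integral M F"])
  also have "\<dots> = ennreal (r ^ DIM('a)) * (\<integral>\<^sup>+x. F (t + r *\<^sub>R x) \<partial>lborel)"
    using assms(2) by (subst nn_integral_density) (auto simp: nn_integral_distr nn_integral_cmult)
  finally show ?thesis by simp
qed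

lemma GDERIV_line:
  fixes \<phi> :: "'a::euclidean_space \<Rightarrow> real"
  assumes "\<And>x. GDERIV \<phi> x :> D x"
  shows "((\<lambda>r. \<phi> (x + r *\<^sub>R \<omega>)) has_real_derivative (\<omega> \<bullet> D (x + r *\<^sub>R \<omega>))) (at r within S)"
proof -
  have "((\<lambda>r. x + r *\<^sub>R \<omega>) has_derivative (\<lambda>h. h *\<^sub>R \<omega>)) (at r within S)"
    by (auto intro!: derivative_eq_intros)
  from has_derivative_compose[OF this, of \<phi> "\<lambda>h. h \<bullet> D (x + r *\<^sub>R \<omega>)"] assms
  show ?thesis unfolding has_field_derivative_def gderiv_def
    by (auto simp: mult.commute[of "\<omega> \<bullet> _"] elim!: has_derivative_eq_rhs)
qed

text \<open>The fundamental theorem of calculus on the segment, followed by Cauchy-Schwarz. The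
  bound is an extended nonnegative integral so that later exchanges of integrals only ask for
  measurability.\<close>

lemma line_increment:
  fixes \<phi> :: "'a::euclidean_space \<Rightarrow> real"
  assumes grad: "\<And>x. GDERIV \<phi> x :> D x" and cont: "continuous_on UNIV D" and "a \<le> b"
  shows "ennreal \<bar>\<phi> (x + b *\<^sub>R \<omega>) - \<phi> (x + a *\<^sub>R \<omega>)\<bar>
    \<le> (\<integral>\<^sup>+r. indicator {a..b} r * ennreal (norm \<omega> * norm (D (x + r *\<^sub>R \<omega>))) \<partial>lborel)"
proof -
  have c: "continuous_on S (\<lambda>r. D (x + r *\<^sub>R \<omega>))" for S
    by (rule continuous_on_compose2[OF cont]) (auto intro!: continuous_intros)
  have "has_bochner_integral lborel (\<lambda>r. indicator {a..b} r *\<^sub>R (\<omega> \<bullet> D (x + r *\<^sub>R \<omega>)))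
      (\<phi> (x + b *\<^sub>R \<omega>) - \<phi> (x + a *\<^sub>R \<omega>))"
    using GDERIV_line[OF grad] assms(3)
    by (intro has_bochner_integral_FTC_Icc continuous_on_inner continuous_on_const c)
      (auto simp flip: has_real_derivative_iff_has_vector_derivative)
  then have "ennreal (norm (\<phi> (x + b *\<^sub>R \<omega>) - \<phi> (x + a *\<^sub>R \<omega>)))
      \<le> (\<integral>\<^sup>+r. norm (indicator {a..b} r *\<^sub>R (\<omega> \<bullet> D (x + r *\<^sub>R \<omega>))) \<partial>lborel)"
    by (rule has_bochner_integral_norm_bound)
  also have "\<dots> \<le> (\<integral>\<^sup>+r. indicator {a..b} r * ennreal (norm \<omega> * norm (D (x + r *\<^sub>R \<omega>))) \<partial>lborel)"
    by (intro nn_integral_mono) (auto simp: indicator_def intro!: ennreal_leI Cauchy_Schwarz_ineq2)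
  finally show ?thesis by simp
qed

text \<open>Only first derivatives enter the Sobolev and Rellich arguments. K is some compact set
  carrying the function rather than its exact support: it may be taken inside a domain, whose
  measure then bounds that of K.\<close>

locale C1_compact_support =
  fixes \<phi> :: "'a::euclidean_space \<Rightarrow> real" and D :: "'a \<Rightarrow> 'a" and K :: "'a set"
  assumes grad: "\<And>x. GDERIV \<phi> x :> D x" and cont_D: "continuous_on UNIV D"
    and compact_K: "compact K" and supp: "\<And>x. x \<notin> K \<Longrightarrow> \<phi> x = 0"
begin

lemma cont: "continuous_on UNIV \<phi>"
  using GDERIV_continuous grad by blast

lemma measurable_phi[measurable]: "\<phi> \<in> borel_measurable borel"
  using cont by (rule borel_measurable_continuous_onI)

lemma measurable_D[measurable]: "D \<in> borel_measurable borel"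
  using cont_D by (rule borel_measurable_continuous_onI)

lemma supp_D: "D x = 0" if "x \<notin> K"
proof -
  have "open (- K)" using compact_K compact_imp_closed by blast
  moreover have "GDERIV (\<lambda>_. 0) x :> 0" by (rule GDERIV_const)
  ultimately have "GDERIV \<phi> x :> 0"
    unfolding gderiv_def using that supp
    by (auto intro: has_derivative_transform_within_open[where s = "- K" and f = "\<lambda>_. 0"])
  then show ?thesis using grad GDERIV_unique by blast
qed

lemma integrable_if_supp:
  fixes f :: "'a \<Rightarrow> 'b::euclidean_space"
  assumes "continuous_on UNIV f" "\<And>x. x \<notin> K \<Longrightarrow> f x = 0"
  shows "integrable lborel f"
proof -
  have "integrable lborel (\<lambda>x. indicator K x *\<^sub>R f x)"
    using compact_K assms(1) by (intro borel_integrable_compact) (auto intro: continuous_on_subset)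
  moreover have "(\<lambda>x. indicator K x *\<^sub>R f x) = f" using assms(2) by (auto simp: indicator_def)
  ultimately show ?thesis by simp
qed

lemma integrable_norm_D: "integrable lborel (\<lambda>x. norm (D x))"
  by (intro integrable_if_supp continuous_intros cont_D) (simp add: supp_D)

lemma integrable_norm_D2: "integrable lborel (\<lambda>x. (norm (D x))\<^sup>2)"
  by (intro integrable_if_supp continuous_intros cont_D) (simp add: supp_D)

lemma integrable_phi: "integrable lborel \<phi>"
  by (intro integrable_if_supp continuous_intros cont) (simp add: supp)

text \<open>The ray starts where the modulus is at least 2a and leaves K, outside which the function
  vanishes. Let r2 be the first parameter with modulus at most a, and r1 the last one before r2 with
  modulus at least 2a. Strictly between them the modulus lies in (a, 2a), while the function changes
  by at least a; so the gradient inside this layer alone accounts for a.\<close>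

lemma ray_crossing:
  assumes "a > 0" "2 * a \<le> \<bar>\<phi> x\<bar>" "\<omega> \<noteq> 0" "norm \<omega> \<le> 1"
  shows "ennreal a \<le> (\<integral>\<^sup>+r. indicator {0..} r * (indicator {y. a < \<bar>\<phi> y\<bar> \<and> \<bar>\<phi> y\<bar> < 2 * a} (x + r *\<^sub>R \<omega>)
    * ennreal (norm (D (x + r *\<^sub>R \<omega>)))) \<partial>lborel)"
proof -
  define \<gamma> where "\<gamma> r = \<phi> (x + r *\<^sub>R \<omega>)" for r
  have [continuous_intros]: "continuous_on S \<gamma>" for S
    unfolding \<gamma>_def[abs_def] by (rule continuous_on_compose2[OF cont]) (auto intro!: continuous_intros)
  obtain B where B: "\<And>y. y \<in> K \<Longrightarrow> norm y \<le> B" "B > 0"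
    using compact_K compact_imp_bounded bounded_pos by metis
  \<comment> \<open>At this parameter the point has norm greater than B, the bound for K, so the ray
    has left K.\<close>
  define R where "R = (B + norm x + 1) / norm \<omega>"
  have "R > 0" using B assms(3) by (simp add: R_def add_pos_nonneg)
  have "norm (R *\<^sub>R \<omega>) = B + norm x + 1" using B assms(3) by (simp add: R_def)
  moreover have "norm (R *\<^sub>R \<omega>) \<le> norm (x + R *\<^sub>R \<omega>) + norm x"
    using norm_triangle_ineq4[of "x + R *\<^sub>R \<omega>" x] by simp
  ultimately have "x + R *\<^sub>R \<omega> \<notin> K" using B(1)[of "x + R *\<^sub>R \<omega>"] by auto
  then have \<gamma>R: "\<gamma> R = 0" using supp by (simp add: \<gamma>_def)
  have cl: "compact {r \<in> {0..u}. \<bar>\<gamma> r\<bar> \<le> v}" "compact {r \<in> {0..u}. v \<le> \<bar>\<gamma> r\<bar>}" for u v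
  proof -
    have "closed {r. \<bar>\<gamma> r\<bar> \<le> v}" "closed {r. v \<le> \<bar>\<gamma> r\<bar>}"
      by (intro closed_Collect_le continuous_intros)+
    then have "compact ({0..u} \<inter> {r. \<bar>\<gamma> r\<bar> \<le> v})" "compact ({0..u} \<inter> {r. v \<le> \<bar>\<gamma> r\<bar>})"
      by (intro compact_Int_closed; simp)+
    then show "compact {r \<in> {0..u}. \<bar>\<gamma> r\<bar> \<le> v}" "compact {r \<in> {0..u}. v \<le> \<bar>\<gamma> r\<bar>}"
      by (simp_all add: Int_def)
  qed
  have "{r \<in> {0..R}. \<bar>\<gamma> r\<bar> \<le> a} \<noteq> {}" using \<gamma>R \<open>R > 0\<close> assms(1) by force
  then obtain r2 where r2: "r2 \<in> {0..R}" "\<bar>\<gamma> r2\<bar> \<le> a" "\<And>r. r \<in> {0..R} \<Longrightarrow> \<bar>\<gamma> r\<bar> \<le> a \<Longrightarrow> r2 \<le> r"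
    using compact_attains_inf[OF cl(1)[of R a]] by auto
  have "0 \<in> {r \<in> {0..r2}. 2 * a \<le> \<bar>\<gamma> r\<bar>}" using r2 assms(2) by (simp add: \<gamma>_def)
  then obtain r1 where r1: "r1 \<in> {0..r2}" "2 * a \<le> \<bar>\<gamma> r1\<bar>" "\<And>r. r \<in> {0..r2} \<Longrightarrow> 2 * a \<le> \<bar>\<gamma> r\<bar> \<Longrightarrow> r \<le> r1"
    using compact_attains_sup[OF cl(2)[of r2 "2 * a"]] by auto
  have between: "a < \<bar>\<gamma> r\<bar> \<and> \<bar>\<gamma> r\<bar> < 2 * a" if "r1 < r" "r < r2" for r
    using r1(3)[of r] r2(3)[of r] r1(1) r2(1) that by (auto simp: not_le[symmetric])
  have "ennreal a \<le> ennreal \<bar>\<gamma> r2 - \<gamma> r1\<bar>" using r1(2) r2(2) by (intro ennreal_leI) linarith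
  also have "\<dots> \<le> (\<integral>\<^sup>+r. indicator {r1..r2} r * ennreal (norm \<omega> * norm (D (x + r *\<^sub>R \<omega>))) \<partial>lborel)"
    unfolding \<gamma>_def using r1(1) by (intro line_increment grad cont_D) auto
  also have "\<dots> \<le> (\<integral>\<^sup>+r. indicator {0..} r * (indicator {y. a < \<bar>\<phi> y\<bar> \<and> \<bar>\<phi> y\<bar> < 2 * a} (x + r *\<^sub>R \<omega>)
    * ennreal (norm (D (x + r *\<^sub>R \<omega>)))) \<partial>lborel)"
  proof (rule nn_integral_mono_AE)
    \<comment> \<open>The layer is defined by strict inequalities, so the endpoints r1 and r2 are
      discarded as null sets. The factor \<open>norm \<omega>\<close> is dropped because it is at
      most 1.\<close>
    show "AE r in lborel. indicator {r1..r2} r * ennreal (norm \<omega> * norm (D (x + r *\<^sub>R \<omega>)))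
      \<le> indicator {0..} r * (indicator {y. a < \<bar>\<phi> y\<bar> \<and> \<bar>\<phi> y\<bar> < 2 * a} (x + r *\<^sub>R \<omega>)
        * ennreal (norm (D (x + r *\<^sub>R \<omega>))))"
      using AE_lborel_singleton[of r1] AE_lborel_singleton[of r2]
    proof eventually_elim
      case (elim r)
      show ?case
      proof (cases "r \<in> {r1..r2}")
        case True
        then have "r1 < r" "r < r2" using elim by auto
        then show ?thesis using between[of r] r1(1) assms(4)
          by (auto simp: \<gamma>_def indicator_def intro!: ennreal_leI mult_left_le_one_le)
      qed simp
    qed
  qed
  finally show ?thesis .
qed

text \<open>Averaging the ray estimate over directions in the unit ball, the part $r \le R$ of the rays is
  controlled by Fubini and translation, and the part $r \ge R$ by the dilation factor $r^{-N}$.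
  The radius $R$ is chosen as $|E|^{1/N}$.\<close>

lemma weak_isoperimetric:
  assumes "a > 0" "DIM('a) \<ge> 2"
  defines "E \<equiv> {y. 2 * a \<le> \<bar>\<phi> y\<bar>}"
  defines "F \<equiv> \<lambda>y. indicator {y. a < \<bar>\<phi> y\<bar> \<and> \<bar>\<phi> y\<bar> < 2 * a} y * ennreal (norm (D y))"
  defines "m \<equiv> measure lborel E"
  defines "\<beta> \<equiv> measure lborel (ball (0::'a) 1)"
  shows "ennreal (a * m) \<le> ennreal ((1 + 1 / ((real DIM('a) - 1) * \<beta>)) * m powr (1 / real DIM('a))) * (\<integral>\<^sup>+y. F y \<partial>lborel)"
proof (cases "m = 0")
  case False
  define \<nu> where "\<nu> = real DIM('a)"
  define R where "R = m powr (1 / \<nu>)"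
  define B where "B = ball (0::'a) 1"
  define G where "G = (\<integral>\<^sup>+y. F y \<partial>lborel)"
  have \<nu>: "\<nu> \<ge> 2" using assms(2) by (simp add: \<nu>_def)
  have "m > 0" using False by (simp add: m_def less_le)
  then have R: "R > 0" "R powr \<nu> = m" using \<nu> by (simp_all add: R_def powr_powr)
  have \<beta>: "\<beta> > 0" unfolding \<beta>_def using content_ball_pos[of 1 "0::'a"] by simp
  have [measurable]: "E \<in> sets borel" unfolding E_def by measurable
  have [measurable]: "F \<in> borel_measurable borel" unfolding F_def by measurable
  have [measurable]: "B \<in> sets borel" unfolding B_def by simp
  have "E \<subseteq> K" using supp assms(1) by (force simp: E_def)
  then have "emeasure lborel E < \<infinity>"
    using compact_K compact_imp_bounded bounded_subset emeasure_bounded_finite by blast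
  then have emE: "emeasure lborel E = ennreal m" unfolding m_def by (simp add: emeasure_eq_ennreal_measure)
  have emB: "emeasure lborel B = ennreal \<beta>" unfolding B_def \<beta>_def
    using emeasure_lborel_ball_finite[of "0::'a" 1] by (simp add: emeasure_eq_ennreal_measure)
  \<comment> \<open>The estimate on one ray is integrated over starting points x in E and directions
    in the unit ball; the direction 0, for which there is no ray, is a null set.\<close>
  have "ennreal (a * m * \<beta>) = (\<integral>\<^sup>+x. (\<integral>\<^sup>+\<omega>. ennreal a * indicator B \<omega> * indicator E x \<partial>lborel) \<partial>lborel)"
    using assms(1) \<open>m > 0\<close> \<beta>
    by (simp add: nn_integral_cmult nn_integral_multc emE emB ennreal_mult mult_ac)
  also have "\<dots> \<le> (\<integral>\<^sup>+x. (\<integral>\<^sup>+\<omega>. (\<integral>\<^sup>+r. indicator E x * (indicator B \<omega> * (indicator {0..} r * F (x + r *\<^sub>R \<omega>))) \<partial>lborel) \<partial>lborel) \<partial>lborel)"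
  proof (rule nn_integral_mono, rule nn_integral_mono_AE)
    fix x
    show "AE \<omega> in lborel. ennreal a * indicator B \<omega> * indicator E x
      \<le> (\<integral>\<^sup>+r. indicator E x * (indicator B \<omega> * (indicator {0..} r * F (x + r *\<^sub>R \<omega>))) \<partial>lborel)"
      using AE_lborel_singleton[of 0]
    proof eventually_elim
      case (elim \<omega>)
      show ?case
      proof (cases "x \<in> E \<and> \<omega> \<in> B")
        case True
        then show ?thesis using ray_crossing[OF assms(1), of x \<omega>] elim
          by (simp add: E_def B_def F_def)
      qed (auto simp: indicator_def)
    qed
  qed
  also have "\<dots> = (\<integral>\<^sup>+x. (\<integral>\<^sup>+r. (\<integral>\<^sup>+\<omega>. indicator E x * (indicator B \<omega> * (indicator {0..} r * F (x + r *\<^sub>R \<omega>))) \<partial>lborel) \<partial>lborel) \<partial>lborel)"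
    by (intro nn_integral_cong lborel_pair.Fubini') measurable
  also have "\<dots> = (\<integral>\<^sup>+r. (\<integral>\<^sup>+x. (\<integral>\<^sup>+\<omega>. indicator E x * (indicator B \<omega> * (indicator {0..} r * F (x + r *\<^sub>R \<omega>))) \<partial>lborel) \<partial>lborel) \<partial>lborel)"
    by (intro lborel_pair.Fubini') measurable
  also have "\<dots> \<le> (\<integral>\<^sup>+r. indicator {0..R} r * (ennreal \<beta> * G) + (ennreal (r powr (- \<nu>)) * indicator {R..} r) * (ennreal m * G) \<partial>lborel)"
  proof (rule nn_integral_mono)
    fix r :: real
    show "(\<integral>\<^sup>+x. (\<integral>\<^sup>+\<omega>. indicator E x * (indicator B \<omega> * (indicator {0..} r * F (x + r *\<^sub>R \<omega>))) \<partial>lborel) \<partial>lborel)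
      \<le> indicator {0..R} r * (ennreal \<beta> * G) + (ennreal (r powr (- \<nu>)) * indicator {R..} r) * (ennreal m * G)"
    proof -
      consider "r < 0" | "0 \<le> r" "r \<le> R" | "R < r" by linarith
      then show ?thesis
      proof cases
        case 2
        have "(\<integral>\<^sup>+x. (\<integral>\<^sup>+\<omega>. indicator E x * (indicator B \<omega> * (indicator {0..} r * F (x + r *\<^sub>R \<omega>))) \<partial>lborel) \<partial>lborel)
          \<le> (\<integral>\<^sup>+x. (\<integral>\<^sup>+\<omega>. indicator B \<omega> * F (x + r *\<^sub>R \<omega>) \<partial>lborel) \<partial>lborel)"
          by (intro nn_integral_mono) (auto simp: indicator_def)
        also have "\<dots> = (\<integral>\<^sup>+\<omega>. (\<integral>\<^sup>+x. indicator B \<omega> * F (x + r *\<^sub>R \<omega>) \<partial>lborel) \<partial>lborel)"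
          by (intro lborel_pair.Fubini') measurable
        also have "\<dots> = ennreal \<beta> * G"
          by (simp add: nn_integral_cmult nn_integral_multc nn_integral_lborel_shift emB G_def)
        finally show ?thesis using 2 by (simp add: add_increasing2)
      next
        case 3
        then have "r > 0" using R by linarith
        have "(\<integral>\<^sup>+x. (\<integral>\<^sup>+\<omega>. indicator E x * (indicator B \<omega> * (indicator {0..} r * F (x + r *\<^sub>R \<omega>))) \<partial>lborel) \<partial>lborel)
          \<le> (\<integral>\<^sup>+x. (\<integral>\<^sup>+\<omega>. indicator E x * F (x + r *\<^sub>R \<omega>) \<partial>lborel) \<partial>lborel)"
          by (intro nn_integral_mono) (auto simp: indicator_def)
        also have "\<dots> = (\<integral>\<^sup>+x. indicator E x * (ennreal (r powr (- \<nu>)) * G) \<partial>lborel)"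
        proof (rule nn_integral_cong)
          fix x
          have "G = ennreal (r ^ DIM('a)) * (\<integral>\<^sup>+\<omega>. F (x + r *\<^sub>R \<omega>) \<partial>lborel)"
            unfolding G_def using nn_integral_lborel_scale[of F r x] \<open>r > 0\<close> by simp
          then have "ennreal (r powr (- \<nu>)) * G = ennreal (r powr (- \<nu>) * r ^ DIM('a)) * (\<integral>\<^sup>+\<omega>. F (x + r *\<^sub>R \<omega>) \<partial>lborel)"
            using \<open>r > 0\<close> by (simp add: ennreal_mult mult.assoc)
          moreover have "r powr (- \<nu>) * r ^ DIM('a) = 1"
            using \<open>r > 0\<close> by (simp add: \<nu>_def powr_minus powr_realpow)
          ultimately show "(\<integral>\<^sup>+\<omega>. indicator E x * F (x + r *\<^sub>R \<omega>) \<partial>lborel) = indicator E x * (ennreal (r powr (- \<nu>)) * G)"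
            by (simp add: nn_integral_cmult)
        qed
        also have "\<dots> = ennreal (r powr (- \<nu>)) * (ennreal m * G)"
          by (subst nn_integral_multc) (simp_all add: emE mult_ac)
        finally show ?thesis using 3 by simp
      qed simp
    qed
  qed
  also have "\<dots> = ennreal R * (ennreal \<beta> * G) + (\<integral>\<^sup>+r. ennreal (r powr (- \<nu>)) * indicator {R..} r \<partial>lborel) * (ennreal m * G)"
    using R by (simp add: nn_integral_add nn_integral_multc)
  \<comment> \<open>The tail of the dilation factor is integrable because the dimension exceeds
    1.\<close>
  also have "(\<integral>\<^sup>+r. ennreal (r powr (- \<nu>)) * indicator {R..} r \<partial>lborel) = ennreal (0 - (- (R powr (1 - \<nu>)) / (\<nu> - 1)))"
  proof (rule nn_integral_FTC_atLeast)
    show "((\<lambda>r. - (r powr (1 - \<nu>)) / (\<nu> - 1)) has_real_derivative x powr (- \<nu>)) (at x)" if "R \<le> x" for x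
    proof -
      have "((\<lambda>r. r powr (1 - \<nu>)) has_real_derivative (1 - \<nu>) * x powr (1 - \<nu> - 1)) (at x)"
        using that R by (intro has_real_derivative_powr) auto
      from DERIV_cdivide[OF DERIV_minus[OF this], of "\<nu> - 1"]
      show ?thesis by (rule DERIV_cong) (use \<nu> in \<open>simp add: field_simps\<close>)
    qed
    have "((\<lambda>r. r powr (1 - \<nu>)) \<longlongrightarrow> 0) at_top"
      using \<nu> by (intro tendsto_neg_powr filterlim_ident) auto
    from tendsto_divide[OF tendsto_minus[OF this] tendsto_const[of "\<nu> - 1"]] \<nu>
    show "((\<lambda>r. - (r powr (1 - \<nu>)) / (\<nu> - 1)) \<longlongrightarrow> 0) at_top" by simp
  qed auto
  also have "0 - - (R powr (1 - \<nu>)) / (\<nu> - 1) = R powr (1 - \<nu>) / (\<nu> - 1)" by simp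
  also have "ennreal R * (ennreal \<beta> * G) + ennreal (R powr (1 - \<nu>) / (\<nu> - 1)) * (ennreal m * G)
      = (ennreal (R * \<beta>) + ennreal (R powr (1 - \<nu>) / (\<nu> - 1) * m)) * G"
    using R \<beta> \<nu> \<open>m > 0\<close> by (subst (1 2) ennreal_mult) (auto simp: distrib_right mult.assoc)
  also have "\<dots> = ennreal (R * \<beta> + R powr (1 - \<nu>) / (\<nu> - 1) * m) * G"
    using R \<beta> \<nu> \<open>m > 0\<close> by (subst ennreal_plus) auto
  \<comment> \<open>Here R^\<nu> = m is used: it turns the far contribution R^(1-\<nu>) m into R, so
    that near and far parts of the rays contribute the same power of m.\<close>
  also have "R powr (1 - \<nu>) / (\<nu> - 1) * m = R / (\<nu> - 1)"
    using R by (simp flip: R(2) powr_add)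
  finally have *: "ennreal (a * m * \<beta>) \<le> ennreal (R * \<beta> + R / (\<nu> - 1)) * G" .
  have "ennreal (a * m) = ennreal (1 / \<beta>) * ennreal (a * m * \<beta>)"
    using \<beta> assms(1) \<open>m > 0\<close> by (simp flip: ennreal_mult)
  also have "\<dots> \<le> ennreal (1 / \<beta>) * (ennreal (R * \<beta> + R / (\<nu> - 1)) * G)"
    using * by (rule mult_left_mono) simp
  also have "\<dots> = ennreal (1 / \<beta> * (R * \<beta> + R / (\<nu> - 1))) * G"
    using \<beta> \<nu> R by (subst ennreal_mult[of "1 / \<beta>"]) (simp_all only: mult.assoc, auto)
  also have "1 / \<beta> * (R * \<beta> + R / (\<nu> - 1)) = (1 + 1 / ((\<nu> - 1) * \<beta>)) * R"
    using \<beta> \<nu> by (simp add: field_simps)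
  finally show ?thesis unfolding G_def R_def \<nu>_def .
qed simp

end

context C1_compact_support begin

text \<open>Cauchy-Schwarz on the layer: the integral of |D| is at most the square root of the
  measure of the level set at a, which contains the layer, times the square root of the energy of
  the layer. Inserted into the weak isoperimetric inequality this relates two consecutive levels;
  squaring avoids the roots.\<close>

lemma level_step:
  assumes "a > 0" "DIM('a) \<ge> 2"
  defines "m \<equiv> \<lambda>a. measure lborel {y. a \<le> \<bar>\<phi> y\<bar>}"
  defines "\<beta> \<equiv> measure lborel (ball (0::'a) 1)"
  shows "(a * m (2 * a))\<^sup>2 \<le> ((1 + 1 / ((real DIM('a) - 1) * \<beta>)) * m (2 * a) powr (1 / real DIM('a)))\<^sup>2 *
    (m a * (LINT y|lborel. indicator {y. a < \<bar>\<phi> y\<bar> \<and> \<bar>\<phi> y\<bar> < 2 * a} y * (norm (D y))\<^sup>2))"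
proof -
  define A where "A = {y. a < \<bar>\<phi> y\<bar> \<and> \<bar>\<phi> y\<bar> < 2 * a}"
  define F where "F y = indicator A y * ennreal (norm (D y))" for y
  define b where "b = (LINT y|lborel. indicator A y * (norm (D y))\<^sup>2)"
  define c where "c = 1 + 1 / ((real DIM('a) - 1) * \<beta>)"
  define R where "R = m (2 * a) powr (1 / real DIM('a))"
  have [measurable]: "A \<in> sets borel" unfolding A_def by measurable
  have [measurable]: "F \<in> borel_measurable borel" unfolding F_def by measurable
  have c: "c \<ge> 0" using assms(2) by (simp add: c_def \<beta>_def)
  have R: "R \<ge> 0" by (simp add: R_def)
  have b: "b \<ge> 0" unfolding b_def by (intro integral_nonneg_AE) auto
  have E: "emeasure lborel {y. a \<le> \<bar>\<phi> y\<bar>} = ennreal (m a)"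
  proof -
    have "{y. a \<le> \<bar>\<phi> y\<bar>} \<subseteq> K" using supp assms(1) by force
    then have "emeasure lborel {y. a \<le> \<bar>\<phi> y\<bar>} < \<infinity>"
      using compact_K compact_imp_bounded bounded_subset emeasure_bounded_finite by blast
    then show ?thesis unfolding m_def by (simp add: emeasure_eq_ennreal_measure)
  qed
  have "integrable lborel (\<lambda>y. indicator A y * (norm (D y))\<^sup>2)"
    using integrable_mult_indicator[OF _ integrable_norm_D2, of A] by simp
  then have F2: "(\<integral>\<^sup>+y. F y ^ 2 \<partial>lborel) = ennreal b"
    unfolding b_def by (subst nn_integral_eq_integral[symmetric])
      (auto simp: F_def indicator_def ennreal_power intro!: nn_integral_cong)
  have "(\<integral>\<^sup>+y. F y \<partial>lborel) = (\<integral>\<^sup>+y. indicator {y. a \<le> \<bar>\<phi> y\<bar>} y * F y \<partial>lborel)"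
    by (intro nn_integral_cong) (auto simp: F_def A_def indicator_def)
  then have "(\<integral>\<^sup>+y. F y \<partial>lborel)\<^sup>2 \<le> (\<integral>\<^sup>+y. indicator {y. a \<le> \<bar>\<phi> y\<bar>} y ^ 2 \<partial>lborel) * (\<integral>\<^sup>+y. F y ^ 2 \<partial>lborel)"
    by (simp only:) (rule Cauchy_Schwarz_nn_integral; measurable)
  also have "(\<integral>\<^sup>+y. indicator {y. a \<le> \<bar>\<phi> y\<bar>} y ^ 2 \<partial>lborel) = (\<integral>\<^sup>+y. indicator {y. a \<le> \<bar>\<phi> y\<bar>} y \<partial>lborel)"
    by (intro nn_integral_cong) (auto simp: indicator_def)
  also have "\<dots> = ennreal (m a)" using E by simp
  finally have CS: "(\<integral>\<^sup>+y. F y \<partial>lborel)\<^sup>2 \<le> ennreal (m a) * ennreal b" unfolding F2 .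
  have "ennreal (a * m (2 * a)) \<le> ennreal (c * R) * (\<integral>\<^sup>+y. F y \<partial>lborel)"
    using weak_isoperimetric[OF assms(1,2)] unfolding F_def A_def c_def R_def m_def \<beta>_def .
  then have "ennreal (a * m (2 * a)) ^ 2 \<le> (ennreal (c * R) * (\<integral>\<^sup>+y. F y \<partial>lborel)) ^ 2"
    by (rule power_mono) simp
  also have "\<dots> \<le> ennreal (c * R) ^ 2 * (ennreal (m a) * ennreal b)"
    unfolding power_mult_distrib using CS by (rule mult_left_mono) simp
  also have "\<dots> = ennreal ((c * R)\<^sup>2 * (m a * b))"
  proof -
    have "ennreal (c * R) ^ 2 = ennreal ((c * R)\<^sup>2)" using c R by (intro ennreal_power) simp
    moreover have "ennreal (m a) * ennreal b = ennreal (m a * b)"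
      using b by (intro ennreal_mult[symmetric]) (auto simp: m_def)
    moreover have "ennreal ((c * R)\<^sup>2) * ennreal (m a * b) = ennreal ((c * R)\<^sup>2 * (m a * b))"
      using b by (intro ennreal_mult[symmetric]) (auto simp: m_def)
    ultimately show ?thesis by (simp only:)
  qed
  finally have "ennreal ((a * m (2 * a))\<^sup>2) \<le> ennreal ((c * R)\<^sup>2 * (m a * b))"
    using assms(1) by (simp add: ennreal_power m_def)
  then show ?thesis
    using b by (subst (asm) ennreal_le_iff) (auto simp: m_def c_def R_def b_def A_def)
qed

end

text \<open>Young's inequality with weights r and 1 - r, applied after moving powers of 2c between
  the factors so that the coefficient of a becomes 1/2. The condition r >= 1/2 makes the exponent
  r/(1-r) at least 1, and b <= 1 then replaces that power of b by b itself.\<close>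

lemma Young_absorb:
  fixes a b c r :: real
  assumes "a \<ge> 0" "0 \<le> b" "b \<le> 1" "c > 0" "1/2 \<le> r" "r < 1"
  shows "c * (a * b) powr r \<le> a / 2 + c * (2 * c) powr (r / (1 - r)) * b"
proof (cases "a = 0 \<or> b = 0")
  case False
  define s where "s = r / (1 - r)"
  have s: "s \<ge> 1" "s * (1 - r) = r" using assms by (simp_all add: s_def field_simps)
  have pos: "a > 0" "b > 0" using False assms by auto
  have "(a / (2 * c)) powr r * ((2 * c) powr s * b powr s) powr (1 - r)
      \<le> r * (a / (2 * c)) + (1 - r) * ((2 * c) powr s * b powr s)"
    using assms pos by (intro Youngs_inequality_0) auto
  also have "(a / (2 * c)) powr r * ((2 * c) powr s * b powr s) powr (1 - r) = (a * b) powr r"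
    using assms pos s by (simp add: powr_mult powr_divide powr_powr)
  also have "r * (a / (2 * c)) + (1 - r) * ((2 * c) powr s * b powr s) \<le> a / (2 * c) + (2 * c) powr s * b"
  proof (rule add_mono)
    show "r * (a / (2 * c)) \<le> a / (2 * c)" using assms by (intro mult_left_le_one_le) auto
    have "b powr s \<le> b powr 1" using assms s pos by (intro powr_mono') auto
    then have "(2 * c) powr s * b powr s \<le> (2 * c) powr s * b" using pos by (intro mult_left_mono) auto
    moreover have "(1 - r) * ((2 * c) powr s * b powr s) \<le> (2 * c) powr s * b powr s"
      using assms by (intro mult_left_le_one_le) auto
    ultimately show "(1 - r) * ((2 * c) powr s * b powr s) \<le> (2 * c) powr s * b" by linarith
  qed
  finally have "c * (a * b) powr r \<le> c * (a / (2 * c) + (2 * c) powr s * b)"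
    using assms by (intro mult_left_mono) auto
  also have "\<dots> = a / 2 + c * (2 * c) powr s * b" using assms by (simp add: field_simps)
  finally show ?thesis by (simp add: s_def)
qed (use assms in auto)

text \<open>Solving for x gives x^(2 - 2/\<nu>) <= c^2 t^(-2) y z, and r is the inverse of the
  exponent on the left. The exponent q satisfies q = q r + 2 r, the relation that bounds t^q x by
  the r-th power of t^q y z; this is where the critical exponent comes from.\<close>

lemma dyadic_step:
  fixes c x y z t \<nu> :: real
  assumes \<nu>: "\<nu> > 2" and "c > 0" "x \<ge> 0" "y \<ge> 0" "z \<ge> 0" "t > 0"
    and step: "(t * x)\<^sup>2 \<le> (c * x powr (1 / \<nu>))\<^sup>2 * (y * z)"
  defines "q \<equiv> 2 * \<nu> / (\<nu> - 2)" and "r \<equiv> \<nu> / (2 * (\<nu> - 1))"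
  shows "t powr q * x \<le> (c\<^sup>2) powr r * (t powr q * y * z) powr r"
proof (cases "x = 0")
  case False
  have x: "x > 0" using False assms by simp
  have r: "(2 - 2 / \<nu>) * r = 1" "r > 0" using \<nu> by (simp_all add: r_def field_simps)
  have "1 - r = (\<nu> - 2) / (2 * (\<nu> - 1))" using \<nu> by (simp add: r_def field_simps)
  then have "q * (1 - r) = 2 * r" using \<nu> by (simp add: q_def r_def)
  then have q: "q = q * r + 2 * r" by (simp add: algebra_simps)
  have "x powr (2 - 2 / \<nu>) = x\<^sup>2 / x powr (2 / \<nu>)"
    using x by (simp add: powr_diff)
  also have "\<dots> = (t * x)\<^sup>2 / (t\<^sup>2 * x powr (2 / \<nu>))"
    using x assms by (simp add: field_simps)
  also have "\<dots> \<le> ((c * x powr (1 / \<nu>))\<^sup>2 * (y * z)) / (t\<^sup>2 * x powr (2 / \<nu>))"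
    using step by (rule divide_right_mono) simp
  also have "(c * x powr (1 / \<nu>))\<^sup>2 = c\<^sup>2 * x powr (2 / \<nu>)"
    using x by (simp add: power_mult_distrib powr_powr flip: powr_numeral)
  also have "c\<^sup>2 * x powr (2 / \<nu>) * (y * z) / (t\<^sup>2 * x powr (2 / \<nu>)) = c\<^sup>2 * (t powr (-2) * (y * z))"
    using x assms by (simp add: field_simps powr_minus)
  finally have "x powr (2 - 2 / \<nu>) \<le> c\<^sup>2 * (t powr (-2) * (y * z))" .
  then have "(x powr (2 - 2 / \<nu>)) powr r \<le> (c\<^sup>2 * (t powr (-2) * (y * z))) powr r"
    using r by (intro powr_mono2) auto
  also have "(x powr (2 - 2 / \<nu>)) powr r = x" using x r by (simp add: powr_powr)
  also have "(c\<^sup>2 * (t powr (-2) * (y * z))) powr r = (c\<^sup>2) powr r * (t powr (- (2 * r)) * (y * z) powr r)"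
    using assms by (simp add: powr_mult powr_powr)
  finally have "t powr q * x \<le> t powr q * ((c\<^sup>2) powr r * (t powr (- (2 * r)) * (y * z) powr r))"
    by (rule mult_left_mono) simp
  also have "\<dots> = (c\<^sup>2) powr r * (t powr (q + - (2 * r)) * (y * z) powr r)"
    by (simp only: powr_add mult_ac)
  also have "q + - (2 * r) = q * r" using q by linarith
  also have "t powr (q * r) * (y * z) powr r = (t powr q * y * z) powr r"
    using assms by (simp add: powr_mult powr_powr mult.assoc)
  finally show ?thesis .
qed simp

lemma crit_exp_gt_2: "N \<ge> 3 \<Longrightarrow> crit_exp N > 2"
  by (simp add: crit_exp_def field_simps)

text \<open>Each step reads a(k+1) <= a(k)/2 + C b(k). Summed, the half is absorbed on the left,
  which is legitimate because the sums are finite; the factor 2 in the result is the price, and the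
  bound does not depend on n.\<close>

lemma dyadic_sum_bound:
  fixes m b :: "nat \<Rightarrow> real" and c :: real and N :: nat
  assumes N: "N \<ge> 3" and c: "c > 0" and m: "\<And>k. m k \<ge> 0" and b: "\<And>k. b k \<ge> 0"
    and sum_b: "\<And>n. (\<Sum>k<n. b k) \<le> 1"
    and step: "\<And>k. (2 ^ k * m (Suc k))\<^sup>2 \<le> (c * m (Suc k) powr (1 / real N))\<^sup>2 * (m k * b k)"
  defines "q \<equiv> crit_exp N" and "r \<equiv> real N / (2 * (real N - 1))"
  defines "c' \<equiv> 2 powr q * (c\<^sup>2) powr r"
  shows "(\<Sum>k<n. 2 powr (q * k) * m k) \<le> 2 * m 0 + 2 * (c' * (2 * c') powr (r / (1 - r)))"
proof -
  define a where "a k = 2 powr (q * real k) * m k" for k :: nat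
  define C where "C = c' * (2 * c') powr (r / (1 - r))"
  have c': "c' > 0" using c by (simp add: c'_def)
  have C: "C \<ge> 0" using c' by (simp add: C_def)
  have r: "1/2 \<le> r" "r < 1" using N by (simp_all add: r_def field_simps)
  have a: "a k \<ge> 0" for k using m by (simp add: a_def)
  have b1: "b k \<le> 1" for k
    using sum_b[of "Suc k"] sum_nonneg[of "{..<k}" b] b by simp
  have a_Suc: "a (Suc k) \<le> a k / 2 + C * b k" for k
  proof -
    have "(2 ^ k) powr q * m (Suc k) \<le> (c\<^sup>2) powr r * ((2 ^ k) powr q * m k * b k) powr r"
      unfolding q_def r_def crit_exp_def using N c m b step by (intro dyadic_step) auto
    moreover have "(2 ^ k) powr q = (2::real) powr (q * real k)"
      by (simp add: powr_powr mult.commute flip: powr_realpow)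
    moreover have "a (Suc k) = 2 powr q * (2 powr (q * real k) * m (Suc k))"
      by (simp add: a_def distrib_left powr_add)
    ultimately have "a (Suc k) \<le> 2 powr q * ((c\<^sup>2) powr r * (a k * b k) powr r)"
      unfolding a_def by (metis mult_left_mono powr_ge_zero)
    then have "a (Suc k) \<le> c' * (a k * b k) powr r" by (simp only: c'_def mult.assoc)
    also have "\<dots> \<le> a k / 2 + C * b k"
      unfolding C_def using a b b1 c' r by (intro Young_absorb) auto
    finally show ?thesis .
  qed
  have "(\<Sum>k<Suc n. a k) \<le> a 0 + (\<Sum>k<n. a k / 2 + C * b k)"
    unfolding sum.lessThan_Suc_shift using a_Suc by (intro add_left_mono sum_mono)
  also have "(\<Sum>k<n. a k / 2 + C * b k) = (\<Sum>k<n. a k) / 2 + C * (\<Sum>k<n. b k)"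
    by (simp add: sum.distrib sum_divide_distrib sum_distrib_left)
  also have "C * (\<Sum>k<n. b k) \<le> C" using mult_left_mono[OF sum_b C] by simp
  finally have "(\<Sum>k<Suc n. a k) \<le> a 0 + ((\<Sum>k<n. a k) / 2 + C)" by simp
  moreover have "(\<Sum>k<n. a k) \<le> (\<Sum>k<Suc n. a k)" using a by simp
  ultimately have "(\<Sum>k<n. a k) \<le> a 0 + ((\<Sum>k<n. a k) / 2 + C)" using order_trans by blast
  then show ?thesis unfolding C_def[symmetric] by (simp add: a_def[symmetric]) (simp add: a_def)
qed

text \<open>The layers are disjoint. The right-hand side is sharper than 1 to make the induction
  work: at stage n everything counted so far lies below 2^n.\<close>

lemma sum_dyadic_indicators_le_1:
  fixes t :: real
  shows "(\<Sum>k<n. indicator {t. 2 ^ k < t \<and> t < 2 * 2 ^ k} t) \<le> (indicator {..<2 ^ n} t :: real)"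
proof (induction n)
  case (Suc n)
  have "(0::real) < 2 ^ n" by simp
  then have "indicator {..<2 ^ n} t + indicator {t. 2 ^ n < t \<and> t < 2 * 2 ^ n} t \<le> (indicator {..<2 ^ Suc n} t :: real)"
  proof (cases "t < 2 ^ n")
    case True
    then have "t < 2 ^ Suc n" using \<open>0 < 2 ^ n\<close> unfolding power_Suc by linarith
    then show ?thesis using True by (simp add: indicator_def)
  qed (auto simp: indicator_def)
  then show ?case using Suc unfolding sum.lessThan_Suc by linarith
qed simp

text \<open>The summand 1 covers t below the first level. Otherwise the largest level not exceeding
  t already suffices, the factor 2^q accounting for the next dyadic value.\<close>

lemma powr_le_dyadic_sum:
  fixes t q :: real
  assumes "0 \<le> t" "t < 2 ^ n" "q \<ge> 0"
  shows "t powr q \<le> 1 + (\<Sum>k<n. 2 powr q * (2 powr (q * real k) * indicator {2 ^ k..} t))"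
  using assms(2)
proof (induction n)
  case 0
  then show ?case using assms powr_le1[of q t] by simp
next
  case (Suc n)
  show ?case
  proof (cases "t < 2 ^ n")
    case True
    then show ?thesis using Suc.IH by (simp add: add_increasing2)
  next
    case False
    have "t powr q \<le> (2 ^ Suc n) powr q" using Suc.prems assms by (intro powr_mono2) auto
    also have "\<dots> = 2 powr q * (2 powr (q * real n))"
      by (simp add: powr_mult powr_powr mult.commute flip: powr_realpow)
    moreover have "0 \<le> (\<Sum>k<n. 2 powr q * (2 powr (q * real k) * indicator {2 ^ k..} t))"
      by (intro sum_nonneg) auto
    ultimately show ?thesis using False by simp
  qed
qed

lemma C1_compact_support_scale:
  assumes "C1_compact_support \<phi> D K"
  shows "C1_compact_support (\<lambda>x. c * \<phi> x) (\<lambda>x. c *\<^sub>R D x) K"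
proof -
  interpret C1_compact_support \<phi> D K by fact
  show ?thesis
  proof
    show "GDERIV (\<lambda>x. c * \<phi> x) x :> c *\<^sub>R D x" for x
      using GDERIV_mult[OF GDERIV_const grad] by simp
  qed (auto intro!: continuous_intros cont_D compact_K simp: supp)
qed

text \<open>The dyadic terms $2^{kq} |\{|\phi| \ge 2^k\}|$ are bounded by interpolation with
  their shifted neighbours and the energies between consecutive levels. Young's inequality absorbs the
  former into the sum itself, which starts at level $1$ and so costs the volume $V$.\<close>

lemma Sobolev_C1_normalized:
  fixes V :: real
  assumes N: "DIM('a::euclidean_space) \<ge> 3"
  obtains C where "C \<ge> 0" "\<And>(\<phi>::'a \<Rightarrow> real) D K. C1_compact_support \<phi> D K \<Longrightarrow> measure lborel K \<le> V \<Longrightarrow>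
    (LINT y|lborel. (norm (D y))\<^sup>2) \<le> 1 \<Longrightarrow> (LINT y|lborel. \<bar>\<phi> y\<bar> powr crit_exp DIM('a)) \<le> C"
proof -
  define q where "q = crit_exp DIM('a)"
  have q: "q > 2" using crit_exp_gt_2[OF N] by (simp add: q_def)
  define r where "r = real DIM('a) / (2 * (real DIM('a) - 1))"
  define c where "c = 1 + 1 / ((real DIM('a) - 1) * measure lborel (ball (0::'a) 1))"
  define c' where "c' = 2 powr q * (c\<^sup>2) powr r"
  define C where "C = V + 2 powr q * (2 * V + 2 * (c' * (2 * c') powr (r / (1 - r))))"
  have c: "c > 0" using N by (auto simp: c_def intro!: add_pos_nonneg)
  have "(LINT y|lborel. \<bar>\<phi> y\<bar> powr q) \<le> C"
    if C1: "C1_compact_support \<phi> D K" and V: "measure lborel K \<le> V"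
      and D1: "(LINT y|lborel. (norm (D y))\<^sup>2) \<le> 1" for \<phi> :: "'a \<Rightarrow> real" and D K
  proof -
    interpret C1_compact_support \<phi> D K by fact
    define m where "m k = measure lborel {y. 2 ^ k \<le> \<bar>\<phi> y\<bar>}" for k :: nat
    define A where "A k = {y. 2 ^ k < \<bar>\<phi> y\<bar> \<and> \<bar>\<phi> y\<bar> < 2 * 2 ^ k}" for k :: nat
    define b where "b k = (LINT y|lborel. indicator (A k) y * (norm (D y))\<^sup>2)" for k
    have [measurable]: "A k \<in> sets borel" for k unfolding A_def by measurable
    have [measurable]: "K \<in> sets borel" using compact_K by (simp add: borel_compact)
    have finK: "emeasure lborel K < \<infinity>" using compact_K compact_imp_bounded emeasure_bounded_finite by blast
    have finE: "emeasure lborel {y. 2 ^ k \<le> \<bar>\<phi> y\<bar>} < \<infinity>" for k :: nat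
    proof -
      have "{y. 2 ^ k \<le> \<bar>\<phi> y\<bar>} \<subseteq> K"
      proof
        fix y assume y: "y \<in> {y. 2 ^ k \<le> \<bar>\<phi> y\<bar>}"
        have "(0::real) < 2 ^ k" by simp
        moreover have "2 ^ k \<le> \<bar>\<phi> y\<bar>" using y by blast
        ultimately have "\<phi> y \<noteq> 0" by linarith
        then show "y \<in> K" using supp by blast
      qed
      then show ?thesis
        using compact_K compact_imp_bounded bounded_subset emeasure_bounded_finite by blast
    qed
    have intA: "integrable lborel (\<lambda>y. indicator (A k) y * (norm (D y))\<^sup>2)" for k
      using integrable_mult_indicator[OF _ integrable_norm_D2, of "A k"] by simp
    have "(\<Sum>k<n. b k) \<le> 1" for n
    proof -
      have "(\<Sum>k<n. b k) = (LINT y|lborel. (\<Sum>k<n. indicator (A k) y * (norm (D y))\<^sup>2))"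
        unfolding b_def by (rule Bochner_Integration.integral_sum[symmetric]) (rule intA)
      also have "\<dots> \<le> (LINT y|lborel. (norm (D y))\<^sup>2)"
      proof (rule integral_mono)
        fix y
        have "indicator (A k) y = (indicator {t. 2 ^ k < t \<and> t < 2 * 2 ^ k} \<bar>\<phi> y\<bar> :: real)" for k
          by (simp add: A_def indicator_def)
        then have "(\<Sum>k<n. indicator (A k) y :: real) \<le> indicator {..<2 ^ n} \<bar>\<phi> y\<bar>"
          using sum_dyadic_indicators_le_1[of "\<bar>\<phi> y\<bar>" n] by (simp only:)
        also have "\<dots> \<le> 1" by (simp add: indicator_def)
        finally have "(\<Sum>k<n. indicator (A k) y) * (norm (D y))\<^sup>2 \<le> 1 * (norm (D y))\<^sup>2"
          by (rule mult_right_mono) simp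
        then show "(\<Sum>k<n. indicator (A k) y * (norm (D y))\<^sup>2) \<le> (norm (D y))\<^sup>2"
          by (simp only: sum_distrib_right mult_1)
        show "integrable lborel (\<lambda>y. \<Sum>k<n. indicator (A k) y * (norm (D y))\<^sup>2)"
          by (rule Bochner_Integration.integrable_sum) (rule intA)
      qed (rule integrable_norm_D2)
      finally show ?thesis using D1 by linarith
    qed
    moreover have "(2 ^ k * m (Suc k))\<^sup>2 \<le> (c * m (Suc k) powr (1 / real DIM('a)))\<^sup>2 * (m k * b k)" for k
      using level_step[of "2 ^ k"] N by (simp add: m_def b_def c_def A_def)
    moreover have "b k \<ge> 0" for k unfolding b_def by (intro integral_nonneg_AE) auto
    ultimately have sum_m: "(\<Sum>k<n. 2 powr (q * real k) * m k) \<le> 2 * m 0 + 2 * (c' * (2 * c') powr (r / (1 - r)))" for n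
      unfolding q_def r_def c'_def using N c by (intro dyadic_sum_bound[where b = b]) (auto simp: m_def)
    have m0: "m 0 \<le> V"
    proof -
      have "m 0 \<le> measure lborel K" unfolding m_def
        by (intro measure_mono_fmeasurable) (use supp finK in \<open>force simp: fmeasurable_def\<close>)+
      then show ?thesis using V by linarith
    qed
    obtain B where B: "\<And>y. \<bar>\<phi> y\<bar> \<le> B"
    proof -
      have "bounded (\<phi> ` K)" using compact_K cont
        by (intro compact_imp_bounded compact_continuous_image) (auto intro: continuous_on_subset)
      then obtain B where B: "\<And>y. y \<in> K \<Longrightarrow> \<bar>\<phi> y\<bar> \<le> B" "B > 0" by (auto simp: bounded_pos)
      then have "\<bar>\<phi> y\<bar> \<le> B" for y using supp[of y] by (cases "y \<in> K") auto
      then show thesis using that by blast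
    qed
    \<comment> \<open>The number of levels depends on the function, but \<open>sum_m\<close> holds
      for every n with the same right-hand side.\<close>
    obtain n :: nat where "B < 2 ^ n" using real_arch_pow[of 2 B] by auto
    have "\<bar>\<phi> y\<bar> powr q \<le> indicator K y + (\<Sum>k<n. 2 powr q * (2 powr (q * real k) * indicator {y. 2 ^ k \<le> \<bar>\<phi> y\<bar>} y))" for y
    proof (cases "y \<in> K")
      case True
      then show ?thesis using powr_le_dyadic_sum[of "\<bar>\<phi> y\<bar>" n q] B[of y] \<open>B < 2 ^ n\<close> q
        by (simp add: indicator_def)
    next
      case False
      then show ?thesis using supp by (auto intro!: sum_nonneg)
    qed
    then have "(LINT y|lborel. \<bar>\<phi> y\<bar> powr q)
      \<le> (LINT y|lborel. indicator K y + (\<Sum>k<n. 2 powr q * (2 powr (q * real k) * indicator {y. 2 ^ k \<le> \<bar>\<phi> y\<bar>} y)))"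
      using finK finE by (intro integral_mono') (auto intro!: integrable_add integrable_sum add_nonneg_nonneg sum_nonneg)
    also have "\<dots> = measure lborel K + 2 powr q * (\<Sum>k<n. 2 powr (q * real k) * m k)"
      using finK finE by (subst Bochner_Integration.integral_add) (auto simp: m_def sum_distrib_left integral_sum)
    also have "\<dots> \<le> C"
      unfolding C_def using V m0 sum_m[of n] by (intro add_mono mult_left_mono) auto
    finally show ?thesis .
  qed
  \<comment> \<open>V is an arbitrary real number, so C itself may be negative.\<close>
  then have "(LINT y|lborel. \<bar>\<phi> y\<bar> powr q) \<le> max 0 C"
    if "C1_compact_support \<phi> D K" "measure lborel K \<le> V" "(LINT y|lborel. (norm (D y))\<^sup>2) \<le> 1"
    for \<phi> :: "'a \<Rightarrow> real" and D K using that by fastforce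
  then show thesis using that[of "max 0 C"] unfolding q_def by auto
qed

text \<open>Scaling by 1/sqrt s reduces to energy at most 1. The form with an arbitrary bound s > 0
  on the energy also covers zero energy and lets s approach the energy of a limit.\<close>

lemma Sobolev_C1:
  fixes V :: real
  assumes N: "DIM('a::euclidean_space) \<ge> 3"
  obtains C where "C \<ge> 0" "\<And>(\<phi>::'a \<Rightarrow> real) D K s. C1_compact_support \<phi> D K \<Longrightarrow> measure lborel K \<le> V \<Longrightarrow> s > 0 \<Longrightarrow>
    (LINT y|lborel. (norm (D y))\<^sup>2) \<le> s \<Longrightarrow>
    (LINT y|lborel. \<bar>\<phi> y\<bar> powr crit_exp DIM('a)) \<le> C * s powr (crit_exp DIM('a) / 2)"
proof -
  define q where "q = crit_exp DIM('a)"
  obtain C where "C \<ge> 0" and C: "\<And>(\<phi>::'a \<Rightarrow> real) D K. C1_compact_support \<phi> D K \<Longrightarrow> measure lborel K \<le> V \<Longrightarrow>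
    (LINT y|lborel. (norm (D y))\<^sup>2) \<le> 1 \<Longrightarrow> (LINT y|lborel. \<bar>\<phi> y\<bar> powr q) \<le> C"
    using that unfolding q_def by (rule Sobolev_C1_normalized[OF N, of V])
  have "(LINT y|lborel. \<bar>\<phi> y\<bar> powr q) \<le> C * s powr (q / 2)"
    if C1: "C1_compact_support \<phi> D K" "measure lborel K \<le> V" and s: "s > 0"
      and Ds: "(LINT y|lborel. (norm (D y))\<^sup>2) \<le> s" for \<phi> :: "'a \<Rightarrow> real" and D K s
  proof -
    have "(LINT y|lborel. (norm ((1 / sqrt s) *\<^sub>R D y))\<^sup>2) = (1 / s) * (LINT y|lborel. (norm (D y))\<^sup>2)"
      using s by (simp add: power_divide)
    also have "\<dots> \<le> 1" using Ds s by (simp add: field_simps)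
    finally have "(LINT y|lborel. \<bar>(1 / sqrt s) * \<phi> y\<bar> powr q) \<le> C"
      by (intro C[OF C1_compact_support_scale[OF C1(1)] C1(2)])
    moreover have "(\<lambda>y. \<bar>(1 / sqrt s) * \<phi> y\<bar> powr q) = (\<lambda>y. (1 / s powr (q / 2)) * \<bar>\<phi> y\<bar> powr q)"
      using s by (intro ext) (simp add: abs_mult powr_divide powr_half_sqrt[symmetric] powr_powr)
    ultimately have "(1 / s powr (q / 2)) * (LINT y|lborel. \<bar>\<phi> y\<bar> powr q) \<le> C" by simp
    then show ?thesis using s by (simp add: field_simps)
  qed
  then show thesis using that \<open>C \<ge> 0\<close> unfolding q_def by blast
qed

section \<open>Rellich compactness for $C^1$ functions\<close>

text \<open>The average over a ball without the division by its volume \<beta>; it is compared with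
  \<beta> times the function instead.\<close>

definition ball_integral :: "real \<Rightarrow> ('a::euclidean_space \<Rightarrow> real) \<Rightarrow> 'a \<Rightarrow> real" where
  "ball_integral \<rho> \<phi> x = (LINT y|lborel. indicator (ball 0 \<rho>) y * \<phi> (x + y))"

context C1_compact_support begin

lemma integrable_shift:
  fixes f :: "'a \<Rightarrow> real"
  assumes "integrable lborel f"
  shows "integrable lborel (\<lambda>y. f (x + y))" "(LINT y|lborel. f (x + y)) = (LINT y|lborel. f y)"
proof -
  have [measurable]: "f \<in> borel_measurable borel" using assms by auto
  have "integrable (distr lborel borel ((+) x)) f" using assms by (simp add: lborel_distr_plus)
  then show "integrable lborel (\<lambda>y. f (x + y))" by (simp add: integrable_distr_eq)
  have "(LINT y|lborel. f y) = integral\<^sup>L (distr lborel borel ((+) x)) f" by (simp add: lborel_distr_plus)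
  also have "\<dots> = (LINT y|lborel. f (x + y))" by (rule integral_distr) auto
  finally show "(LINT y|lborel. f (x + y)) = (LINT y|lborel. f y)" by simp
qed

text \<open>The increment is integrated along the segment from x to x + z and the integrals are
  exchanged: each translate of the gradient has the same L^1 norm, so only the length of z
  remains.\<close>

lemma nn_integral_shift_diff:
  "(\<integral>\<^sup>+x. ennreal \<bar>\<phi> (x + z) - \<phi> x\<bar> \<partial>lborel) \<le> ennreal (norm z * (LINT x|lborel. norm (D x)))"
proof -
  have G: "(\<integral>\<^sup>+x. ennreal (norm (D x)) \<partial>lborel) = ennreal (LINT x|lborel. norm (D x))"
    by (rule nn_integral_eq_integral[OF integrable_norm_D]) simp
  have "(\<integral>\<^sup>+x. ennreal \<bar>\<phi> (x + z) - \<phi> x\<bar> \<partial>lborel)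
      \<le> (\<integral>\<^sup>+x. (\<integral>\<^sup>+r. indicator {0..1} r * ennreal (norm z * norm (D (x + r *\<^sub>R z))) \<partial>lborel) \<partial>lborel)"
  proof (rule nn_integral_mono)
    fix x
    show "ennreal \<bar>\<phi> (x + z) - \<phi> x\<bar> \<le> (\<integral>\<^sup>+r. indicator {0..1} r * ennreal (norm z * norm (D (x + r *\<^sub>R z))) \<partial>lborel)"
      using line_increment[OF grad cont_D, of 0 1 x z] by simp
  qed
  also have "\<dots> = (\<integral>\<^sup>+r. (\<integral>\<^sup>+x. indicator {0..1} r * ennreal (norm z * norm (D (x + r *\<^sub>R z))) \<partial>lborel) \<partial>lborel)"
    by (intro lborel_pair.Fubini') measurable
  also have "\<dots> = (\<integral>\<^sup>+r. indicator {0..1::real} r * (ennreal (norm z) * ennreal (LINT x|lborel. norm (D x))) \<partial>lborel)"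
  proof (rule nn_integral_cong)
    fix r :: real
    show "(\<integral>\<^sup>+x. indicator {0..1} r * ennreal (norm z * norm (D (x + r *\<^sub>R z))) \<partial>lborel)
      = indicator {0..1} r * (ennreal (norm z) * ennreal (LINT x|lborel. norm (D x)))"
      using nn_integral_lborel_shift[of "\<lambda>x. ennreal (norm (D x))" "r *\<^sub>R z"]
      by (simp add: nn_integral_cmult ennreal_mult G)
  qed
  also have "\<dots> = ennreal (norm z) * ennreal (LINT x|lborel. norm (D x))"
    by (subst nn_integral_multc) auto
  finally show ?thesis by (simp add: ennreal_mult)
qed

lemma integral_shift_diff:
  "(LINT y|lborel. \<bar>\<phi> (x + y) - \<phi> (x' + y)\<bar>) \<le> norm (x - x') * (LINT x|lborel. norm (D x))"
proof -
  have i: "integrable lborel (\<lambda>y. \<bar>\<phi> ((x - x') + y) - \<phi> y\<bar>)"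
    by (intro integrable_abs Bochner_Integration.integrable_diff integrable_shift integrable_phi)
  have "(LINT y|lborel. \<bar>\<phi> (x + y) - \<phi> (x' + y)\<bar>) = (LINT y|lborel. \<bar>\<phi> ((x - x') + y) - \<phi> y\<bar>)"
    using integrable_shift(2)[OF i, of x'] by (simp add: algebra_simps)
  moreover have "ennreal (LINT y|lborel. \<bar>\<phi> ((x - x') + y) - \<phi> y\<bar>) \<le> ennreal (norm (x - x') * (LINT x|lborel. norm (D x)))"
    using nn_integral_shift_diff[of "x - x'"] by (subst nn_integral_eq_integral[OF i, symmetric]) (simp_all add: add.commute)
  ultimately show ?thesis by (subst (asm) ennreal_le_iff) (auto intro!: mult_nonneg_nonneg)
qed

lemma integrable_ball: "integrable lborel (\<lambda>y. indicator (ball 0 \<rho>) y * \<phi> (x + y))"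
  using integrable_mult_indicator[OF _ integrable_shift(1)[OF integrable_phi], of "ball 0 \<rho>" x] by simp

lemma ball_integral_bound: "\<bar>ball_integral \<rho> \<phi> x\<bar> \<le> (LINT y|lborel. \<bar>\<phi> y\<bar>)"
proof -
  have "\<bar>ball_integral \<rho> \<phi> x\<bar> \<le> (LINT y|lborel. \<bar>indicator (ball 0 \<rho>) y * \<phi> (x + y)\<bar>)"
    unfolding ball_integral_def by (rule integral_abs_bound)
  also have "\<dots> \<le> (LINT y|lborel. \<bar>\<phi> (x + y)\<bar>)"
    using integrable_shift(1)[OF integrable_phi, of x] integrable_ball[of \<rho> x]
    by (intro integral_mono integrable_abs) (auto simp: indicator_def)
  also have "\<dots> = (LINT y|lborel. \<bar>\<phi> y\<bar>)"
    by (rule integrable_shift(2)[OF integrable_abs[OF integrable_phi]])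
  finally show ?thesis .
qed

text \<open>The constant does not depend on the radius \<rho>; an L^1 bound on the gradients alone
  makes the ball integrals of a whole family equicontinuous.\<close>

lemma ball_integral_Lipschitz:
  "\<bar>ball_integral \<rho> \<phi> x - ball_integral \<rho> \<phi> x'\<bar> \<le> norm (x - x') * (LINT y|lborel. norm (D y))"
proof -
  have "ball_integral \<rho> \<phi> x - ball_integral \<rho> \<phi> x'
      = (LINT y|lborel. indicator (ball 0 \<rho>) y * \<phi> (x + y) - indicator (ball 0 \<rho>) y * \<phi> (x' + y))"
    unfolding ball_integral_def by (intro Bochner_Integration.integral_diff[symmetric] integrable_ball)
  also have "\<bar>\<dots>\<bar> \<le> (LINT y|lborel. \<bar>indicator (ball 0 \<rho>) y * \<phi> (x + y) - indicator (ball 0 \<rho>) y * \<phi> (x' + y)\<bar>)"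
    by (rule integral_abs_bound)
  also have "\<dots> \<le> (LINT y|lborel. \<bar>\<phi> (x + y) - \<phi> (x' + y)\<bar>)"
    by (intro integral_mono integrable_abs Bochner_Integration.integrable_diff integrable_ball integrable_shift integrable_phi)
      (auto simp: indicator_def)
  also note integral_shift_diff
  finally show ?thesis .
qed

lemma measurable_ball_integral[measurable]: "ball_integral \<rho> \<phi> \<in> borel_measurable borel"
proof -
  have [measurable]: "ball (0::'a) \<rho> \<in> sets borel" by simp
  have "ball_integral \<rho> \<phi> \<in> borel_measurable lborel"
    unfolding ball_integral_def[abs_def] by (rule lborel.borel_measurable_lebesgue_integral) measurable
  then show ?thesis by simp
qed

text \<open>The difference is the integral of \<phi>(x) - \<phi>(x + y) over y in the ball. After
  exchanging the integrals each y contributes at most |y| times the L^1 norm of the gradient, and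
  |y| < \<rho>.\<close>

lemma ball_integral_approx:
  assumes "\<rho> > 0"
  defines "\<beta> \<equiv> measure lborel (ball (0::'a) \<rho>)"
  shows "integrable lborel (\<lambda>x. \<beta> * \<phi> x - ball_integral \<rho> \<phi> x)"
    and "(LINT x|lborel. \<bar>\<beta> * \<phi> x - ball_integral \<rho> \<phi> x\<bar>) \<le> \<beta> * (\<rho> * (LINT y|lborel. norm (D y)))"
proof -
  let ?G = "LINT y|lborel. norm (D y)"
  have [measurable]: "ball (0::'a) \<rho> \<in> sets borel" by simp
  have G: "?G \<ge> 0" by simp
  have \<beta>: "\<beta> \<ge> 0" by (simp add: \<beta>_def)
  have emb: "emeasure lborel (ball (0::'a) \<rho>) = ennreal \<beta>"
    unfolding \<beta>_def using emeasure_lborel_ball_finite[of "0::'a" \<rho>] by (simp add: emeasure_eq_ennreal_measure)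
  have int_ind: "integrable lborel (\<lambda>y. indicator (ball (0::'a) \<rho>) y * \<phi> x)" for x
  proof -
    have "integrable lborel (indicator (ball (0::'a) \<rho>) :: 'a \<Rightarrow> real)"
      by (rule integrable_real_indicator) (use emeasure_lborel_ball_finite[of "0::'a" \<rho>] in auto)
    then show ?thesis by simp
  qed
  have "(\<integral>\<^sup>+x. ennreal \<bar>\<beta> * \<phi> x - ball_integral \<rho> \<phi> x\<bar> \<partial>lborel)
      \<le> (\<integral>\<^sup>+x. (\<integral>\<^sup>+y. indicator (ball 0 \<rho>) y * ennreal \<bar>\<phi> (x + y) - \<phi> x\<bar> \<partial>lborel) \<partial>lborel)"
  proof (rule nn_integral_mono)
    fix x
    have "\<beta> * \<phi> x - ball_integral \<rho> \<phi> x = (LINT y|lborel. indicator (ball 0 \<rho>) y * \<phi> x - indicator (ball 0 \<rho>) y * \<phi> (x + y))"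
      unfolding ball_integral_def \<beta>_def by (subst Bochner_Integration.integral_diff[OF int_ind integrable_ball]) simp
    moreover have "ennreal (norm (LINT y|lborel. indicator (ball 0 \<rho>) y * \<phi> x - indicator (ball 0 \<rho>) y * \<phi> (x + y)))
        \<le> (\<integral>\<^sup>+y. norm (indicator (ball 0 \<rho>) y * \<phi> x - indicator (ball 0 \<rho>) y * \<phi> (x + y)) \<partial>lborel)"
      by (intro integral_norm_bound_ennreal Bochner_Integration.integrable_diff int_ind integrable_ball)
    moreover have "(\<integral>\<^sup>+y. norm (indicator (ball 0 \<rho>) y * \<phi> x - indicator (ball 0 \<rho>) y * \<phi> (x + y)) \<partial>lborel)
        = (\<integral>\<^sup>+y. indicator (ball 0 \<rho>) y * ennreal \<bar>\<phi> (x + y) - \<phi> x\<bar> \<partial>lborel)"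
      by (intro nn_integral_cong) (auto simp: indicator_def abs_minus_commute)
    ultimately show "ennreal \<bar>\<beta> * \<phi> x - ball_integral \<rho> \<phi> x\<bar>
        \<le> (\<integral>\<^sup>+y. indicator (ball 0 \<rho>) y * ennreal \<bar>\<phi> (x + y) - \<phi> x\<bar> \<partial>lborel)" by simp
  qed
  also have "\<dots> = (\<integral>\<^sup>+y. (\<integral>\<^sup>+x. indicator (ball 0 \<rho>) y * ennreal \<bar>\<phi> (x + y) - \<phi> x\<bar> \<partial>lborel) \<partial>lborel)"
    by (intro lborel_pair.Fubini') measurable
  also have "\<dots> \<le> (\<integral>\<^sup>+y. indicator (ball (0::'a) \<rho>) y * ennreal (\<rho> * ?G) \<partial>lborel)"
  proof (rule nn_integral_mono)
    fix y :: 'a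
    have "(\<integral>\<^sup>+x. indicator (ball 0 \<rho>) y * ennreal \<bar>\<phi> (x + y) - \<phi> x\<bar> \<partial>lborel)
        \<le> indicator (ball 0 \<rho>) y * ennreal (norm y * ?G)"
      using nn_integral_shift_diff[of y] by (subst nn_integral_cmult) (auto simp: indicator_def)
    also have "\<dots> \<le> indicator (ball 0 \<rho>) y * ennreal (\<rho> * ?G)"
      using G by (auto simp: indicator_def intro!: ennreal_leI mult_right_mono)
    finally show "(\<integral>\<^sup>+x. indicator (ball 0 \<rho>) y * ennreal \<bar>\<phi> (x + y) - \<phi> x\<bar> \<partial>lborel)
        \<le> indicator (ball 0 \<rho>) y * ennreal (\<rho> * ?G)" .
  qed
  also have "\<dots> = ennreal (\<beta> * (\<rho> * ?G))"
    using G \<beta> assms(1) by (subst nn_integral_multc) (auto simp: emb ennreal_mult)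
  finally have *: "(\<integral>\<^sup>+x. ennreal (norm (\<beta> * \<phi> x - ball_integral \<rho> \<phi> x)) \<partial>lborel) \<le> ennreal (\<beta> * (\<rho> * ?G))" by simp
  show int: "integrable lborel (\<lambda>x. \<beta> * \<phi> x - ball_integral \<rho> \<phi> x)"
    by (rule integrableI_bounded) (measurable, use * in \<open>auto intro: order_le_less_trans\<close>)
  show "(LINT x|lborel. \<bar>\<beta> * \<phi> x - ball_integral \<rho> \<phi> x\<bar>) \<le> \<beta> * (\<rho> * ?G)"
    using * G \<beta> assms(1) by (subst (asm) nn_integral_eq_integral[OF integrable_norm[OF int]]) (auto simp: ennreal_le_iff)
qed

end

text \<open>A diagonal subsequence makes the ball integrals of all radii 1/(m+1) converge on a
  countable dense set, hence everywhere by the common Lipschitz constant. Dominated convergence on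
  the bounded set W and \<open>ball_integral_approx\<close> then make the subsequence Cauchy in L^1,
  and a further subsequence is Cauchy almost everywhere.\<close>

lemma Rellich_L1:
  fixes \<phi> :: "nat \<Rightarrow> 'a::euclidean_space \<Rightarrow> real"
  assumes C1: "\<And>n. C1_compact_support (\<phi> n) (D n) (K n)" and KW: "\<And>n. K n \<subseteq> W"
    and W: "bounded W" "W \<in> sets borel"
    and B: "\<And>n. (LINT x|lborel. \<bar>\<phi> n x\<bar>) \<le> B" "\<And>n. (LINT x|lborel. norm (D n x)) \<le> B"
  obtains k where "strict_mono k" "AE x in lborel. Cauchy (\<lambda>n. \<phi> (k n) x)"
proof -
  have [measurable]: "W \<in> sets borel" by fact
  have [measurable]: "ball_integral \<rho> (\<phi> n) \<in> borel_measurable borel" for \<rho> n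
    using C1 C1_compact_support.measurable_ball_integral by blast
  have [measurable]: "\<phi> n \<in> borel_measurable borel" for n
    using C1 C1_compact_support.measurable_phi by blast
  have B0: "B \<ge> 0" proof -
    have "0 \<le> (LINT x|lborel. \<bar>\<phi> 0 x\<bar>)" by simp
    with B(1)[of 0] show ?thesis by linarith
  qed
  have finW: "emeasure lborel W < \<infinity>" using W emeasure_bounded_finite by blast
  define I where "I n m x = ball_integral (1 / real (Suc m)) (\<phi> n) x" for n m x
  have [measurable]: "I n m \<in> borel_measurable borel" for n m unfolding I_def by measurable
  have I_bound: "\<bar>I n m x\<bar> \<le> B" for n m x
    unfolding I_def using C1_compact_support.ball_integral_bound[OF C1] B(1) order_trans by blast
  have I_Lip: "\<bar>I n m x - I n m x'\<bar> \<le> norm (x - x') * B" for n m x x'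
    unfolding I_def
    using C1_compact_support.ball_integral_Lipschitz[OF C1] B(2) mult_left_mono[OF B(2) norm_ge_zero] order_trans by blast
  obtain S :: "'a set" where S: "countable S" "\<And>X. open X \<Longrightarrow> X \<noteq> {} \<Longrightarrow> \<exists>d\<in>S. d \<in> X"
    using countable_dense_exists by blast
  have "countable (UNIV \<times> S :: (nat \<times> 'a) set)" using S(1) by blast
  \<comment> \<open>Pairs of a radius index and a dense point are countable, so one subsequence
    serves all radii at once.\<close>
  then obtain k where k: "strict_mono k" and
    k': "\<And>p. p \<in> UNIV \<times> S \<Longrightarrow> \<exists>l. (\<lambda>n. (\<lambda>n (m, x). I n m x) (k n) p) \<longlonglongrightarrow> l"
    by (rule function_convergent_subsequence[of "UNIV \<times> S" "\<lambda>n (m, x). I n m x" B]) (use I_bound in auto)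
  have conv: "convergent (\<lambda>n. I (k n) m x)" for m x
  proof -
    have "Cauchy (\<lambda>n. I (k n) m x)"
    proof (rule metric_CauchyI)
      fix e :: real assume e: "e > 0"
      \<comment> \<open>Within this distance a B-Lipschitz function varies by less than e/4; B + 1
        avoids division by 0.\<close>
      have "e / (4 * (B + 1)) > 0" using e B0 by simp
      then have "ball x (e / (4 * (B + 1))) \<noteq> {}" by simp
      then obtain d where d: "d \<in> S" "dist x d < e / (4 * (B + 1))"
        using S(2)[of "ball x (e / (4 * (B + 1)))"] by auto
      have "norm (x - d) * B \<le> norm (x - d) * (B + 1)" by (intro mult_left_mono) auto
      also have "\<dots> < e / 4" using d(2) B0 by (simp add: dist_norm field_simps)
      finally have small: "\<bar>I n m x - I n m d\<bar> < e / 4" for n using I_Lip[of n m x d] by linarith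
      have "Cauchy (\<lambda>n. I (k n) m d)" using k'[of "(m, d)"] d(1) LIMSEQ_imp_Cauchy by auto
      then obtain M where M: "\<And>i j. i \<ge> M \<Longrightarrow> j \<ge> M \<Longrightarrow> dist (I (k i) m d) (I (k j) m d) < e / 2"
        using e metric_CauchyD[of _ "e / 2"] by (metis half_gt_zero)
      have "dist (I (k i) m x) (I (k j) m x) < e" if "i \<ge> M" "j \<ge> M" for i j
        using M[OF that] small[of "k i"] small[of "k j"] unfolding dist_real_def by linarith
      then show "\<exists>M. \<forall>i\<ge>M. \<forall>j\<ge>M. dist (I (k i) m x) (I (k j) m x) < e" by blast
    qed
    then show ?thesis by (simp add: Cauchy_convergent_iff)
  qed
  define L where "L m x = lim (\<lambda>n. I (k n) m x)" for m x
  have L: "(\<lambda>n. I (k n) m x) \<longlonglongrightarrow> L m x" for m x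
    unfolding L_def using conv convergent_LIMSEQ_iff by blast
  have [measurable]: "L m \<in> borel_measurable borel" for m
    by (rule borel_measurable_LIMSEQ_real[OF L]) measurable
  have L_bound: "\<bar>L m x\<bar> \<le> B" for m x
    by (rule LIMSEQ_le_const2[OF tendsto_rabs[OF L]]) (use I_bound in auto)
  have IL: "(\<lambda>n. LINT x|lborel. indicator W x * \<bar>I (k n) m x - L m x\<bar>) \<longlonglongrightarrow> 0" for m
  proof -
    have "(\<lambda>n. LINT x|lborel. indicator W x * \<bar>I (k n) m x - L m x\<bar>) \<longlonglongrightarrow> (LINT x|(lborel::'a measure). 0)"
    proof (rule integral_dominated_convergence[where w = "\<lambda>x. indicator W x * (2 * B)"])
      show "AE x in lborel. (\<lambda>n. indicator W x * \<bar>I (k n) m x - L m x\<bar>) \<longlonglongrightarrow> 0"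
      proof (rule AE_I2)
        fix x
        have "(\<lambda>n. indicator W x * \<bar>I (k n) m x - L m x\<bar>) \<longlonglongrightarrow> indicator W x * \<bar>L m x - L m x\<bar>"
          by (intro tendsto_intros L)
        then show "(\<lambda>n. indicator W x * \<bar>I (k n) m x - L m x\<bar>) \<longlonglongrightarrow> 0" by simp
      qed
      show "AE x in lborel. norm (indicator W x * \<bar>I (k n) m x - L m x\<bar>) \<le> indicator W x * (2 * B)" for n
      proof (rule AE_I2)
        fix x
        have "\<bar>I (k n) m x - L m x\<bar> \<le> 2 * B" using I_bound[of "k n" m x] L_bound[of m x] by linarith
        then show "norm (indicator W x * \<bar>I (k n) m x - L m x\<bar>) \<le> indicator W x * (2 * B)"
          by (auto simp: indicator_def)
      qed
    qed (use finW in auto)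
    then show ?thesis by simp
  qed
  have intIL: "integrable lborel (\<lambda>x. indicator W x * \<bar>I n m x - L m x\<bar>)" for n m
  proof (rule Bochner_Integration.integrable_bound[where f = "\<lambda>x. indicator W x * (2 * B)"])
    show "AE x in lborel. norm (indicator W x * \<bar>I n m x - L m x\<bar>) \<le> norm (indicator W x * (2 * B))"
    proof (rule AE_I2)
      fix x
      have "\<bar>I n m x - L m x\<bar> \<le> 2 * B" using I_bound[of n m x] L_bound[of m x] by linarith
      then show "norm (indicator W x * \<bar>I n m x - L m x\<bar>) \<le> norm (indicator W x * (2 * B))"
        by (auto simp: indicator_def)
    qed
  qed (use finW in auto)
  have L1_Cauchy: "\<exists>M. \<forall>i\<ge>M. \<forall>j\<ge>M. LINT x|lborel. norm (\<phi> (k i) x - \<phi> (k j) x) < e" if e: "e > 0" for e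
  proof -
    \<comment> \<open>The radius 1/(m+1) makes each of the two approximation errors, divided by
      \<beta>, less than e/4; the two distances to the limit L contribute e/4 each.\<close>
    obtain m :: nat where "4 * B / e < real m" using reals_Archimedean2 by blast
    then have "B * 4 < e * real (Suc m)" using e by (simp add: field_simps)
    define \<rho> where "\<rho> = 1 / real (Suc m)"
    have \<rho>: "\<rho> > 0" "\<rho> * B < e / 4" using \<open>B * 4 < e * real (Suc m)\<close> by (simp_all add: \<rho>_def field_simps)
    define \<beta> where "\<beta> = measure lborel (ball (0::'a) \<rho>)"
    have \<beta>: "\<beta> > 0" unfolding \<beta>_def using content_ball_pos[OF \<rho>(1)] by simp
    obtain M where M: "\<And>n. n \<ge> M \<Longrightarrow> (LINT x|lborel. indicator W x * \<bar>I (k n) m x - L m x\<bar>) < \<beta> * (e / 4)"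
      using order_tendstoD(2)[OF IL[of m], of "\<beta> * (e / 4)"] \<beta> e by (auto simp: eventually_sequentially)
    have approx: "integrable lborel (\<lambda>x. \<bar>\<beta> * \<phi> n x - I n m x\<bar>)"
        "(LINT x|lborel. \<bar>\<beta> * \<phi> n x - I n m x\<bar>) \<le> \<beta> * (\<rho> * B)" for n
    proof -
      show "integrable lborel (\<lambda>x. \<bar>\<beta> * \<phi> n x - I n m x\<bar>)"
        unfolding I_def \<beta>_def \<rho>_def[symmetric]
        by (intro integrable_abs C1_compact_support.ball_integral_approx(1)[OF C1] \<rho>)
      have "(LINT x|lborel. \<bar>\<beta> * \<phi> n x - I n m x\<bar>) \<le> \<beta> * (\<rho> * (LINT y|lborel. norm (D n y)))"
        unfolding I_def \<beta>_def \<rho>_def[symmetric] by (intro C1_compact_support.ball_integral_approx(2)[OF C1] \<rho>)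
      also have "\<dots> \<le> \<beta> * (\<rho> * B)" using \<beta> \<rho> B(2) by (intro mult_left_mono) auto
      finally show "(LINT x|lborel. \<bar>\<beta> * \<phi> n x - I n m x\<bar>) \<le> \<beta> * (\<rho> * B)" .
    qed
    have "(LINT x|lborel. norm (\<phi> (k i) x - \<phi> (k j) x)) < e" if "i \<ge> M" "j \<ge> M" for i j
    proof -
      have "\<beta> * (LINT x|lborel. norm (\<phi> (k i) x - \<phi> (k j) x)) = (LINT x|lborel. \<beta> * norm (\<phi> (k i) x - \<phi> (k j) x))"
        by simp
      also have "\<dots> \<le> (LINT x|lborel. (\<bar>\<beta> * \<phi> (k i) x - I (k i) m x\<bar> + indicator W x * \<bar>I (k i) m x - L m x\<bar>)
          + (\<bar>\<beta> * \<phi> (k j) x - I (k j) m x\<bar> + indicator W x * \<bar>I (k j) m x - L m x\<bar>))"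
      proof (rule integral_mono)
        fix x
        show "\<beta> * norm (\<phi> (k i) x - \<phi> (k j) x) \<le> (\<bar>\<beta> * \<phi> (k i) x - I (k i) m x\<bar> + indicator W x * \<bar>I (k i) m x - L m x\<bar>)
          + (\<bar>\<beta> * \<phi> (k j) x - I (k j) m x\<bar> + indicator W x * \<bar>I (k j) m x - L m x\<bar>)"
        \<comment> \<open>Outside W both functions vanish, so restricting the terms with L to W,
          where dominated convergence is available, loses nothing.\<close>
        proof (cases "x \<in> W")
          case True
          have "\<beta> * norm (\<phi> (k i) x - \<phi> (k j) x) = \<bar>\<beta> * \<phi> (k i) x - \<beta> * \<phi> (k j) x\<bar>"
            using \<beta> by (simp add: abs_mult flip: right_diff_distrib)
          then show ?thesis using True by simp
        next
          case False
          then have "\<phi> n x = 0" for n using C1_compact_support.supp[OF C1] KW by blast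
          then show ?thesis by simp
        qed
        show "integrable lborel (\<lambda>x. \<beta> * norm (\<phi> (k i) x - \<phi> (k j) x))"
          by (intro integrable_mult_right integrable_norm Bochner_Integration.integrable_diff
              C1_compact_support.integrable_phi[OF C1])
        show "integrable lborel (\<lambda>x. (\<bar>\<beta> * \<phi> (k i) x - I (k i) m x\<bar> + indicator W x * \<bar>I (k i) m x - L m x\<bar>)
          + (\<bar>\<beta> * \<phi> (k j) x - I (k j) m x\<bar> + indicator W x * \<bar>I (k j) m x - L m x\<bar>))"
          by (intro Bochner_Integration.integrable_add approx intIL)
      qed
      also have "\<dots> = ((LINT x|lborel. \<bar>\<beta> * \<phi> (k i) x - I (k i) m x\<bar>) + (LINT x|lborel. indicator W x * \<bar>I (k i) m x - L m x\<bar>))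
          + ((LINT x|lborel. \<bar>\<beta> * \<phi> (k j) x - I (k j) m x\<bar>) + (LINT x|lborel. indicator W x * \<bar>I (k j) m x - L m x\<bar>))"
        by (simp add: Bochner_Integration.integral_add approx(1) intIL)
      also have "\<dots> < (\<beta> * (\<rho> * B) + \<beta> * (e / 4)) + (\<beta> * (\<rho> * B) + \<beta> * (e / 4))"
        by (intro add_strict_mono add_le_less_mono approx(2) M that)
      also have "\<dots> = \<beta> * (2 * (\<rho> * B) + e / 2)" by (simp add: algebra_simps)
      also have "\<dots> \<le> \<beta> * e" using \<rho> \<beta> by (intro mult_left_mono) auto
      finally show ?thesis using \<beta> by simp
    qed
    then show ?thesis by blast
  qed
  obtain r where r: "strict_mono r" "AE x in lborel. Cauchy (\<lambda>n. \<phi> (k (r n)) x)"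
    using cauchy_L1_AE_cauchy_subseq[OF C1_compact_support.integrable_phi[OF C1] L1_Cauchy] by blast
  have "strict_mono (k \<circ> r)" using k r(1) by (rule strict_mono_o)
  then show thesis using that[of "k \<circ> r"] r(2) by (simp add: o_def)
qed

section \<open>Convergence of integrals\<close>

text \<open>The bound on the integrals is asked only eventually: in the applications it is read off
  from a strict inequality for a limit or holds beyond some index.\<close>

lemma integrable_Fatou:
  fixes f :: "nat \<Rightarrow> 'a \<Rightarrow> real"
  assumes f: "\<And>n. integrable M (f n)" "\<And>n. AE x in M. 0 \<le> f n x" and g: "g \<in> borel_measurable M"
    and lim: "AE x in M. (\<lambda>n. f n x) \<longlonglongrightarrow> g x" and B: "\<forall>\<^sub>F n in sequentially. (LINT x|M. f n x) \<le> B"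
  shows "integrable M g" "(LINT x|M. g x) \<le> B" "AE x in M. 0 \<le> g x"
proof -
  have [measurable]: "\<And>n. f n \<in> borel_measurable M" "g \<in> borel_measurable M" using f(1) g by auto
  have "AE x in M. \<forall>n. 0 \<le> f n x" using f(2) by (simp add: AE_all_countable)
  then show pos: "AE x in M. 0 \<le> g x"
    using lim by eventually_elim (auto intro: LIMSEQ_le_const)
  obtain n where "(LINT x|M. f n x) \<le> B" using B eventually_happens'[OF sequentially_bot] by blast
  moreover have "0 \<le> (LINT x|M. f n x)" by (rule integral_nonneg_AE[OF f(2)])
  ultimately have B0: "B \<ge> 0" by linarith
  have "(\<integral>\<^sup>+x. ennreal (g x) \<partial>M) = (\<integral>\<^sup>+x. liminf (\<lambda>n. ennreal (f n x)) \<partial>M)"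
  proof (rule nn_integral_cong_AE)
    show "AE x in M. ennreal (g x) = liminf (\<lambda>n. ennreal (f n x))"
      using lim by eventually_elim (metis lim_imp_Liminf sequentially_bot tendsto_ennrealI)
  qed
  also have "\<dots> \<le> liminf (\<lambda>n. \<integral>\<^sup>+x. ennreal (f n x) \<partial>M)" by (rule nn_integral_liminf) measurable
  also have "\<dots> = liminf (\<lambda>n. ennreal (LINT x|M. f n x))"
    using f by (simp add: nn_integral_eq_integral)
  also have "\<dots> \<le> liminf (\<lambda>n. ennreal B)"
    by (rule Liminf_mono) (use B in \<open>auto elim!: eventually_mono intro: ennreal_leI\<close>)
  also have "\<dots> = ennreal B" by (simp add: Liminf_const)
  finally have *: "(\<integral>\<^sup>+x. ennreal (g x) \<partial>M) \<le> ennreal B" .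
  show int: "integrable M g"
    by (rule integrableI_nonneg) (use pos * in \<open>auto simp: le_less_trans\<close>)
  have "ennreal (LINT x|M. g x) \<le> ennreal B" using * nn_integral_eq_integral[OF int pos] by simp
  then show "(LINT x|M. g x) \<le> B" using B0 by (simp add: ennreal_le_iff)
qed

text \<open>A Vitali-type convergence theorem: the sequence is dominated up to an arbitrarily small
  multiple of a sequence that is merely bounded in $L^1$. Taking $a_n = |u_n|^{2^*}$ it covers
  subcritical nonlinearities as well as the Brezis-Lieb lemma.\<close>

lemma almost_dominated_convergence:
  fixes w :: "nat \<Rightarrow> 'a \<Rightarrow> real"
  assumes w: "\<And>n. w n \<in> borel_measurable M" and v: "v \<in> borel_measurable M"
    and lim: "AE x in M. (\<lambda>n. w n x) \<longlonglongrightarrow> v x"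
    and a: "\<And>n. integrable M (a n)" "\<And>n x. 0 \<le> a n x" "\<And>n. (LINT x|M. a n x) \<le> B"
    and dom: "\<And>\<epsilon>. \<epsilon> > 0 \<Longrightarrow> \<exists>G. integrable M G \<and> (\<forall>n. AE x in M. \<bar>w n x\<bar> \<le> \<epsilon> * a n x + G x)"
  shows "\<And>n. integrable M (w n)" "integrable M v" "(\<lambda>n. LINT x|M. w n x) \<longlonglongrightarrow> (LINT x|M. v x)"
    "(\<lambda>n. LINT x|M. \<bar>w n x - v x\<bar>) \<longlonglongrightarrow> 0"
proof -
  have [measurable]: "\<And>n. w n \<in> borel_measurable M" "v \<in> borel_measurable M"
    "\<And>n. a n \<in> borel_measurable M" using w v a(1) by auto
  have B0: "B \<ge> 0" proof -
    have "0 \<le> (LINT x|M. a 0 x)" using a(2) by (intro integral_nonneg_AE) auto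
    with a(3)[of 0] show ?thesis by linarith
  qed
  \<comment> \<open>The hypothesis with \<epsilon> = 1 gives integrability and a uniform L^1 bound,
    from which Fatou yields integrability of the limit.\<close>
  obtain G1 where G1: "integrable M G1" "\<And>n. AE x in M. \<bar>w n x\<bar> \<le> 1 * a n x + G1 x"
    using dom[of 1] by auto
  show intw: "integrable M (w n)" for n
  proof (rule Bochner_Integration.integrable_bound)
    show "integrable M (\<lambda>x. 1 * a n x + G1 x)" using G1(1) a(1) by simp
    show "AE x in M. norm (w n x) \<le> norm (1 * a n x + G1 x)"
      using G1(2)[of n] by eventually_elim simp
  qed (rule w)
  show intv: "integrable M v"
  proof -
    have "integrable M (\<lambda>x. \<bar>v x\<bar>)"
    proof (rule integrable_Fatou(1))
      show "AE x in M. (\<lambda>n. \<bar>w n x\<bar>) \<longlonglongrightarrow> \<bar>v x\<bar>" using lim by eventually_elim (rule tendsto_rabs)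
      have "(LINT x|M. \<bar>w n x\<bar>) \<le> B + (LINT x|M. G1 x)" for n
      proof -
        have "(LINT x|M. \<bar>w n x\<bar>) \<le> (LINT x|M. 1 * a n x + G1 x)"
          by (rule integral_mono_AE) (use intw G1 a(1) in auto)
        also have "\<dots> = (LINT x|M. a n x) + (LINT x|M. G1 x)" using a(1) G1(1) by simp
        finally show ?thesis using a(3)[of n] by linarith
      qed
      then show "\<forall>\<^sub>F n in sequentially. (LINT x|M. \<bar>w n x\<bar>) \<le> B + (LINT x|M. G1 x)" by simp
    qed (use intw in auto)
    then show ?thesis by (simp add: integrable_abs_iff)
  qed
  show L1: "(\<lambda>n. LINT x|M. \<bar>w n x - v x\<bar>) \<longlonglongrightarrow> 0"
  proof (rule LIMSEQ_I)
    fix e :: real assume e: "e > 0"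
    define \<epsilon> where "\<epsilon> = e / (2 * (B + 1))"
    have \<epsilon>: "\<epsilon> > 0" "\<epsilon> * B < e / 2" using e B0 by (simp_all add: \<epsilon>_def field_simps)
    obtain G where G: "integrable M G" "\<And>n. AE x in M. \<bar>w n x\<bar> \<le> \<epsilon> * a n x + G x"
      using dom[OF \<epsilon>(1)] by auto
    have [measurable]: "G \<in> borel_measurable M" using G(1) by auto
    \<comment> \<open>The excess of |w - v| over the small multiple of a. It is dominated by |G| +
      |v|, independently of n, so its integral tends to 0; the part cut off has integral at most
      \<epsilon> B < e/2.\<close>
    define p where "p n x = max 0 (\<bar>w n x - v x\<bar> - \<epsilon> * a n x)" for n x
    have [measurable]: "p n \<in> borel_measurable M" for n unfolding p_def by measurable
    have p_le: "AE x in M. norm (p n x) \<le> \<bar>G x\<bar> + \<bar>v x\<bar>" for n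
      using G(2)[of n] by eventually_elim (auto simp: p_def)
    have "(\<lambda>n. LINT x|M. p n x) \<longlonglongrightarrow> (LINT x|M. 0)"
    proof (rule integral_dominated_convergence[where w = "\<lambda>x. \<bar>G x\<bar> + \<bar>v x\<bar>"])
      show "AE x in M. (\<lambda>n. p n x) \<longlonglongrightarrow> 0" using lim
      proof eventually_elim
        case (elim x)
        have "(\<lambda>n. \<bar>w n x - v x\<bar>) \<longlonglongrightarrow> \<bar>v x - v x\<bar>" by (intro tendsto_intros elim)
        then have "(\<lambda>n. \<bar>w n x - v x\<bar>) \<longlonglongrightarrow> 0" by simp
        moreover have "norm (p n x) \<le> \<bar>w n x - v x\<bar>" for n
          using a(2)[of n x] \<epsilon> by (auto simp: p_def)
        ultimately show ?case
          by (intro Lim_null_comparison[of "\<lambda>n. p n x" "\<lambda>n. \<bar>w n x - v x\<bar>"] always_eventually allI)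
      qed
    qed (use G intv p_le in auto)
    then have "\<forall>\<^sub>F n in sequentially. (LINT x|M. p n x) < e / 2"
      using e by (intro order_tendstoD) auto
    then obtain N where N: "\<And>n. n \<ge> N \<Longrightarrow> (LINT x|M. p n x) < e / 2"
      by (auto simp: eventually_sequentially)
    have intp: "integrable M (p n)" for n
    proof (rule Bochner_Integration.integrable_bound)
      show "integrable M (\<lambda>x. \<bar>G x\<bar> + \<bar>v x\<bar>)" using G(1) intv by simp
      show "AE x in M. norm (p n x) \<le> norm (\<bar>G x\<bar> + \<bar>v x\<bar>)"
        using p_le[of n] by eventually_elim simp
    qed measurable
    have "norm ((LINT x|M. \<bar>w n x - v x\<bar>) - 0) < e" if "n \<ge> N" for n
    proof -
      have "(LINT x|M. \<bar>w n x - v x\<bar>) \<le> (LINT x|M. p n x + \<epsilon> * a n x)"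
        by (rule integral_mono) (use intw intv intp a(1) in \<open>auto simp: p_def\<close>)
      also have "\<dots> = (LINT x|M. p n x) + \<epsilon> * (LINT x|M. a n x)" using intp a(1) by simp
      also have "\<dots> < e / 2 + e / 2"
        using N[OF that] \<epsilon> mult_left_mono[OF a(3)[of n], of \<epsilon>] by linarith
      finally show ?thesis by simp
    qed
    then show "\<exists>N. \<forall>n\<ge>N. norm ((LINT x|M. \<bar>w n x - v x\<bar>) - 0) < e" by blast
  qed
  show "(\<lambda>n. LINT x|M. w n x) \<longlonglongrightarrow> (LINT x|M. v x)"
  proof (rule LIM_zero_cancel, rule Lim_null_comparison[OF _ L1], rule always_eventually, rule allI)
    fix n
    have "(LINT x|M. w n x) - (LINT x|M. v x) = (LINT x|M. w n x - v x)" using intw intv by simp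
    then show "norm ((LINT x|M. w n x) - (LINT x|M. v x)) \<le> (LINT x|M. \<bar>w n x - v x\<bar>)" by simp
  qed
qed

section \<open>Calculus of square-integrable functions over a general measure\<close>

definition square_integrable :: "'a measure \<Rightarrow> ('a \<Rightarrow> 'b::euclidean_space) \<Rightarrow> bool" where
  "square_integrable M u \<longleftrightarrow> u \<in> borel_measurable M \<and> integrable M (\<lambda>x. (norm (u x))\<^sup>2)"

abbreviation L2_sq :: "'a measure \<Rightarrow> ('a \<Rightarrow> 'b::euclidean_space) \<Rightarrow> real" where
  "L2_sq M u \<equiv> (LINT x|M. (norm (u x))\<^sup>2)"

lemma square_integrable_measurable: "square_integrable M u \<Longrightarrow> u \<in> borel_measurable M"
  by (simp add: square_integrable_def)

lemma norm_sum_squared_le: "(norm (a + b))\<^sup>2 \<le> 2 * (norm a)\<^sup>2 + 2 * (norm (b :: 'b::real_inner))\<^sup>2"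
  using inner_ge_zero[of "a - b"]
  by (simp add: power2_norm_eq_inner inner_add_left inner_add_right inner_diff_left inner_diff_right inner_commute)

lemma square_integrable_inner:
  assumes "square_integrable M u" "square_integrable M v"
  shows "integrable M (\<lambda>x. u x \<bullet> v x)"
proof (rule Bochner_Integration.integrable_bound)
  show "integrable M (\<lambda>x. (norm (u x))\<^sup>2 + (norm (v x))\<^sup>2)"
    using assms by (simp add: square_integrable_def)
  show "(\<lambda>x. u x \<bullet> v x) \<in> borel_measurable M"
    using assms by (simp add: square_integrable_def borel_measurable_inner)
  have "\<bar>u x \<bullet> v x\<bar> \<le> (norm (u x))\<^sup>2 + (norm (v x))\<^sup>2" for x
  proof -
    have "\<bar>u x \<bullet> v x\<bar> \<le> norm (u x) * norm (v x)" by (rule Cauchy_Schwarz_ineq2)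
    also have "\<dots> \<le> (norm (u x))\<^sup>2 + (norm (v x))\<^sup>2"
      using sum_squares_bound[of "norm (u x)" "norm (v x)"] mult_nonneg_nonneg[OF norm_ge_zero[of "u x"] norm_ge_zero[of "v x"]]
      by linarith
    finally show ?thesis .
  qed
  then show "AE x in M. norm (u x \<bullet> v x) \<le> norm ((norm (u x))\<^sup>2 + (norm (v x))\<^sup>2)"
    by (intro AE_I2) simp
qed

lemma square_integrable_add:
  assumes "square_integrable M u" "square_integrable M v"
  shows "square_integrable M (\<lambda>x. u x + v x)"
  unfolding square_integrable_def
proof
  show m: "(\<lambda>x. u x + v x) \<in> borel_measurable M"
    using assms by (auto simp: square_integrable_def intro: borel_measurable_add)
  show "integrable M (\<lambda>x. (norm (u x + v x))\<^sup>2)"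
    by (rule Bochner_Integration.integrable_bound[of M "\<lambda>x. 2 * (norm (u x))\<^sup>2 + 2 * (norm (v x))\<^sup>2"])
      (use assms m norm_sum_squared_le in \<open>auto simp: square_integrable_def\<close>)
qed

lemma square_integrable_scaleR:
  assumes "square_integrable M u"
  shows "square_integrable M (\<lambda>x. c *\<^sub>R u x)"
  using assms by (auto simp: square_integrable_def power_mult_distrib)

lemma square_integrable_diff:
  assumes "square_integrable M u" "square_integrable M v"
  shows "square_integrable M (\<lambda>x. u x - v x)"
  using square_integrable_add[OF assms(1) square_integrable_scaleR[OF assms(2), of "-1"]] by simp

lemma L2_sq_nonneg: "L2_sq M u \<ge> 0"
  by simp

lemma L2_sq_add:
  assumes "square_integrable M u" "square_integrable M v"
  shows "L2_sq M (\<lambda>x. u x + v x) = L2_sq M u + 2 * (LINT x|M. u x \<bullet> v x) + L2_sq M v"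
proof -
  have "(norm (u x + v x))\<^sup>2 = (norm (u x))\<^sup>2 + 2 * (u x \<bullet> v x) + (norm (v x))\<^sup>2" for x
    by (simp add: power2_norm_eq_inner inner_add_left inner_add_right inner_commute)
  then show ?thesis
    using assms square_integrable_inner[OF assms] by (simp add: square_integrable_def)
qed

lemma L2_sq_scaleR: "L2_sq M (\<lambda>x. c *\<^sub>R u x) = c\<^sup>2 * L2_sq M u"
  by (simp add: power_mult_distrib)

lemma L2_sq_diff_commute: "L2_sq M (\<lambda>x. u x - v x) = L2_sq M (\<lambda>x. v x - u x)"
  by (simp add: norm_minus_commute)

text \<open>With squared norms this takes the place of the triangle inequality and avoids square
  roots at the cost of the factor 2.\<close>

lemma L2_sq_triangle:
  assumes "square_integrable M u" "square_integrable M v"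
  shows "L2_sq M (\<lambda>x. u x + v x) \<le> 2 * L2_sq M u + 2 * L2_sq M v"
proof -
  have "L2_sq M (\<lambda>x. u x + v x) \<le> (LINT x|M. 2 * (norm (u x))\<^sup>2 + 2 * (norm (v x))\<^sup>2)"
    by (rule integral_mono) (use assms square_integrable_add[OF assms] norm_sum_squared_le in \<open>auto simp: square_integrable_def\<close>)
  then show ?thesis using assms by (simp add: square_integrable_def)
qed

lemma L2_Cauchy_Schwarz:
  assumes "square_integrable M u" "square_integrable M v"
  shows "(LINT x|M. u x \<bullet> v x)\<^sup>2 \<le> L2_sq M u * L2_sq M v"
proof -
  have [measurable]: "u \<in> borel_measurable M" "v \<in> borel_measurable M"
    using assms by (auto simp: square_integrable_def)
  have int: "integrable M (\<lambda>x. (norm (u x))\<^sup>2)" "integrable M (\<lambda>x. (norm (v x))\<^sup>2)"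
    using assms by (auto simp: square_integrable_def)
  have sq: "(\<integral>\<^sup>+x. ennreal (norm (w x)) ^ 2 \<partial>M) = ennreal (L2_sq M w)"
    if "integrable M (\<lambda>x. (norm (w x))\<^sup>2)" for w :: "_ \<Rightarrow> 'b"
    using that by (simp add: ennreal_power nn_integral_eq_integral)
  have "ennreal \<bar>LINT x|M. u x \<bullet> v x\<bar> \<le> (\<integral>\<^sup>+x. norm (u x \<bullet> v x) \<partial>M)"
    using integral_norm_bound_ennreal[OF square_integrable_inner[OF assms]] by simp
  also have "\<dots> \<le> (\<integral>\<^sup>+x. ennreal (norm (u x)) * ennreal (norm (v x)) \<partial>M)"
    by (intro nn_integral_mono) (auto simp: Cauchy_Schwarz_ineq2 intro!: ennreal_leI simp flip: ennreal_mult)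
  finally have "ennreal \<bar>LINT x|M. u x \<bullet> v x\<bar> ^ 2 \<le> (\<integral>\<^sup>+x. ennreal (norm (u x)) * ennreal (norm (v x)) \<partial>M) ^ 2"
    by (rule power_mono) simp
  also have "\<dots> \<le> ennreal (L2_sq M u) * ennreal (L2_sq M v)"
    unfolding sq[OF int(1), symmetric] sq[OF int(2), symmetric]
    by (rule Cauchy_Schwarz_nn_integral) measurable
  finally have "ennreal ((LINT x|M. u x \<bullet> v x)\<^sup>2) \<le> ennreal (L2_sq M u * L2_sq M v)"
    by (simp add: ennreal_power ennreal_mult)
  then show ?thesis by (simp add: ennreal_le_iff)
qed

lemma L2_inner_tendsto:
  assumes u: "\<And>n. square_integrable M (u n)" "square_integrable M u'" and v: "square_integrable M v"
    and lim: "(\<lambda>n. L2_sq M (\<lambda>x. u n x - u' x)) \<longlonglongrightarrow> 0"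
  shows "(\<lambda>n. LINT x|M. u n x \<bullet> v x) \<longlonglongrightarrow> (LINT x|M. u' x \<bullet> v x)"
proof (rule LIM_zero_cancel)
  have "(\<lambda>n. sqrt (L2_sq M (\<lambda>x. u n x - u' x) * L2_sq M v)) \<longlonglongrightarrow> sqrt (0 * L2_sq M v)"
    by (intro tendsto_intros lim)
  then have "(\<lambda>n. sqrt (L2_sq M (\<lambda>x. u n x - u' x) * L2_sq M v)) \<longlonglongrightarrow> 0" by simp
  then show "(\<lambda>n. (LINT x|M. u n x \<bullet> v x) - (LINT x|M. u' x \<bullet> v x)) \<longlonglongrightarrow> 0"
  proof (rule Lim_null_comparison[rotated], intro always_eventually allI)
    fix n
    have "(LINT x|M. u n x \<bullet> v x) - (LINT x|M. u' x \<bullet> v x) = (LINT x|M. (u n x - u' x) \<bullet> v x)"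
      unfolding inner_diff_left
      by (rule Bochner_Integration.integral_diff[symmetric]) (intro square_integrable_inner u v)+
    then show "norm ((LINT x|M. u n x \<bullet> v x) - (LINT x|M. u' x \<bullet> v x)) \<le> sqrt (L2_sq M (\<lambda>x. u n x - u' x) * L2_sq M v)"
      using L2_Cauchy_Schwarz[OF square_integrable_diff[OF u] v] by (simp add: real_le_rsqrt)
  qed
qed

lemma L2_sq_tendsto:
  assumes u: "\<And>n. square_integrable M (u n)" "square_integrable M u'"
    and lim: "(\<lambda>n. L2_sq M (\<lambda>x. u n x - u' x)) \<longlonglongrightarrow> 0"
  shows "(\<lambda>n. L2_sq M (u n)) \<longlonglongrightarrow> L2_sq M u'"
proof -
  have eq: "L2_sq M (u n) = L2_sq M (\<lambda>x. u n x - u' x) + 2 * (LINT x|M. u n x \<bullet> u' x) - L2_sq M u'" for n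
  proof -
    have "L2_sq M (\<lambda>x. u n x - u' x) = L2_sq M (u n) + 2 * (LINT x|M. u n x \<bullet> (-1) *\<^sub>R u' x) + L2_sq M u'"
      using L2_sq_add[OF u(1) square_integrable_scaleR[OF u(2), of "-1"], of n] by simp
    then show ?thesis by simp
  qed
  have "(\<lambda>n. L2_sq M (\<lambda>x. u n x - u' x) + 2 * (LINT x|M. u n x \<bullet> u' x) - L2_sq M u')
      \<longlonglongrightarrow> 0 + 2 * (LINT x|M. u' x \<bullet> u' x) - L2_sq M u'"
    by (intro tendsto_intros lim L2_inner_tendsto u)
  also have "0 + 2 * (LINT x|M. u' x \<bullet> u' x) - L2_sq M u' = L2_sq M u'"
    by (simp add: power2_norm_eq_inner)
  finally show ?thesis by (simp only: eq)
qed

lemma L2_convergent_AE_subseq: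
  assumes u: "\<And>n. square_integrable M (u n)" "square_integrable M u'"
    and lim: "(\<lambda>n. L2_sq M (\<lambda>x. u n x - u' x)) \<longlonglongrightarrow> 0"
  obtains r where "strict_mono r" "AE x in M. (\<lambda>n. u (r n) x) \<longlonglongrightarrow> u' x"
proof -
  have int: "integrable M (\<lambda>x. (norm (u n x - u' x))\<^sup>2)" for n
    using square_integrable_diff[OF u] by (simp add: square_integrable_def)
  have "(\<lambda>n. LINT x|M. norm ((norm (u n x - u' x))\<^sup>2)) \<longlonglongrightarrow> 0" using lim by simp
  then obtain r where r: "strict_mono r" "AE x in M. (\<lambda>n. (norm (u (r n) x - u' x))\<^sup>2) \<longlonglongrightarrow> 0"
    using tendsto_L1_AE_subseq[of M "\<lambda>n x. (norm (u n x - u' x))\<^sup>2", OF int] by blast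
  have "AE x in M. (\<lambda>n. u (r n) x) \<longlonglongrightarrow> u' x"
    using r(2)
  proof eventually_elim
    case (elim x)
    have "(\<lambda>n. norm (u (r n) x - u' x)) \<longlonglongrightarrow> 0"
      using tendsto_real_sqrt[OF elim] by simp
    then show ?case using Lim_null tendsto_norm_zero_iff by blast
  qed
  then show thesis using that r(1) by blast
qed

lemma (in finite_measure) square_integrable_L1:
  assumes "square_integrable M u"
  shows "integrable M u" "(LINT x|M. norm (u x))\<^sup>2 \<le> measure M (space M) * L2_sq M u"
proof -
  have n: "square_integrable M (\<lambda>x. norm (u x))" using assms by (auto simp: square_integrable_def)
  have 1: "square_integrable M (\<lambda>x. 1::real)" by (simp add: square_integrable_def)
  have "integrable M (\<lambda>x. norm (u x))" using square_integrable_inner[OF n 1] by simp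
  then show "integrable M u"
    using assms by (simp add: square_integrable_def integrable_norm_iff)
  show "(LINT x|M. norm (u x))\<^sup>2 \<le> measure M (space M) * L2_sq M u"
    using L2_Cauchy_Schwarz[OF n 1] by (simp add: mult.commute)
qed

text \<open>On a finite measure space an L^2 Cauchy sequence is L^1 Cauchy, so a subsequence
  converges almost everywhere. Fatou along this subsequence bounds the L^2 distance of u n to the
  limit by the Cauchy bound; in particular the limit differs from some u n by an L^2
  function.\<close>

lemma (in finite_measure) L2_complete:
  fixes u :: "nat \<Rightarrow> 'a \<Rightarrow> 'b::euclidean_space"
  assumes u: "\<And>n. square_integrable M (u n)"
    and Cauchy: "\<And>e. e > 0 \<Longrightarrow> \<exists>N. \<forall>i\<ge>N. \<forall>j\<ge>N. L2_sq M (\<lambda>x. u i x - u j x) < e"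
  obtains u' where "square_integrable M u'" "(\<lambda>n. L2_sq M (\<lambda>x. u n x - u' x)) \<longlonglongrightarrow> 0"
proof -
  have [measurable]: "u n \<in> borel_measurable M" for n using u by (simp add: square_integrable_def)
  have intd: "integrable M (\<lambda>x. (norm (u i x - u j x))\<^sup>2)" for i j
    using square_integrable_diff[OF u u] by (simp add: square_integrable_def)
  have L1: "\<exists>N. \<forall>i\<ge>N. \<forall>j\<ge>N. LINT x|M. norm (u i x - u j x) < e" if e: "e > 0" for e
  proof -
    let ?\<mu> = "measure M (space M)"
    have "e\<^sup>2 / (?\<mu> + 1) > 0" using e by (simp add: add_nonneg_pos)
    then obtain N where N: "\<And>i j. i \<ge> N \<Longrightarrow> j \<ge> N \<Longrightarrow> L2_sq M (\<lambda>x. u i x - u j x) < e\<^sup>2 / (?\<mu> + 1)"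
      using Cauchy by blast
    have "(LINT x|M. norm (u i x - u j x)) < e" if "i \<ge> N" "j \<ge> N" for i j
    proof (rule power2_less_imp_less)
      have "(LINT x|M. norm (u i x - u j x))\<^sup>2 \<le> ?\<mu> * L2_sq M (\<lambda>x. u i x - u j x)"
        by (rule square_integrable_L1(2)[OF square_integrable_diff[OF u u]])
      also have "\<dots> \<le> (?\<mu> + 1) * L2_sq M (\<lambda>x. u i x - u j x)" by (intro mult_right_mono) auto
      also have "\<dots> < (?\<mu> + 1) * (e\<^sup>2 / (?\<mu> + 1))"
        using N[OF that] by (intro mult_strict_left_mono) (auto simp: add_nonneg_pos)
      also have "\<dots> = e\<^sup>2" using measure_nonneg[of M "space M"] by (simp add: add_nonneg_eq_0_iff)
      finally show "(LINT x|M. norm (u i x - u j x))\<^sup>2 < e\<^sup>2" .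
    qed (use e in simp)
    then show ?thesis by blast
  qed
  obtain r where r: "strict_mono r" "AE x in M. Cauchy (\<lambda>i. u (r i) x)"
    using cauchy_L1_AE_cauchy_subseq[OF square_integrable_L1(1)[OF u] L1] by blast
  define u' where "u' x = lim (\<lambda>i. u (r i) x)" for x
  have [measurable]: "u' \<in> borel_measurable M" unfolding u'_def by measurable
  have lim: "AE x in M. (\<lambda>i. u (r i) x) \<longlonglongrightarrow> u' x"
    using r(2) by eventually_elim (simp add: u'_def Cauchy_convergent_iff convergent_LIMSEQ_iff)
  have bound: "integrable M (\<lambda>x. (norm (u n x - u' x))\<^sup>2) \<and> L2_sq M (\<lambda>x. u n x - u' x) \<le> e"
    if N: "\<forall>i\<ge>N. \<forall>j\<ge>N. L2_sq M (\<lambda>x. u i x - u j x) < e" and n: "n \<ge> N" for n N e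
  proof -
    have l: "AE x in M. (\<lambda>i. (norm (u n x - u (r i) x))\<^sup>2) \<longlonglongrightarrow> (norm (u n x - u' x))\<^sup>2"
      using lim by eventually_elim (intro tendsto_intros)
    have "L2_sq M (\<lambda>x. u n x - u (r i) x) \<le> e" if "i \<ge> N" for i
    proof -
      have "r i \<ge> N" using seq_suble[OF r(1), of i] that by linarith
      then show ?thesis using N n by (meson less_imp_le)
    qed
    then have "\<forall>\<^sub>F i in sequentially. L2_sq M (\<lambda>x. u n x - u (r i) x) \<le> e"
      using eventually_sequentially by blast
    then show ?thesis
      using integrable_Fatou(1,2)[of M "\<lambda>i x. (norm (u n x - u (r i) x))\<^sup>2" "\<lambda>x. (norm (u n x - u' x))\<^sup>2" e] intd l
      by simp
  qed
  obtain N1 where "\<forall>i\<ge>N1. \<forall>j\<ge>N1. L2_sq M (\<lambda>x. u i x - u j x) < 1" using Cauchy[of 1] by auto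
  then have "square_integrable M (\<lambda>x. u N1 x - u' x)"
    using bound[of N1 1 N1] by (simp add: square_integrable_def)
  from square_integrable_diff[OF u[of N1] this] have sq: "square_integrable M u'" by simp
  have "(\<lambda>n. L2_sq M (\<lambda>x. u n x - u' x)) \<longlonglongrightarrow> 0"
  proof (rule LIMSEQ_I)
    fix e :: real assume "e > 0"
    then obtain N where N: "\<forall>i\<ge>N. \<forall>j\<ge>N. L2_sq M (\<lambda>x. u i x - u j x) < e / 2" using Cauchy[of "e / 2"] by auto
    have "norm (L2_sq M (\<lambda>x. u n x - u' x) - 0) < e" if "n \<ge> N" for n
      using bound[OF N that] \<open>e > 0\<close> by simp
    then show "\<exists>N. \<forall>n\<ge>N. norm (L2_sq M (\<lambda>x. u n x - u' x) - 0) < e" by blast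
  qed
  then show thesis using that sq by blast
qed

section \<open>Interpolation between powers\<close>

lemma powr_interpolation:
  fixes t T p q :: real
  assumes "t \<ge> 0" "T > 0" "0 \<le> p" "p \<le> q"
  shows "t powr p \<le> T powr (p - q) * t powr q + T powr p"
proof (cases "t \<le> T")
  case True
  then have "t powr p \<le> T powr p" using assms by (intro powr_mono2) auto
  then show ?thesis using powr_ge_zero[of T "p - q"] powr_ge_zero[of t q] by (simp add: add_increasing)
next
  case False
  have "t powr p = t powr (p - q) * t powr q" using False assms by (simp flip: powr_add)
  also have "\<dots> \<le> T powr (p - q) * t powr q"
    using False assms by (intro mult_right_mono powr_mono2') auto
  finally show ?thesis using powr_ge_zero[of T p] by linarith
qed

lemma powr_eps_bound:
  fixes \<epsilon> p q :: real
  assumes "\<epsilon> > 0" "0 \<le> p" "p < q"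
  obtains C where "C \<ge> 0" "\<And>t. t \<ge> 0 \<Longrightarrow> t powr p \<le> \<epsilon> * t powr q + C"
proof -
  \<comment> \<open>The exponent p - q is negative and this threshold satisfies T^(p-q) =
    \<epsilon>; above it t^p is at most \<epsilon> t^q, below it at most T^p.\<close>
  define T where "T = \<epsilon> powr (1 / (p - q))"
  have T: "T > 0" "T powr (p - q) = \<epsilon>" using assms by (simp_all add: T_def powr_powr)
  have "t powr p \<le> \<epsilon> * t powr q + T powr p" if "t \<ge> 0" for t
    using powr_interpolation[OF that T(1) assms(2), of q] T(2) assms by simp
  then show thesis using that[of "T powr p"] by simp
qed

section \<open>The space $H^1_0(\Omega)$\<close>

lemma L2_on_square_integrable: "L2_on \<Omega> u \<longleftrightarrow> square_integrable (lebesgue_on \<Omega>) u"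
  by (simp add: L2_on_def square_integrable_def)

lemma integrable_lebesgue_on_supp:
  fixes f :: "'a::euclidean_space \<Rightarrow> 'b::euclidean_space"
  assumes "S \<subseteq> T" "S \<in> sets lebesgue" "T \<in> sets lebesgue" "\<And>x. x \<in> T - S \<Longrightarrow> f x = 0"
  shows "integrable (lebesgue_on T) f \<longleftrightarrow> integrable (lebesgue_on S) f"
    and "integral\<^sup>L (lebesgue_on T) f = integral\<^sup>L (lebesgue_on S) f"
proof -
  have "(\<lambda>x. indicator T x *\<^sub>R f x) = (\<lambda>x. indicator S x *\<^sub>R f x)"
    using assms(1,4) by (intro ext) (auto simp: indicator_def)
  then show "integrable (lebesgue_on T) f \<longleftrightarrow> integrable (lebesgue_on S) f"
    "integral\<^sup>L (lebesgue_on T) f = integral\<^sup>L (lebesgue_on S) f"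
    using assms by (simp_all add: integrable_restrict_space integral_restrict_space)
qed

lemma borel_measurable_lebesgue_onI:
  "f \<in> borel_measurable borel \<Longrightarrow> f \<in> borel_measurable (lebesgue_on S)"
  by (intro measurable_restrict_space1 measurable_completion) simp

lemma borel_supp_lebesgue_on:
  fixes f :: "'a::euclidean_space \<Rightarrow> 'b::euclidean_space"
  assumes "f \<in> borel_measurable borel" "S \<in> sets lebesgue" "\<And>x. x \<notin> S \<Longrightarrow> f x = 0"
  shows "integral\<^sup>L (lebesgue_on S) f = integral\<^sup>L lborel f"
    and "integrable (lebesgue_on S) f \<longleftrightarrow> integrable lborel f"
proof -
  have "integral\<^sup>L (lebesgue_on UNIV) f = integral\<^sup>L (lebesgue_on S) f"
    "integrable (lebesgue_on UNIV) f \<longleftrightarrow> integrable (lebesgue_on S) f"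
    using integrable_lebesgue_on_supp[of S UNIV f] assms by auto
  then show "integral\<^sup>L (lebesgue_on S) f = integral\<^sup>L lborel f"
    "integrable (lebesgue_on S) f \<longleftrightarrow> integrable lborel f"
    using assms(1) by (simp_all add: lebesgue_on_UNIV_eq integral_completion integrable_completion)
qed

text \<open>Extension by 0 moves both functions to the complete measure \<open>lebesgue\<close>,
  where a function equal almost everywhere to a measurable one is measurable.\<close>

lemma borel_measurable_lebesgue_on_AE:
  fixes f :: "'a::euclidean_space \<Rightarrow> 'b::euclidean_space"
  assumes "f \<in> borel_measurable (lebesgue_on S)" "S \<in> sets lebesgue" "AE x in lebesgue_on S. f x = g x"
  shows "g \<in> borel_measurable (lebesgue_on S)"
proof -
  have "(\<lambda>x. if x \<in> S then g x else 0) \<in> borel_measurable lebesgue"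
  proof (rule borel_measurable_AE)
    show "(\<lambda>x. if x \<in> S then f x else 0) \<in> borel_measurable lebesgue"
      using assms by (simp add: borel_measurable_if)
    have "AE x in lebesgue. x \<in> S \<longrightarrow> f x = g x"
      using assms(2,3) by (simp add: AE_restrict_space_iff)
    then show "AE x in lebesgue. (if x \<in> S then f x else 0) = (if x \<in> S then g x else 0)"
      by eventually_elim auto
  qed
  then show ?thesis using assms(2) by (simp add: borel_measurable_if)
qed

lemma test_function_C1:
  assumes "\<phi> \<in> test_functions \<Omega>"
  obtains D K where "C1_compact_support \<phi> D K" "K \<subseteq> \<Omega>"
proof -
  have "C_k (Suc 0) \<phi>" using assms unfolding test_functions_def by blast
  then obtain D where D: "\<And>x. GDERIV \<phi> x :> D x" "\<And>b. b \<in> Basis \<Longrightarrow> continuous_on UNIV (\<lambda>x. D x \<bullet> b)"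
    unfolding C_k.simps by blast
  obtain K where K: "compact K" "K \<subseteq> \<Omega>" "\<And>x. x \<notin> K \<Longrightarrow> \<phi> x = 0"
    using assms unfolding test_functions_def by blast
  have "continuous_on UNIV D" using D(2) by (subst continuous_on_componentwise) blast
  then have "C1_compact_support \<phi> D K" using D(1) K by unfold_locales auto
  then show thesis using that K by blast
qed

lemma test_function_C1_grad:
  assumes "\<phi> \<in> test_functions \<Omega>" "\<And>x. GDERIV \<phi> x :> D x"
  obtains K where "C1_compact_support \<phi> D K" "K \<subseteq> \<Omega>"
proof -
  obtain D' K where DK: "C1_compact_support \<phi> D' K" "K \<subseteq> \<Omega>" using test_function_C1[OF assms(1)] by blast
  then have "D' = D" using assms(2) GDERIV_unique C1_compact_support.grad by blast
  then show thesis using that DK by blast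
qed

text \<open>Order k of a partial derivative is read off from order k + 1 of the function, the
  gradient being unique; the compact set K is kept.\<close>

lemma test_function_partial:
  assumes "\<phi> \<in> test_functions \<Omega>" "\<And>x. GDERIV \<phi> x :> D x" "b \<in> Basis"
  shows "(\<lambda>x. D x \<bullet> b) \<in> test_functions \<Omega>"
proof -
  have "C_k k (\<lambda>x. D x \<bullet> b)" for k
  proof -
    have "C_k (Suc k) \<phi>" using assms(1) unfolding test_functions_def by blast
    then obtain E where E: "\<And>x. GDERIV \<phi> x :> E x" "\<And>b. b \<in> Basis \<Longrightarrow> C_k k (\<lambda>x. E x \<bullet> b)"
      unfolding C_k.simps by blast
    have "E = D" using E(1) assms(2) GDERIV_unique by blast
    then show ?thesis using E(2) assms(3) by blast
  qed
  moreover obtain K where K: "C1_compact_support \<phi> D K" "K \<subseteq> \<Omega>"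
    using test_function_C1_grad[OF assms(1,2)] by blast
  moreover have "\<forall>x. x \<notin> K \<longrightarrow> D x \<bullet> b = 0" using C1_compact_support.supp_D[OF K(1)] by simp
  ultimately show ?thesis
    unfolding test_functions_def using C1_compact_support.compact_K[OF K(1)] by blast
qed

lemma test_functions_add:
  assumes "\<phi> \<in> test_functions \<Omega>" "\<psi> \<in> test_functions \<Omega>"
  shows "(\<lambda>x. \<phi> x + \<psi> x) \<in> test_functions \<Omega>"
proof -
  obtain K where K: "compact K" "K \<subseteq> \<Omega>" "\<forall>x. x \<notin> K \<longrightarrow> \<phi> x = 0"
    using assms(1) unfolding test_functions_def by blast
  obtain L where L: "compact L" "L \<subseteq> \<Omega>" "\<forall>x. x \<notin> L \<longrightarrow> \<psi> x = 0"
    using assms(2) unfolding test_functions_def by blast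
  have "compact (K \<union> L)" "K \<union> L \<subseteq> \<Omega>" "\<forall>x. x \<notin> K \<union> L \<longrightarrow> \<phi> x + \<psi> x = 0" using K L by auto
  moreover have "\<forall>k. C_k k (\<lambda>x. \<phi> x + \<psi> x)"
    using assms C_k_add unfolding test_functions_def by blast
  ultimately show ?thesis unfolding test_functions_def by blast
qed

lemma test_functions_scale:
  assumes "\<phi> \<in> test_functions \<Omega>"
  shows "(\<lambda>x. c * \<phi> x) \<in> test_functions \<Omega>"
proof -
  obtain K where K: "compact K" "K \<subseteq> \<Omega>" "\<forall>x. x \<notin> K \<longrightarrow> c * \<phi> x = 0"
    using assms(1) unfolding test_functions_def by auto
  moreover have "\<forall>k. C_k k (\<lambda>x. c * \<phi> x)"
    using assms C_k_mult[OF C_k_const] unfolding test_functions_def by blast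
  ultimately show ?thesis unfolding test_functions_def by blast
qed

text \<open>By translation invariance every difference quotient has integral 0. Quotients with step
  at most 1 vanish outside a ball of radius R + 1 and are bounded by the mean value theorem, so the
  integral passes to the limit.\<close>

lemma integral_partial_eq_0:
  assumes "C1_compact_support \<phi> D K"
  shows "(LINT x|lborel. D x) = 0"
proof -
  interpret C1_compact_support \<phi> D K by fact
  have int_D: "integrable lborel D" by (intro integrable_if_supp cont_D) (rule supp_D)
  have "(LINT x|lborel. D x) \<bullet> b = 0" if b: "b \<in> Basis" for b
  proof -
    obtain R where R: "\<And>y. y \<in> K \<Longrightarrow> norm y \<le> R"
      using compact_K compact_imp_bounded bounded_pos by metis
    have "bounded (D ` K)" using compact_K cont_D
      by (intro compact_imp_bounded compact_continuous_image) (auto intro: continuous_on_subset)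
    then obtain B where B: "\<And>y. y \<in> K \<Longrightarrow> norm (D y) \<le> B" "B > 0" by (auto simp: bounded_pos)
    then have DB: "norm (D y) \<le> B" for y using supp_D[of y] by (cases "y \<in> K") auto
    define s where "s n x = real (Suc n) * (\<phi> (x + (1 / real (Suc n)) *\<^sub>R b) - \<phi> x)" for n x
    have int_shift: "integrable lborel (\<lambda>x. \<phi> (x + z))" "(LINT x|lborel. \<phi> (x + z)) = (LINT x|lborel. \<phi> x)" for z
      using integrable_shift[OF integrable_phi, of z] by (simp_all add: add.commute)
    have "(LINT x|lborel. s n x) = 0" for n
      unfolding s_def using int_shift integrable_phi by simp
    moreover have "(\<lambda>n. LINT x|lborel. s n x) \<longlonglongrightarrow> (LINT x|lborel. b \<bullet> D x)"
    proof (rule integral_dominated_convergence[where w = "\<lambda>x. indicator (cball 0 (R + 1)) x * B"])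
      show "AE x in lborel. (\<lambda>n. s n x) \<longlonglongrightarrow> b \<bullet> D x"
      proof (rule AE_I2)
        fix x
        have "((\<lambda>r. \<phi> (x + r *\<^sub>R b)) has_real_derivative b \<bullet> D (x + 0 *\<^sub>R b)) (at 0)"
          by (rule GDERIV_line[OF grad])
        then have "(\<lambda>h. (\<phi> (x + h *\<^sub>R b) - \<phi> x) / h) \<midarrow>0\<rightarrow> b \<bullet> D x"
          unfolding DERIV_def by simp
        moreover have "filterlim (\<lambda>n. 1 / real (Suc n)) (at 0) sequentially"
          using LIMSEQ_Suc[OF lim_1_over_n] by (auto simp: filterlim_at)
        ultimately have "(\<lambda>n. (\<phi> (x + (1 / real (Suc n)) *\<^sub>R b) - \<phi> x) / (1 / real (Suc n))) \<longlonglongrightarrow> b \<bullet> D x"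
          by (rule filterlim_compose)
        then show "(\<lambda>n. s n x) \<longlonglongrightarrow> b \<bullet> D x" by (simp add: s_def mult.commute)
      qed
      show "AE x in lborel. norm (s n x) \<le> indicator (cball 0 (R + 1)) x * B" for n
      proof (rule AE_I2)
        fix x
        have "1 / real (Suc n) \<le> 1" by simp
        show "norm (s n x) \<le> indicator (cball 0 (R + 1)) x * B"
        proof (cases "x \<in> cball 0 (R + 1)")
          case True
          have "\<exists>z>0. z < 1 / real (Suc n) \<and> \<phi> (x + (1 / real (Suc n)) *\<^sub>R b) - \<phi> (x + 0 *\<^sub>R b) = (1 / real (Suc n) - 0) * (b \<bullet> D (x + z *\<^sub>R b))"
            by (rule MVT2[of 0 "1 / real (Suc n)" "\<lambda>r. \<phi> (x + r *\<^sub>R b)"]) (auto intro: GDERIV_line[OF grad])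
          then obtain z where "\<phi> (x + (1 / real (Suc n)) *\<^sub>R b) - \<phi> x = (1 / real (Suc n)) * (b \<bullet> D (x + z *\<^sub>R b))" by auto
          then have "s n x = b \<bullet> D (x + z *\<^sub>R b)" by (simp add: s_def)
          also have "norm \<dots> \<le> norm b * norm (D (x + z *\<^sub>R b))" by (simp add: Cauchy_Schwarz_ineq2)
          also have "\<dots> \<le> B" using b DB by simp
          finally show ?thesis using True by simp
        next
          case False
          then have x: "norm x > R + 1" by simp
          have "norm x \<le> norm (x + (1 / real (Suc n)) *\<^sub>R b) + norm ((1 / real (Suc n)) *\<^sub>R b)"
            using norm_triangle_ineq4[of "x + (1 / real (Suc n)) *\<^sub>R b" "(1 / real (Suc n)) *\<^sub>R b"] by simp
          moreover have "norm ((1 / real (Suc n)) *\<^sub>R b) \<le> 1" using b by simp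
          ultimately have "norm (x + (1 / real (Suc n)) *\<^sub>R b) > R" using x by linarith
          then have "x \<notin> K" "x + (1 / real (Suc n)) *\<^sub>R b \<notin> K" using R x by force+
          then show ?thesis using supp False by (simp add: s_def)
        qed
      qed
      show "integrable lborel (\<lambda>x. indicator (cball (0::'a) (R + 1)) x * B)"
        using emeasure_lborel_cball_finite[of "0::'a" "R + 1"] by (intro integrable_mult_left integrable_real_indicator) auto
    qed (unfold s_def, measurable)
    ultimately have "(LINT x|lborel. b \<bullet> D x) = 0" by (simp add: LIMSEQ_const_iff)
    then show ?thesis using int_D by (simp add: inner_commute)
  qed
  then show ?thesis using euclidean_eqI[of _ "0::'a"] by simp
qed

text \<open>Integration by parts: the product of the two functions is again C^1 with compact
  support, so its gradient integrates to 0.\<close>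

lemma has_weak_gradient_test:
  assumes "open \<Omega>" "\<phi> \<in> test_functions \<Omega>" "\<And>x. GDERIV \<phi> x :> D x"
  shows "has_weak_gradient \<Omega> \<phi> D"
proof -
  obtain K where K: "C1_compact_support \<phi> D K" "K \<subseteq> \<Omega>" using test_function_C1_grad[OF assms(2,3)] by blast
  interpret C1_compact_support \<phi> D K by (rule K)
  have \<Omega>: "\<Omega> \<in> sets lebesgue" using assms(1) by auto
  have loc: "locally_integrable_on f \<Omega>" if "continuous_on UNIV f" for f :: "'a \<Rightarrow> 'b::euclidean_space"
    unfolding locally_integrable_on_def
  proof (intro allI impI)
    fix L assume "compact L \<and> L \<subseteq> \<Omega>"
    then have L: "compact L" "L \<in> sets lborel" using borel_compact by auto
    have "integrable lborel (\<lambda>x. indicator L x *\<^sub>R f x)"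
      using that L by (intro borel_integrable_compact) (auto intro: continuous_on_subset)
    then have "integrable lebesgue (\<lambda>x. indicator L x *\<^sub>R f x)"
      using integrable_completion[of "\<lambda>x. indicator L x *\<^sub>R f x" lborel] by auto
    then show "integrable (lebesgue_on L) f" using L by (simp add: integrable_restrict_space)
  qed
  have "(LINT x|lebesgue_on \<Omega>. \<phi> x *\<^sub>R E x) = - (LINT x|lebesgue_on \<Omega>. \<psi> x *\<^sub>R D x)"
    if \<psi>: "\<psi> \<in> test_functions \<Omega>" "\<And>x. GDERIV \<psi> x :> E x" for \<psi> E
  proof -
    obtain L where "C1_compact_support \<psi> E L" "L \<subseteq> \<Omega>" using test_function_C1_grad[OF \<psi>] by blast
    then interpret \<psi>: C1_compact_support \<psi> E L by blast
    have prod: "C1_compact_support (\<lambda>x. \<phi> x * \<psi> x) (\<lambda>x. \<phi> x *\<^sub>R E x + \<psi> x *\<^sub>R D x) K"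
      by unfold_locales
        (auto intro: GDERIV_mult grad \<psi>.grad intro!: continuous_intros cont \<psi>.cont cont_D \<psi>.cont_D compact_K simp: supp)
    have i1: "integrable lborel (\<lambda>x. \<phi> x *\<^sub>R E x)"
      by (intro integrable_if_supp continuous_intros cont \<psi>.cont_D) (simp add: supp)
    have i2: "integrable lborel (\<lambda>x. \<psi> x *\<^sub>R D x)"
      by (intro integrable_if_supp continuous_intros \<psi>.cont cont_D) (simp add: supp_D)
    have "(LINT x|lborel. \<phi> x *\<^sub>R E x) + (LINT x|lborel. \<psi> x *\<^sub>R D x) = 0"
      using integral_partial_eq_0[OF prod] i1 i2 by simp
    moreover have "(LINT x|lebesgue_on \<Omega>. \<phi> x *\<^sub>R E x) = (LINT x|lborel. \<phi> x *\<^sub>R E x)"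
      using \<Omega> i1 supp K(2) by (intro borel_supp_lebesgue_on) auto
    moreover have "(LINT x|lebesgue_on \<Omega>. \<psi> x *\<^sub>R D x) = (LINT x|lborel. \<psi> x *\<^sub>R D x)"
      using \<Omega> i2 supp_D K(2) by (intro borel_supp_lebesgue_on) auto
    ultimately show ?thesis by (simp add: eq_neg_iff_add_eq_0)
  qed
  then show ?thesis unfolding has_weak_gradient_def using loc[OF cont] loc[OF cont_D] by blast
qed

text \<open>The difference of the two gradients integrates to 0 against every test function.
  Gradients are only locally integrable, so integrability of the products is obtained on the compact
  set carrying the test function.\<close>

lemma has_weak_gradient_unique:
  fixes \<Omega> :: "'a::euclidean_space set"
  assumes "open \<Omega>" "has_weak_gradient \<Omega> u g" "has_weak_gradient \<Omega> u g'"
  shows "AE x in lebesgue_on \<Omega>. g x = g' x"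
proof -
  have \<Omega>: "\<Omega> \<in> sets lebesgue" using assms(1) by auto
  have loc: "locally_integrable_on g \<Omega>" "locally_integrable_on g' \<Omega>"
    using assms unfolding has_weak_gradient_def by blast+
  have "AE x in lebesgue_on \<Omega>. g x - g' x = 0"
  proof (rule fundamental_lemma[OF assms(1)])
    show "locally_integrable_on (\<lambda>x. g x - g' x) \<Omega>"
      using loc unfolding locally_integrable_on_def by (blast intro: Bochner_Integration.integrable_diff)
    fix \<phi> assume \<phi>: "\<phi> \<in> test_functions \<Omega>"
    obtain D K where K: "C1_compact_support \<phi> D K" "K \<subseteq> \<Omega>" using test_function_C1[OF \<phi>] by blast
    interpret C1_compact_support \<phi> D K by (rule K)
    have int: "integrable (lebesgue_on \<Omega>) (\<lambda>x. \<phi> x *\<^sub>R w x)" if w: "locally_integrable_on w \<Omega>" for w :: "'a \<Rightarrow> 'a"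
    proof -
      have Kl: "K \<in> sets lebesgue" using compact_K by (simp add: borel_compact)
      have wK: "integrable (lebesgue_on K) w" using w compact_K K(2) unfolding locally_integrable_on_def by blast
      have "bounded (\<phi> ` K)" using compact_K cont
        by (intro compact_imp_bounded compact_continuous_image) (auto intro: continuous_on_subset)
      then obtain B where B: "\<And>y. y \<in> K \<Longrightarrow> \<bar>\<phi> y\<bar> \<le> B" by (auto simp: bounded_iff)
      have "integrable (lebesgue_on K) (\<lambda>x. \<phi> x *\<^sub>R w x)"
      proof (rule Bochner_Integration.integrable_bound)
        show "integrable (lebesgue_on K) (\<lambda>x. B * norm (w x))" using wK by simp
        show "(\<lambda>x. \<phi> x *\<^sub>R w x) \<in> borel_measurable (lebesgue_on K)"
          by (rule borel_measurable_scaleR[OF borel_measurable_lebesgue_onI[OF measurable_phi] borel_measurable_integrable[OF wK]])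
        show "AE x in lebesgue_on K. norm (\<phi> x *\<^sub>R w x) \<le> norm (B * norm (w x))"
          using B by (intro AE_I2) (auto simp: abs_mult intro!: mult_right_mono order_trans[OF _ abs_ge_self])
      qed
      then show ?thesis
        using integrable_lebesgue_on_supp(1)[OF K(2) Kl \<Omega>, of "\<lambda>x. \<phi> x *\<^sub>R w x"] supp by auto
    qed
    have "(LINT x|lebesgue_on \<Omega>. u x *\<^sub>R D x) = - (LINT x|lebesgue_on \<Omega>. \<phi> x *\<^sub>R g x)"
      using assms(2) \<phi> grad unfolding has_weak_gradient_def by blast
    moreover have "(LINT x|lebesgue_on \<Omega>. u x *\<^sub>R D x) = - (LINT x|lebesgue_on \<Omega>. \<phi> x *\<^sub>R g' x)"
      using assms(3) \<phi> grad unfolding has_weak_gradient_def by blast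
    ultimately have "(LINT x|lebesgue_on \<Omega>. \<phi> x *\<^sub>R g x) = (LINT x|lebesgue_on \<Omega>. \<phi> x *\<^sub>R g' x)" by simp
    then show "(LINT x|lebesgue_on \<Omega>. \<phi> x *\<^sub>R (g x - g' x)) = 0"
      using int loc by (simp add: scaleR_diff_right)
  qed
  then show ?thesis by simp
qed

lemma square_integrable_mult_scaleR:
  fixes u :: "'a \<Rightarrow> real" and v :: "'a \<Rightarrow> 'b::euclidean_space"
  assumes "square_integrable M u" "square_integrable M v"
  shows "integrable M (\<lambda>x. u x *\<^sub>R v x)"
proof -
  have n: "square_integrable M (\<lambda>x. norm (u x))" "square_integrable M (\<lambda>x. norm (v x))"
    using assms by (auto simp: square_integrable_def)
  show ?thesis
  proof (rule Bochner_Integration.integrable_bound[OF square_integrable_inner[OF n]])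
    show "(\<lambda>x. u x *\<^sub>R v x) \<in> borel_measurable M"
      using assms by (auto simp: square_integrable_def intro: borel_measurable_scaleR)
  qed simp
qed

lemma square_integrable_cong_AE:
  assumes "square_integrable M u" "v \<in> borel_measurable M" "AE x in M. u x = v x"
  shows "square_integrable M v" "L2_sq M v = L2_sq M u"
proof -
  have [measurable]: "u \<in> borel_measurable M" "v \<in> borel_measurable M"
    using assms by (auto simp: square_integrable_def)
  have ae: "AE x in M. (norm (u x))\<^sup>2 = (norm (v x))\<^sup>2" using assms(3) by eventually_elim simp
  show "L2_sq M v = L2_sq M u" by (rule integral_cong_AE[symmetric]) (use ae in auto)
  have "integrable M (\<lambda>x. (norm (v x))\<^sup>2)"
    by (rule integrable_cong_AE_imp[where g = "\<lambda>x. (norm (u x))\<^sup>2"]) (use assms ae in \<open>auto simp: square_integrable_def\<close>)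
  then show "square_integrable M v" using assms(2) by (simp add: square_integrable_def)
qed

locale bounded_domain =
  fixes \<Omega> :: "'a::euclidean_space set"
  assumes open_\<Omega>: "open \<Omega>" and bounded_\<Omega>: "bounded \<Omega>" and nonempty_\<Omega>: "\<Omega> \<noteq> {}"
    and dim: "DIM('a) \<ge> 3"
begin

abbreviation "M \<equiv> lebesgue_on \<Omega>"

lemma crit_exp_gt: "crit_exp DIM('a) > 2"
  using crit_exp_gt_2[OF dim] .

lemma sets_\<Omega>: "\<Omega> \<in> sets lebesgue"
  using open_\<Omega> by auto

sublocale finite_measure M
  using bounded_\<Omega> sets_\<Omega> by (intro finite_measure_lebesgue_on bounded_set_imp_lmeasurable)

lemma square_integrable_loc:
  fixes u :: "'a \<Rightarrow> 'b::euclidean_space"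
  assumes "square_integrable M u"
  shows "locally_integrable_on u \<Omega>"
  unfolding locally_integrable_on_def
proof (intro allI impI)
  fix K assume K: "compact K \<and> K \<subseteq> \<Omega>"
  then have Kl: "K \<in> sets lebesgue" by (simp add: borel_compact)
  have "integrable lebesgue (\<lambda>x. indicator \<Omega> x *\<^sub>R u x)"
    using square_integrable_L1(1)[OF assms] sets_\<Omega> by (simp add: integrable_restrict_space)
  from integrable_mult_indicator[OF Kl this]
  have "integrable lebesgue (\<lambda>x. indicator K x *\<^sub>R (indicator \<Omega> x *\<^sub>R u x))" .
  moreover have "(\<lambda>x. indicator K x *\<^sub>R (indicator \<Omega> x *\<^sub>R u x)) = (\<lambda>x. indicator K x *\<^sub>R u x)"
    using K by (intro ext) (auto simp: indicator_def)
  ultimately show "integrable (lebesgue_on K) u" using Kl by (simp add: integrable_restrict_space)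
qed

text \<open>A relation between a function and any of its weak gradients, so that sums, multiples and
  limits can be handled with explicit gradients; the choice inside \<open>weak_grad\<close> is
  unfolded only in \<open>has_L2_grad_weak_grad\<close>.\<close>

definition has_L2_grad :: "('a \<Rightarrow> real) \<Rightarrow> ('a \<Rightarrow> 'a) \<Rightarrow> bool" where
  "has_L2_grad u g \<longleftrightarrow> square_integrable M u \<and> square_integrable M g \<and> has_weak_gradient \<Omega> u g"

lemma C1_lebesgue_on:
  assumes "C1_compact_support \<phi> D K" "K \<subseteq> \<Omega>"
  shows "square_integrable M \<phi>" "square_integrable M D"
    "L2_sq M D = (LINT x|lborel. (norm (D x))\<^sup>2)"
    "r > 0 \<Longrightarrow> integrable M (\<lambda>x. \<bar>\<phi> x\<bar> powr r)"
    "r > 0 \<Longrightarrow> (LINT x|M. \<bar>\<phi> x\<bar> powr r) = (LINT x|lborel. \<bar>\<phi> x\<bar> powr r)"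
proof -
  interpret C1_compact_support \<phi> D K by fact
  have out: "\<phi> x = 0" "D x = 0" if "x \<notin> \<Omega>" for x
    using supp supp_D assms(2) that by blast+
  have "integrable lborel (\<lambda>x. (norm (\<phi> x))\<^sup>2)"
    by (intro integrable_if_supp continuous_intros cont) (simp add: supp)
  then have "integrable M (\<lambda>x. (norm (\<phi> x))\<^sup>2)"
    using borel_supp_lebesgue_on(2)[OF _ sets_\<Omega>, of "\<lambda>x. (norm (\<phi> x))\<^sup>2"] out by simp
  then show "square_integrable M \<phi>"
    using borel_measurable_lebesgue_onI[OF measurable_phi] by (simp add: square_integrable_def)
  have "integrable M (\<lambda>x. (norm (D x))\<^sup>2)"
    using borel_supp_lebesgue_on(2)[OF _ sets_\<Omega>, of "\<lambda>x. (norm (D x))\<^sup>2"] out integrable_norm_D2 by simp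
  then show "square_integrable M D"
    using borel_measurable_lebesgue_onI[OF measurable_D] by (simp add: square_integrable_def)
  show "L2_sq M D = (LINT x|lborel. (norm (D x))\<^sup>2)"
    using out by (intro borel_supp_lebesgue_on(1) sets_\<Omega>) auto
  show "(LINT x|M. \<bar>\<phi> x\<bar> powr r) = (LINT x|lborel. \<bar>\<phi> x\<bar> powr r)" if "r > 0"
    using out by (intro borel_supp_lebesgue_on(1) sets_\<Omega>) auto
  show "integrable M (\<lambda>x. \<bar>\<phi> x\<bar> powr r)" if "r > 0"
  proof -
    have "integrable lborel (\<lambda>x. \<bar>\<phi> x\<bar> powr r)"
      using that by (intro integrable_if_supp continuous_on_powr' continuous_intros cont) (auto simp: supp)
    then show ?thesis
      using borel_supp_lebesgue_on(2)[OF _ sets_\<Omega>, of "\<lambda>x. \<bar>\<phi> x\<bar> powr r"] out by simp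
  qed
qed

lemma test_square_integrable:
  assumes "\<phi> \<in> test_functions \<Omega>" "\<And>x. GDERIV \<phi> x :> D x"
  shows "square_integrable M \<phi>" "square_integrable M D"
proof -
  obtain K where "C1_compact_support \<phi> D K" "K \<subseteq> \<Omega>" using test_function_C1_grad[OF assms] by blast
  then show "square_integrable M \<phi>" "square_integrable M D" using C1_lebesgue_on by blast+
qed

lemma has_L2_gradI:
  assumes "square_integrable M u" "square_integrable M g"
    and "\<And>\<phi> D. \<phi> \<in> test_functions \<Omega> \<Longrightarrow> (\<And>x. GDERIV \<phi> x :> D x) \<Longrightarrow>
      (LINT x|M. u x *\<^sub>R D x) = - (LINT x|M. \<phi> x *\<^sub>R g x)"
  shows "has_L2_grad u g"
  unfolding has_L2_grad_def has_weak_gradient_def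
  by (intro conjI ballI allI impI square_integrable_loc assms) simp_all

lemma has_L2_grad_test:
  assumes "\<phi> \<in> test_functions \<Omega>" "\<And>x. GDERIV \<phi> x :> D x"
  shows "has_L2_grad \<phi> D"
  using has_weak_gradient_test[OF open_\<Omega> assms] test_square_integrable[OF assms] by (simp add: has_L2_grad_def)

lemma has_L2_gradD:
  assumes "has_L2_grad u g"
  shows "square_integrable M u" "square_integrable M g"
    "\<phi> \<in> test_functions \<Omega> \<Longrightarrow> (\<And>x. GDERIV \<phi> x :> D x) \<Longrightarrow> (LINT x|M. u x *\<^sub>R D x) = - (LINT x|M. \<phi> x *\<^sub>R g x)"
  using assms unfolding has_L2_grad_def has_weak_gradient_def by blast+

lemma has_L2_grad_add:
  assumes "has_L2_grad u g" "has_L2_grad v k"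
  shows "has_L2_grad (\<lambda>x. u x + v x) (\<lambda>x. g x + k x)"
proof (rule has_L2_gradI)
  fix \<phi> D assume \<phi>: "\<phi> \<in> test_functions \<Omega>" "\<And>x. GDERIV \<phi> x :> D x"
  note sq = test_square_integrable[OF \<phi>]
  have "(LINT x|M. (u x + v x) *\<^sub>R D x) = (LINT x|M. u x *\<^sub>R D x) + (LINT x|M. v x *\<^sub>R D x)"
    unfolding scaleR_add_left
    by (rule Bochner_Integration.integral_add) (intro square_integrable_mult_scaleR sq has_L2_gradD(1)[OF assms(1)] has_L2_gradD(1)[OF assms(2)])+
  also have "\<dots> = - ((LINT x|M. \<phi> x *\<^sub>R g x) + (LINT x|M. \<phi> x *\<^sub>R k x))"
    using has_L2_gradD(3)[OF assms(1) \<phi>] has_L2_gradD(3)[OF assms(2) \<phi>] by simp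
  also have "(LINT x|M. \<phi> x *\<^sub>R g x) + (LINT x|M. \<phi> x *\<^sub>R k x) = (LINT x|M. \<phi> x *\<^sub>R (g x + k x))"
    unfolding scaleR_add_right
    by (rule Bochner_Integration.integral_add[symmetric]) (intro square_integrable_mult_scaleR sq has_L2_gradD(2)[OF assms(1)] has_L2_gradD(2)[OF assms(2)])+
  finally show "(LINT x|M. (u x + v x) *\<^sub>R D x) = - (LINT x|M. \<phi> x *\<^sub>R (g x + k x))" .
qed (intro square_integrable_add has_L2_gradD(1,2)[OF assms(1)] has_L2_gradD(1,2)[OF assms(2)])+

lemma has_L2_grad_scale:
  assumes "has_L2_grad u g"
  shows "has_L2_grad (\<lambda>x. c * u x) (\<lambda>x. c *\<^sub>R g x)"
proof (rule has_L2_gradI)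
  fix \<phi> D assume \<phi>: "\<phi> \<in> test_functions \<Omega>" "\<And>x. GDERIV \<phi> x :> D x"
  show "(LINT x|M. (c * u x) *\<^sub>R D x) = - (LINT x|M. \<phi> x *\<^sub>R (c *\<^sub>R g x))"
    using has_L2_gradD(3)[OF assms \<phi>] by (simp add: scaleR_left_commute flip: scaleR_scaleR)
next
  show "square_integrable M (\<lambda>x. c * u x)" using square_integrable_scaleR[OF has_L2_gradD(1)[OF assms], of c] by simp
qed (intro square_integrable_scaleR has_L2_gradD(2)[OF assms])

lemma has_L2_grad_diff:
  assumes "has_L2_grad u g" "has_L2_grad v k"
  shows "has_L2_grad (\<lambda>x. u x - v x) (\<lambda>x. g x - k x)"
  using has_L2_grad_add[OF assms(1) has_L2_grad_scale[OF assms(2), of "-1"]] by simp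

text \<open>The integration by parts identity passes to the limit because both sides are L^2
  pairings with a fixed function. It is tested coordinate by coordinate, with the partial
  derivatives of the test function as the fixed functions on the left.\<close>

lemma has_L2_grad_limit:
  assumes has_L2_grad: "\<And>n. has_L2_grad (u n) (g n)" and u': "square_integrable M u'" "square_integrable M g'"
    and lim: "(\<lambda>n. L2_sq M (\<lambda>x. u n x - u' x)) \<longlonglongrightarrow> 0" "(\<lambda>n. L2_sq M (\<lambda>x. g n x - g' x)) \<longlonglongrightarrow> 0"
  shows "has_L2_grad u' g'"
proof (rule has_L2_gradI[OF u'])
  fix \<phi> D assume \<phi>: "\<phi> \<in> test_functions \<Omega>" "\<And>x. GDERIV \<phi> x :> D x"
  note sq = test_square_integrable[OF \<phi>]
  have comp: "(LINT x|M. w x *\<^sub>R E x) \<bullet> b = (LINT x|M. w x \<bullet> (E x \<bullet> b))"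
    if "square_integrable M w" "square_integrable M E" for w :: "'a \<Rightarrow> real" and E :: "'a \<Rightarrow> 'a" and b
    using square_integrable_mult_scaleR[OF that] by (simp flip: integral_inner_left)
  have Db: "square_integrable M (\<lambda>x. D x \<bullet> b)" if "b \<in> Basis" for b
  proof -
    have "(\<lambda>x. D x \<bullet> b) \<in> test_functions \<Omega>" by (rule test_function_partial[OF \<phi> that])
    then obtain E K where "C1_compact_support (\<lambda>x. D x \<bullet> b) E K" "K \<subseteq> \<Omega>"
      by (rule test_function_C1)
    then show ?thesis by (rule C1_lebesgue_on(1))
  qed
  have "(LINT x|M. u' x *\<^sub>R D x) \<bullet> b = (- (LINT x|M. \<phi> x *\<^sub>R g' x)) \<bullet> b" if b: "b \<in> Basis" for b
  proof -
    have \<phi>b: "square_integrable M (\<lambda>x. \<phi> x *\<^sub>R b)"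
      using sq(1) b by (auto simp: square_integrable_def intro: borel_measurable_scaleR)
    have eq: "(LINT x|M. \<phi> x *\<^sub>R E x) \<bullet> b = (LINT x|M. E x \<bullet> (\<phi> x *\<^sub>R b))" if "square_integrable M E" for E
      using square_integrable_mult_scaleR[OF sq(1) that] by (simp flip: integral_inner_left)
    have "(\<lambda>n. LINT x|M. u n x \<bullet> (D x \<bullet> b)) \<longlonglongrightarrow> (LINT x|M. u' x \<bullet> (D x \<bullet> b))"
      by (intro L2_inner_tendsto has_L2_gradD(1)[OF has_L2_grad] u' Db b lim)
    then have 1: "(\<lambda>n. (LINT x|M. u n x *\<^sub>R D x) \<bullet> b) \<longlonglongrightarrow> (LINT x|M. u' x *\<^sub>R D x) \<bullet> b"
      using comp has_L2_gradD(1)[OF has_L2_grad] u' sq by simp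
    have "(\<lambda>n. - (LINT x|M. g n x \<bullet> (\<phi> x *\<^sub>R b))) \<longlonglongrightarrow> - (LINT x|M. g' x \<bullet> (\<phi> x *\<^sub>R b))"
      by (intro tendsto_minus L2_inner_tendsto has_L2_gradD(2)[OF has_L2_grad] u' \<phi>b lim)
    then have "(\<lambda>n. (- (LINT x|M. \<phi> x *\<^sub>R g n x)) \<bullet> b) \<longlonglongrightarrow> (- (LINT x|M. \<phi> x *\<^sub>R g' x)) \<bullet> b"
      using eq has_L2_gradD(2)[OF has_L2_grad] u' by simp
    moreover have "(\<lambda>n. (- (LINT x|M. \<phi> x *\<^sub>R g n x)) \<bullet> b) = (\<lambda>n. (LINT x|M. u n x *\<^sub>R D x) \<bullet> b)"
      using has_L2_gradD(3)[OF has_L2_grad \<phi>] by simp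
    ultimately show ?thesis using LIMSEQ_unique[OF 1] by simp
  qed
  then show "(LINT x|M. u' x *\<^sub>R D x) = - (LINT x|M. \<phi> x *\<^sub>R g' x)" by (rule euclidean_eqI)
qed

text \<open>Uniqueness makes the chosen gradient equal to g almost everywhere; measurability, square
  integrability and the energy are inherited from g.\<close>

lemma has_L2_grad_weak_grad:
  assumes "has_L2_grad u g"
  shows "has_L2_grad u (weak_grad \<Omega> u)" "AE x in M. g x = weak_grad \<Omega> u x" "dirichlet \<Omega> u = L2_sq M g"
proof -
  have hw: "has_weak_gradient \<Omega> u (weak_grad \<Omega> u)"
    unfolding weak_grad_def using assms unfolding has_L2_grad_def by (blast intro: someI[where P = "has_weak_gradient \<Omega> u"])
  show ae: "AE x in M. g x = weak_grad \<Omega> u x"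
    using has_weak_gradient_unique[OF open_\<Omega> _ hw] assms by (simp add: has_L2_grad_def)
  have m: "weak_grad \<Omega> u \<in> borel_measurable M"
    using borel_measurable_lebesgue_on_AE[OF _ sets_\<Omega> ae] has_L2_gradD(2)[OF assms] by (simp add: square_integrable_def)
  show "has_L2_grad u (weak_grad \<Omega> u)"
    using hw has_L2_gradD(1)[OF assms] square_integrable_cong_AE(1)[OF has_L2_gradD(2)[OF assms] m ae] by (simp add: has_L2_grad_def)
  show "dirichlet \<Omega> u = L2_sq M g"
    using square_integrable_cong_AE(2)[OF has_L2_gradD(2)[OF assms] m ae] by (simp add: dirichlet_def)
qed

lemma H1_iff: "u \<in> H1 \<Omega> \<longleftrightarrow> (\<exists>g. has_L2_grad u g)"
  by (auto simp: H1_def has_L2_grad_def L2_on_square_integrable)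

text \<open>The density condition of \<open>H10\<close> with squared distances and the gradient of
  the test function made explicit; for a pair in \<open>has_L2_grad\<close> it characterises the
  space by \<open>H10_iff\<close>.\<close>

definition approx :: "('a \<Rightarrow> real) \<Rightarrow> ('a \<Rightarrow> 'a) \<Rightarrow> bool" where
  "approx u g \<longleftrightarrow> (\<forall>\<epsilon>>0. \<exists>\<phi>\<in>test_functions \<Omega>. \<exists>D. (\<forall>x. GDERIV \<phi> x :> D x) \<and>
     L2_sq M (\<lambda>x. u x - \<phi> x) + L2_sq M (\<lambda>x. g x - D x) < \<epsilon>)"

lemma test_function_grad: "\<phi> \<in> test_functions \<Omega> \<Longrightarrow> \<exists>D. \<forall>x. GDERIV \<phi> x :> D x"
  using test_function_C1 C1_compact_support.grad by metis

lemma H1_norm_diff: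
  assumes "has_L2_grad u g" "\<phi> \<in> test_functions \<Omega>" "\<And>x. GDERIV \<phi> x :> D x"
  shows "H1_norm \<Omega> (\<lambda>x. u x - \<phi> x) = sqrt (L2_sq M (\<lambda>x. u x - \<phi> x) + L2_sq M (\<lambda>x. g x - D x))"
  unfolding H1_norm_def using has_L2_grad_weak_grad(3)[OF has_L2_grad_diff[OF assms(1) has_L2_grad_test[OF assms(2,3)]]] by simp

lemma H10_iff:
  assumes "has_L2_grad u g"
  shows "u \<in> H10 \<Omega> \<longleftrightarrow> approx u g"
proof
  assume u: "u \<in> H10 \<Omega>"
  show "approx u g" unfolding approx_def
  proof (intro allI impI)
    fix \<epsilon> :: real assume \<epsilon>: "\<epsilon> > 0"
    then have "sqrt \<epsilon> > 0" by simp
    then obtain \<phi> where \<phi>: "\<phi> \<in> test_functions \<Omega>" "H1_norm \<Omega> (\<lambda>x. u x - \<phi> x) < sqrt \<epsilon>"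
      using u unfolding H10_def by blast
    then obtain D where D: "\<And>x. GDERIV \<phi> x :> D x" using test_function_grad by blast
    have "L2_sq M (\<lambda>x. u x - \<phi> x) + L2_sq M (\<lambda>x. g x - D x) < \<epsilon>"
      using \<phi>(2) unfolding H1_norm_diff[OF assms \<phi>(1) D] by simp
    then show "\<exists>\<phi>\<in>test_functions \<Omega>. \<exists>D. (\<forall>x. GDERIV \<phi> x :> D x) \<and>
        L2_sq M (\<lambda>x. u x - \<phi> x) + L2_sq M (\<lambda>x. g x - D x) < \<epsilon>" using \<phi>(1) D by blast
  qed
next
  assume a: "approx u g"
  have "\<exists>\<phi>\<in>test_functions \<Omega>. H1_norm \<Omega> (\<lambda>x. u x - \<phi> x) < \<epsilon>" if \<epsilon>: "\<epsilon> > 0" for \<epsilon>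
  proof -
    have "\<epsilon>\<^sup>2 > 0" using \<epsilon> by simp
    then obtain \<phi> D where \<phi>: "\<phi> \<in> test_functions \<Omega>" "\<And>x. GDERIV \<phi> x :> D x"
      and small: "L2_sq M (\<lambda>x. u x - \<phi> x) + L2_sq M (\<lambda>x. g x - D x) < \<epsilon>\<^sup>2"
      using a unfolding approx_def by blast
    have "H1_norm \<Omega> (\<lambda>x. u x - \<phi> x) < \<epsilon>"
      unfolding H1_norm_diff[OF assms \<phi>] using real_sqrt_less_mono[OF small] \<epsilon> by simp
    then show ?thesis using \<phi>(1) by blast
  qed
  then show "u \<in> H10 \<Omega>" using assms H1_iff unfolding H10_def by blast
qed

lemma H10_has_L2_grad:
  assumes "u \<in> H10 \<Omega>"
  shows "has_L2_grad u (weak_grad \<Omega> u)" "approx u (weak_grad \<Omega> u)"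
proof -
  obtain g where "has_L2_grad u g" using assms H1_iff unfolding H10_def by blast
  then show "has_L2_grad u (weak_grad \<Omega> u)" by (rule has_L2_grad_weak_grad)
  then show "approx u (weak_grad \<Omega> u)" using assms H10_iff by blast
qed

lemma test_in_H10: "\<phi> \<in> test_functions \<Omega> \<Longrightarrow> \<phi> \<in> H10 \<Omega>"
proof -
  assume \<phi>: "\<phi> \<in> test_functions \<Omega>"
  then obtain D where D: "\<And>x. GDERIV \<phi> x :> D x" using test_function_grad by blast
  have "approx \<phi> D" unfolding approx_def using \<phi> D by (intro allI impI bexI[of _ \<phi>] exI[of _ D]) auto
  then show "\<phi> \<in> H10 \<Omega>" using H10_iff[OF has_L2_grad_test[OF \<phi> D]] by blast
qed

lemma approx_limit:
  assumes a: "\<And>n. approx (u n) (g n)" and has_L2_grad: "\<And>n. has_L2_grad (u n) (g n)" and has_L2_grad': "has_L2_grad u' g'"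
    and lim: "(\<lambda>n. L2_sq M (\<lambda>x. u n x - u' x)) \<longlonglongrightarrow> 0" "(\<lambda>n. L2_sq M (\<lambda>x. g n x - g' x)) \<longlonglongrightarrow> 0"
  shows "approx u' g'"
  unfolding approx_def
proof (intro allI impI)
  fix \<epsilon> :: real assume \<epsilon>: "\<epsilon> > 0"
  \<comment> \<open>The squared triangle inequality doubles every term: two errors below
    \<epsilon>/8 and a joint error below \<epsilon>/4 add up to less than \<epsilon>.\<close>
  have "\<forall>\<^sub>F n in sequentially. L2_sq M (\<lambda>x. u n x - u' x) < \<epsilon> / 8 \<and> L2_sq M (\<lambda>x. g n x - g' x) < \<epsilon> / 8"
    using \<epsilon> by (intro eventually_conj order_tendstoD(2)[OF lim(1)] order_tendstoD(2)[OF lim(2)]) auto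
  then obtain n where n: "L2_sq M (\<lambda>x. u n x - u' x) < \<epsilon> / 8" "L2_sq M (\<lambda>x. g n x - g' x) < \<epsilon> / 8"
    using eventually_happens'[OF sequentially_bot] by blast
  have "\<epsilon> / 4 > 0" using \<epsilon> by simp
  then obtain \<phi> D where \<phi>: "\<phi> \<in> test_functions \<Omega>" "\<And>x. GDERIV \<phi> x :> D x"
    and small: "L2_sq M (\<lambda>x. u n x - \<phi> x) + L2_sq M (\<lambda>x. g n x - D x) < \<epsilon> / 4"
    using a[of n] unfolding approx_def by blast
  note sq = has_L2_gradD(1,2)[OF has_L2_grad[of n]] has_L2_gradD(1,2)[OF has_L2_grad'] test_square_integrable[OF \<phi>]
  have "L2_sq M (\<lambda>x. (u' x - u n x) + (u n x - \<phi> x)) \<le> 2 * L2_sq M (\<lambda>x. u' x - u n x) + 2 * L2_sq M (\<lambda>x. u n x - \<phi> x)"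
    by (intro L2_sq_triangle square_integrable_diff sq)
  moreover have "L2_sq M (\<lambda>x. (g' x - g n x) + (g n x - D x)) \<le> 2 * L2_sq M (\<lambda>x. g' x - g n x) + 2 * L2_sq M (\<lambda>x. g n x - D x)"
    by (intro L2_sq_triangle square_integrable_diff sq)
  moreover have "L2_sq M (\<lambda>x. u' x - u n x) = L2_sq M (\<lambda>x. u n x - u' x)" "L2_sq M (\<lambda>x. g' x - g n x) = L2_sq M (\<lambda>x. g n x - g' x)"
    by (rule L2_sq_diff_commute)+
  ultimately have "L2_sq M (\<lambda>x. u' x - \<phi> x) + L2_sq M (\<lambda>x. g' x - D x) < \<epsilon>"
    using n small by simp
  then show "\<exists>\<phi>\<in>test_functions \<Omega>. \<exists>D. (\<forall>x. GDERIV \<phi> x :> D x) \<and>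
      L2_sq M (\<lambda>x. u' x - \<phi> x) + L2_sq M (\<lambda>x. g' x - D x) < \<epsilon>" using \<phi> by blast
qed

lemma H10_approx_seq:
  assumes "u \<in> H10 \<Omega>" "has_L2_grad u g"
  obtains \<phi> D where "\<And>n. \<phi> n \<in> test_functions \<Omega>" "\<And>n x. GDERIV (\<phi> n) x :> D n x"
    "(\<lambda>n. L2_sq M (\<lambda>x. \<phi> n x - u x)) \<longlonglongrightarrow> 0" "(\<lambda>n. L2_sq M (\<lambda>x. D n x - g x)) \<longlonglongrightarrow> 0"
proof -
  have "approx u g" using assms H10_iff by blast
  define Q where "Q n \<phi> D \<longleftrightarrow> \<phi> \<in> test_functions \<Omega> \<and> (\<forall>x. GDERIV \<phi> x :> D x) \<and>
      L2_sq M (\<lambda>x. u x - \<phi> x) + L2_sq M (\<lambda>x. g x - D x) < 1 / real (Suc n)" for n \<phi> D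
  have "\<exists>\<phi> D. Q n \<phi> D" for n
  proof -
    have "1 / real (Suc n) > 0" by simp
    then show ?thesis using \<open>approx u g\<close> unfolding approx_def Q_def by blast
  qed
  then obtain \<phi> D where "\<And>n. Q n (\<phi> n) (D n)" by metis
  then have \<phi>: "\<And>n::nat. \<phi> n \<in> test_functions \<Omega>" "\<And>n x. GDERIV (\<phi> n) x :> D n x"
    and s: "\<And>n. L2_sq M (\<lambda>x. u x - \<phi> n x) + L2_sq M (\<lambda>x. g x - D n x) < 1 / real (Suc n)"
    unfolding Q_def by blast+
  have s': "L2_sq M (\<lambda>x. \<phi> n x - u x) + L2_sq M (\<lambda>x. D n x - g x) < 1 / real (Suc n)" for n
    using s[of n] L2_sq_diff_commute[of M u "\<phi> n"] L2_sq_diff_commute[of M g "D n"] by simp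
  have l: "(\<lambda>n. 1 / real (Suc n)) \<longlonglongrightarrow> 0" using LIMSEQ_Suc[OF lim_1_over_n] by simp
  have "(\<lambda>n. L2_sq M (\<lambda>x. \<phi> n x - u x)) \<longlonglongrightarrow> 0"
  proof (rule tendsto_sandwich[OF _ _ tendsto_const l])
    show "\<forall>\<^sub>F n in sequentially. L2_sq M (\<lambda>x. \<phi> n x - u x) \<le> 1 / real (Suc n)"
    proof (intro always_eventually allI)
      fix n
      show "L2_sq M (\<lambda>x. \<phi> n x - u x) \<le> 1 / real (Suc n)"
        using s'[of n] L2_sq_nonneg[of M "\<lambda>x. D n x - g x"] by linarith
    qed
  qed simp
  moreover have "(\<lambda>n. L2_sq M (\<lambda>x. D n x - g x)) \<longlonglongrightarrow> 0"
  proof (rule tendsto_sandwich[OF _ _ tendsto_const l])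
    show "\<forall>\<^sub>F n in sequentially. L2_sq M (\<lambda>x. D n x - g x) \<le> 1 / real (Suc n)"
    proof (intro always_eventually allI)
      fix n
      show "L2_sq M (\<lambda>x. D n x - g x) \<le> 1 / real (Suc n)"
        using s'[of n] L2_sq_nonneg[of M "\<lambda>x. \<phi> n x - u x"] by linarith
    qed
  qed simp
  ultimately show thesis by (rule that[OF \<phi>])
qed

lemma H10_limit:
  assumes u: "\<And>n. u n \<in> H10 \<Omega>" "\<And>n. has_L2_grad (u n) (g n)" and u': "square_integrable M u'" "square_integrable M g'"
    and lim: "(\<lambda>n. L2_sq M (\<lambda>x. u n x - u' x)) \<longlonglongrightarrow> 0" "(\<lambda>n. L2_sq M (\<lambda>x. g n x - g' x)) \<longlonglongrightarrow> 0"
  shows "u' \<in> H10 \<Omega>" "has_L2_grad u' g'"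
proof -
  show has_L2_grad': "has_L2_grad u' g'" by (rule has_L2_grad_limit[OF u(2) u' lim])
  have "approx u' g'"
    by (rule approx_limit[OF _ u(2) has_L2_grad' lim]) (use u H10_iff in blast)
  then show "u' \<in> H10 \<Omega>" using H10_iff[OF has_L2_grad'] by blast
qed

section \<open>Linear structure and energy form of H^1_0\<close>

lemma H10_add:
  assumes "u \<in> H10 \<Omega>" "v \<in> H10 \<Omega>"
  shows "(\<lambda>x. u x + v x) \<in> H10 \<Omega>"
proof -
  obtain \<phi> D where \<phi>: "\<And>n. \<phi> n \<in> test_functions \<Omega>" "\<And>n x. GDERIV (\<phi> n) x :> D n x"
    "(\<lambda>n. L2_sq M (\<lambda>x. \<phi> n x - u x)) \<longlonglongrightarrow> 0" "(\<lambda>n. L2_sq M (\<lambda>x. D n x - weak_grad \<Omega> u x)) \<longlonglongrightarrow> 0"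
    by (rule H10_approx_seq[OF assms(1) H10_has_L2_grad(1)[OF assms(1)]]) (rule that)
  obtain \<psi> E where \<psi>: "\<And>n. \<psi> n \<in> test_functions \<Omega>" "\<And>n x. GDERIV (\<psi> n) x :> E n x"
    "(\<lambda>n. L2_sq M (\<lambda>x. \<psi> n x - v x)) \<longlonglongrightarrow> 0" "(\<lambda>n. L2_sq M (\<lambda>x. E n x - weak_grad \<Omega> v x)) \<longlonglongrightarrow> 0"
    by (rule H10_approx_seq[OF assms(2) H10_has_L2_grad(1)[OF assms(2)]]) (rule that)
  note sq = has_L2_gradD(1,2)[OF H10_has_L2_grad(1)[OF assms(1)]] has_L2_gradD(1,2)[OF H10_has_L2_grad(1)[OF assms(2)]]
  have lim_add: "(\<lambda>n. L2_sq M (\<lambda>x. (a n x + b n x) - (a' x + b' x))) \<longlonglongrightarrow> 0"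
    if "\<And>n. square_integrable M (a n)" "\<And>n. square_integrable M (b n)" "square_integrable M a'" "square_integrable M b'"
      "(\<lambda>n. L2_sq M (\<lambda>x. a n x - a' x)) \<longlonglongrightarrow> 0" "(\<lambda>n. L2_sq M (\<lambda>x. b n x - b' x)) \<longlonglongrightarrow> 0"
    for a b :: "nat \<Rightarrow> 'a \<Rightarrow> 'b::euclidean_space" and a' b'
  proof (rule tendsto_sandwich[OF _ _ tendsto_const])
    have "L2_sq M (\<lambda>x. (a n x - a' x) + (b n x - b' x)) \<le> 2 * L2_sq M (\<lambda>x. a n x - a' x) + 2 * L2_sq M (\<lambda>x. b n x - b' x)" for n
      by (intro L2_sq_triangle square_integrable_diff that)
    then show "\<forall>\<^sub>F n in sequentially. L2_sq M (\<lambda>x. (a n x + b n x) - (a' x + b' x))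
        \<le> 2 * L2_sq M (\<lambda>x. a n x - a' x) + 2 * L2_sq M (\<lambda>x. b n x - b' x)"
      by (intro always_eventually allI) (simp add: algebra_simps)
    have "(\<lambda>n. 2 * L2_sq M (\<lambda>x. a n x - a' x) + 2 * L2_sq M (\<lambda>x. b n x - b' x)) \<longlonglongrightarrow> 2 * 0 + 2 * 0"
      by (intro tendsto_intros that)
    then show "(\<lambda>n. 2 * L2_sq M (\<lambda>x. a n x - a' x) + 2 * L2_sq M (\<lambda>x. b n x - b' x)) \<longlonglongrightarrow> 0" by simp
  qed simp
  show ?thesis
  proof (rule H10_limit(1))
    show "(\<lambda>x. \<phi> n x + \<psi> n x) \<in> H10 \<Omega>" for n
      using test_functions_add[OF \<phi>(1) \<psi>(1)] test_in_H10 by blast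
    show "has_L2_grad (\<lambda>x. \<phi> n x + \<psi> n x) (\<lambda>x. D n x + E n x)" for n
      by (intro has_L2_grad_add has_L2_grad_test \<phi> \<psi>)
    show "(\<lambda>n. L2_sq M (\<lambda>x. (\<phi> n x + \<psi> n x) - (u x + v x))) \<longlonglongrightarrow> 0"
      by (intro lim_add \<phi> \<psi> sq test_square_integrable(1)[OF \<phi>(1,2)] test_square_integrable(1)[OF \<psi>(1,2)])
    show "(\<lambda>n. L2_sq M (\<lambda>x. (D n x + E n x) - (weak_grad \<Omega> u x + weak_grad \<Omega> v x))) \<longlonglongrightarrow> 0"
      by (intro lim_add \<phi> \<psi> sq test_square_integrable(2)[OF \<phi>(1,2)] test_square_integrable(2)[OF \<psi>(1,2)])
  qed (intro square_integrable_add sq)+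
qed

lemma H10_scale:
  assumes "u \<in> H10 \<Omega>"
  shows "(\<lambda>x. c * u x) \<in> H10 \<Omega>"
proof -
  obtain \<phi> D where \<phi>: "\<And>n. \<phi> n \<in> test_functions \<Omega>" "\<And>n x. GDERIV (\<phi> n) x :> D n x"
    "(\<lambda>n. L2_sq M (\<lambda>x. \<phi> n x - u x)) \<longlonglongrightarrow> 0" "(\<lambda>n. L2_sq M (\<lambda>x. D n x - weak_grad \<Omega> u x)) \<longlonglongrightarrow> 0"
    by (rule H10_approx_seq[OF assms(1) H10_has_L2_grad(1)[OF assms(1)]]) (rule that)
  note sq = has_L2_gradD(1,2)[OF H10_has_L2_grad(1)[OF assms(1)]]
  show ?thesis
  proof (rule H10_limit(1))
    show "(\<lambda>x. c * \<phi> n x) \<in> H10 \<Omega>" for n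
      using test_functions_scale[OF \<phi>(1)] test_in_H10 by blast
    show "has_L2_grad (\<lambda>x. c * \<phi> n x) (\<lambda>x. c *\<^sub>R D n x)" for n
      by (intro has_L2_grad_scale has_L2_grad_test \<phi>)
    show "(\<lambda>n. L2_sq M (\<lambda>x. c * \<phi> n x - c * u x)) \<longlonglongrightarrow> 0"
      using tendsto_mult_right_zero[OF \<phi>(3), of "c\<^sup>2"]
      by (simp add: power_mult_distrib flip: right_diff_distrib)
    show "(\<lambda>n. L2_sq M (\<lambda>x. c *\<^sub>R D n x - c *\<^sub>R weak_grad \<Omega> u x)) \<longlonglongrightarrow> 0"
      using tendsto_mult_right_zero[OF \<phi>(4), of "c\<^sup>2"]
      by (simp add: power_mult_distrib flip: scaleR_diff_right)
    show "square_integrable M (\<lambda>x. c * u x)" using square_integrable_scaleR[OF sq(1), of c] by simp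
    show "square_integrable M (\<lambda>x. c *\<^sub>R weak_grad \<Omega> u x)" by (rule square_integrable_scaleR[OF sq(2)])
  qed
qed

lemma H10_diff:
  assumes "u \<in> H10 \<Omega>" "v \<in> H10 \<Omega>"
  shows "(\<lambda>x. u x - v x) \<in> H10 \<Omega>"
  using H10_add[OF assms(1) H10_scale[OF assms(2), of "-1"]] by simp

definition ip :: "('a \<Rightarrow> real) \<Rightarrow> ('a \<Rightarrow> real) \<Rightarrow> real" where
  "ip u v = (LINT x|M. weak_grad \<Omega> u x \<bullet> weak_grad \<Omega> v x)"

lemma H10_dirichlet_nonneg: "dirichlet \<Omega> u \<ge> 0"
  by (simp add: dirichlet_def)

lemma H10_norm_sq: "(H10_norm \<Omega> u)\<^sup>2 = dirichlet \<Omega> u"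
  by (simp add: H10_norm_def H10_dirichlet_nonneg)

lemma dirichlet_add_scale:
  assumes "u \<in> H10 \<Omega>" "v \<in> H10 \<Omega>"
  shows "dirichlet \<Omega> (\<lambda>x. u x + t * v x) = dirichlet \<Omega> u + 2 * t * ip u v + t\<^sup>2 * dirichlet \<Omega> v"
proof -
  note has_L2_grad = H10_has_L2_grad(1)[OF assms(1)] H10_has_L2_grad(1)[OF assms(2)]
  have "dirichlet \<Omega> (\<lambda>x. u x + t * v x) = L2_sq M (\<lambda>x. weak_grad \<Omega> u x + t *\<^sub>R weak_grad \<Omega> v x)"
    by (rule has_L2_grad_weak_grad(3)[OF has_L2_grad_add[OF has_L2_grad(1) has_L2_grad_scale[OF has_L2_grad(2)]]])
  also have "\<dots> = L2_sq M (weak_grad \<Omega> u) + 2 * (LINT x|M. weak_grad \<Omega> u x \<bullet> t *\<^sub>R weak_grad \<Omega> v x)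
      + L2_sq M (\<lambda>x. t *\<^sub>R weak_grad \<Omega> v x)"
    by (intro L2_sq_add square_integrable_scaleR has_L2_gradD(2)[OF has_L2_grad(1)] has_L2_gradD(2)[OF has_L2_grad(2)])
  finally show ?thesis by (simp add: power_mult_distrib ip_def dirichlet_def)
qed

lemma dirichlet_scale:
  assumes "u \<in> H10 \<Omega>"
  shows "dirichlet \<Omega> (\<lambda>x. c * u x) = c\<^sup>2 * dirichlet \<Omega> u"
  using has_L2_grad_weak_grad(3)[OF has_L2_grad_scale[OF H10_has_L2_grad(1)[OF assms]]] by (simp add: power_mult_distrib dirichlet_def)

lemma dirichlet_diff:
  assumes "u \<in> H10 \<Omega>" "v \<in> H10 \<Omega>"
  shows "dirichlet \<Omega> (\<lambda>x. u x - v x) = dirichlet \<Omega> u - 2 * ip u v + dirichlet \<Omega> v"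
  using dirichlet_add_scale[OF assms, of "-1"] by simp

lemma ip_self: "ip u u = dirichlet \<Omega> u"
  by (simp add: ip_def dirichlet_def power2_norm_eq_inner)

lemma H10_measurable: "u \<in> H10 \<Omega> \<Longrightarrow> u \<in> borel_measurable M"
  using H10_has_L2_grad(1) has_L2_gradD(1) square_integrable_measurable by blast

end

section \<open>Embeddings and compactness\<close>

lemma tendsto_abs_powr:
  fixes f :: "'b \<Rightarrow> real"
  assumes "(f \<longlongrightarrow> l) F" "r > 0"
  shows "((\<lambda>x. \<bar>f x\<bar> powr r) \<longlongrightarrow> \<bar>l\<bar> powr r) F"
  by (intro tendsto_powr' tendsto_rabs assms tendsto_const) (use assms(2) in simp)

lemma power2_le_1_plus_powr:
  fixes t q :: real
  assumes "q \<ge> 2"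
  shows "t\<^sup>2 \<le> 1 + \<bar>t\<bar> powr q"
  using powr_interpolation[of "\<bar>t\<bar>" 1 2 q] assms by simp

context bounded_domain begin

lemma AE_lborel_imp_M:
  assumes "AE x in lborel. P x"
  shows "AE x in M. P x"
proof -
  have "AE x in lebesgue. P x" using assms by (rule AE_completion)
  then have "AE x in lebesgue. x \<in> \<Omega> \<longrightarrow> P x" by eventually_elim simp
  then show ?thesis using sets_\<Omega> by (simp add: AE_restrict_space_iff)
qed

text \<open>Test functions converging to u have energy eventually below any s exceeding that of u.
  The C^1 inequality with this s and Fatou along an almost everywhere convergent subsequence give
  the bound with s, and s then decreases to the energy of u.\<close>

lemma Sobolev_H10:
  obtains C where "C > 0" "\<And>u. u \<in> H10 \<Omega> \<Longrightarrow> integrable M (\<lambda>x. \<bar>u x\<bar> powr crit_exp DIM('a))"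
    "\<And>u. u \<in> H10 \<Omega> \<Longrightarrow> (LINT x|M. \<bar>u x\<bar> powr crit_exp DIM('a)) \<le> C * dirichlet \<Omega> u powr (crit_exp DIM('a) / 2)"
proof -
  define q where "q = crit_exp DIM('a)"
  have q: "q > 2" using crit_exp_gt by (simp add: q_def)
  obtain C where C: "C \<ge> 0" "\<And>(\<phi>::'a \<Rightarrow> real) D K s. C1_compact_support \<phi> D K \<Longrightarrow> measure lborel K \<le> measure lborel \<Omega> \<Longrightarrow> s > 0 \<Longrightarrow>
      (LINT y|lborel. (norm (D y))\<^sup>2) \<le> s \<Longrightarrow> (LINT y|lborel. \<bar>\<phi> y\<bar> powr q) \<le> C * s powr (q / 2)"
    using that unfolding q_def by (rule Sobolev_C1[OF dim, of "measure lborel \<Omega>"])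
  have main: "integrable M (\<lambda>x. \<bar>u x\<bar> powr q) \<and> (LINT x|M. \<bar>u x\<bar> powr q) \<le> C * s powr (q / 2)"
    if u: "u \<in> H10 \<Omega>" and s: "dirichlet \<Omega> u < s" for u s
  proof -
    have s0: "s > 0" using s H10_dirichlet_nonneg[of u] by linarith
    note has_L2_grad = H10_has_L2_grad(1)[OF u]
    obtain \<phi> D where \<phi>: "\<And>n. \<phi> n \<in> test_functions \<Omega>" "\<And>n x. GDERIV (\<phi> n) x :> D n x"
      "(\<lambda>n. L2_sq M (\<lambda>x. \<phi> n x - u x)) \<longlonglongrightarrow> 0" "(\<lambda>n. L2_sq M (\<lambda>x. D n x - weak_grad \<Omega> u x)) \<longlonglongrightarrow> 0"
      by (rule H10_approx_seq[OF u has_L2_grad]) (rule that)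
    note sq = test_square_integrable[OF \<phi>(1,2)]
    have \<phi>q: "integrable M (\<lambda>x. \<bar>\<phi> n x\<bar> powr q)" "L2_sq M (D n) \<le> s \<Longrightarrow> (LINT x|M. \<bar>\<phi> n x\<bar> powr q) \<le> C * s powr (q / 2)" for n
    proof -
      obtain K where K: "C1_compact_support (\<phi> n) (D n) K" "K \<subseteq> \<Omega>"
        by (rule test_function_C1_grad[OF \<phi>(1,2)[of n]]) (rule that)
      have "K \<in> sets lborel" using C1_compact_support.compact_K[OF K(1)] by (simp add: borel_compact)
      \<comment> \<open>The volume of the domain bounds that of every K, so one constant C serves
        all test functions.\<close>
      then have "measure lborel K \<le> measure lborel \<Omega>"
        using K(2) open_\<Omega> emeasure_bounded_finite[OF bounded_\<Omega>]
        by (intro measure_mono_fmeasurable) (auto simp: fmeasurable_def)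
      then show "integrable M (\<lambda>x. \<bar>\<phi> n x\<bar> powr q)" "L2_sq M (D n) \<le> s \<Longrightarrow> (LINT x|M. \<bar>\<phi> n x\<bar> powr q) \<le> C * s powr (q / 2)"
        using C(2)[OF K(1) _ s0] C1_lebesgue_on[OF K] q by auto
    qed
    have "(\<lambda>n. L2_sq M (D n)) \<longlonglongrightarrow> dirichlet \<Omega> u"
      unfolding dirichlet_def by (intro L2_sq_tendsto sq has_L2_gradD(2)[OF has_L2_grad] \<phi>)
    from order_tendstoD(2)[OF this s] have ev: "\<forall>\<^sub>F n in sequentially. (LINT x|M. \<bar>\<phi> n x\<bar> powr q) \<le> C * s powr (q / 2)"
      by eventually_elim (use \<phi>q in auto)
    obtain r where r: "strict_mono r" "AE x in M. (\<lambda>n. \<phi> (r n) x) \<longlonglongrightarrow> u x"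
      by (rule L2_convergent_AE_subseq[OF sq(1) has_L2_gradD(1)[OF has_L2_grad] \<phi>(3)]) (rule that)
    have lim: "AE x in M. (\<lambda>n. \<bar>\<phi> (r n) x\<bar> powr q) \<longlonglongrightarrow> \<bar>u x\<bar> powr q"
      using r(2) by eventually_elim (use q in \<open>auto intro: tendsto_abs_powr\<close>)
    have meas: "(\<lambda>x. \<bar>u x\<bar> powr q) \<in> borel_measurable M"
      using H10_measurable[OF u] by measurable
    have ev': "\<forall>\<^sub>F n in sequentially. (LINT x|M. \<bar>\<phi> (r n) x\<bar> powr q) \<le> C * s powr (q / 2)"
      using eventually_subseq[OF r(1) ev] .
    have nn: "AE x in M. 0 \<le> \<bar>\<phi> (r n) x\<bar> powr q" for n by simp
    show ?thesis
      using integrable_Fatou(1)[OF \<phi>q(1) nn meas lim ev'] integrable_Fatou(2)[OF \<phi>q(1) nn meas lim ev'] by blast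
  qed
  have "(LINT x|M. \<bar>u x\<bar> powr q) \<le> (C + 1) * dirichlet \<Omega> u powr (q / 2)" if u: "u \<in> H10 \<Omega>" for u
  proof -
    have l: "(\<lambda>n. 1 / real (Suc n)) \<longlonglongrightarrow> 0" using LIMSEQ_Suc[OF lim_1_over_n] by simp
    have "(\<lambda>n. C * (dirichlet \<Omega> u + 1 / real (Suc n)) powr (q / 2)) \<longlonglongrightarrow> C * (dirichlet \<Omega> u + 0) powr (q / 2)"
      by (intro tendsto_mult tendsto_const tendsto_powr' tendsto_add l) (use q H10_dirichlet_nonneg[of u] in \<open>auto intro!: always_eventually\<close>)
    then have "(LINT x|M. \<bar>u x\<bar> powr q) \<le> C * (dirichlet \<Omega> u + 0) powr (q / 2)"
    proof (rule LIMSEQ_le_const, intro exI allI impI)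
      fix n
      show "(LINT x|M. \<bar>u x\<bar> powr q) \<le> C * (dirichlet \<Omega> u + 1 / real (Suc n)) powr (q / 2)"
        using main[OF u, of "dirichlet \<Omega> u + 1 / real (Suc n)"] by simp
    qed
    moreover have "0 \<le> dirichlet \<Omega> u powr (q / 2)" by simp
    ultimately show ?thesis unfolding distrib_right mult_1_left add_0_right by linarith
  qed
  moreover have "integrable M (\<lambda>x. \<bar>u x\<bar> powr q)" if "u \<in> H10 \<Omega>" for u
    using main[OF that, of "dirichlet \<Omega> u + 1"] by simp
  moreover have "C + 1 > 0" using C(1) by simp
  ultimately show thesis using that[of "C + 1"] unfolding q_def by blast
qed

lemma H10_Lq: "u \<in> H10 \<Omega> \<Longrightarrow> integrable M (\<lambda>x. \<bar>u x\<bar> powr crit_exp DIM('a))"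
  using Sobolev_H10 by metis

lemma H10_nonzero_nonempty: "H10_nonzero \<Omega> \<noteq> {}"
proof -
  obtain x where "x \<in> \<Omega>" using nonempty_\<Omega> by blast
  then obtain a b where ab: "cbox a b \<subseteq> \<Omega>" "x \<in> box a b" using open_contains_cbox[OF open_\<Omega>] by metis
  have \<phi>: "box_bump a b 1 \<in> test_functions \<Omega>" by (rule box_bump_in_test_functions[OF zero_less_one ab(1)])
  have "\<not> (AE x in M. box_bump a b 1 x = 0)"
  proof
    assume "AE x in M. box_bump a b 1 x = 0"
    then have "AE x in lebesgue. x \<in> \<Omega> \<longrightarrow> box_bump a b 1 x = 0" using sets_\<Omega> by (simp add: AE_restrict_space_iff)
    moreover have "x \<in> \<Omega> \<and> box_bump a b 1 x \<noteq> 0" if "x \<in> box a b" for x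
      using box_bump_pos[OF that, of 1] ab(1) box_subset_cbox[of a b] that by force
    ultimately have "AE x in lebesgue. x \<notin> box a b"
      by (auto elim!: eventually_mono)
    then have "box a b \<in> null_sets lebesgue" by (simp add: AE_iff_null_sets)
    then have "negligible (box a b)" by (simp add: negligible_iff_null_sets)
    then show False using open_not_negligible[OF open_box, of a b] ab(2) by blast
  qed
  then show ?thesis using test_in_H10[OF \<phi>] unfolding H10_nonzero_def by blast
qed

lemma H10_nonzero_Lq_pos:
  assumes "u \<in> H10_nonzero \<Omega>"
  shows "(LINT x|M. \<bar>u x\<bar> powr crit_exp DIM('a)) > 0"
proof -
  have u: "u \<in> H10 \<Omega>" "\<not> (AE x in M. u x = 0)" using assms by (auto simp: H10_nonzero_def)
  have "(LINT x|M. \<bar>u x\<bar> powr crit_exp DIM('a)) \<noteq> 0"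
    using integral_nonneg_eq_0_iff_AE[OF H10_Lq[OF u(1)]] u(2) by simp
  moreover have "(LINT x|M. \<bar>u x\<bar> powr crit_exp DIM('a)) \<ge> 0" by simp
  ultimately show ?thesis by linarith
qed

text \<open>A constant C in the embedding bounds every quotient below by C^(-2/q). Positivity is
  what allows the inequality defining S to be solved for the critical integral.\<close>

lemma sobolev_const_pos: "sobolev_const \<Omega> > 0"
proof -
  let ?q = "crit_exp DIM('a)"
  obtain C where C: "C > 0" "\<And>u. u \<in> H10 \<Omega> \<Longrightarrow> (LINT x|M. \<bar>u x\<bar> powr ?q) \<le> C * dirichlet \<Omega> u powr (?q / 2)"
    using Sobolev_H10 by metis
  have "C powr (- (2 / ?q)) \<le> sobolev_const \<Omega>"
    unfolding sobolev_const_def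
  proof (rule cINF_greatest[OF H10_nonzero_nonempty])
    fix u assume u: "u \<in> H10_nonzero \<Omega>"
    let ?X = "LINT x|M. \<bar>u x\<bar> powr ?q"
    have X: "?X > 0" by (rule H10_nonzero_Lq_pos[OF u])
    have "?X powr (2 / ?q) \<le> (C * dirichlet \<Omega> u powr (?q / 2)) powr (2 / ?q)"
      using C(2)[of u] u X crit_exp_gt by (intro powr_mono2) (auto simp: H10_nonzero_def)
    also have "\<dots> = C powr (2 / ?q) * dirichlet \<Omega> u"
      using C(1) H10_dirichlet_nonneg[of u] crit_exp_gt by (simp add: powr_mult powr_powr)
    finally have "?X powr (2 / ?q) \<le> C powr (2 / ?q) * dirichlet \<Omega> u" .
    then have "C powr (- (2 / ?q)) * ?X powr (2 / ?q) \<le> C powr (- (2 / ?q)) * (C powr (2 / ?q) * dirichlet \<Omega> u)"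
      by (rule mult_left_mono) simp
    also have "\<dots> = dirichlet \<Omega> u" using C(1) by (simp add: powr_minus)
    finally show "C powr (- (2 / ?q)) \<le> dirichlet \<Omega> u / ?X powr (2 / ?q)"
      using X by (simp add: pos_le_divide_eq)
  qed
  then show ?thesis using C(1) powr_gt_zero[of C "- (2 / ?q)"] by linarith
qed

lemma sobolev_const_bound:
  assumes u: "u \<in> H10 \<Omega>"
  shows "(LINT x|M. \<bar>u x\<bar> powr crit_exp DIM('a))
    \<le> sobolev_const \<Omega> powr (- (crit_exp DIM('a) / 2)) * dirichlet \<Omega> u powr (crit_exp DIM('a) / 2)"
proof (cases "AE x in M. u x = 0")
  case True
  then have "(LINT x|M. \<bar>u x\<bar> powr crit_exp DIM('a)) = 0"
    by (intro integral_eq_zero_AE) (auto elim!: eventually_mono)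
  then show ?thesis by simp
next
  case False
  let ?q = "crit_exp DIM('a)"
  let ?X = "LINT x|M. \<bar>u x\<bar> powr ?q"
  have u': "u \<in> H10_nonzero \<Omega>" using u False by (simp add: H10_nonzero_def)
  have X: "?X > 0" by (rule H10_nonzero_Lq_pos[OF u'])
  have "sobolev_const \<Omega> \<le> dirichlet \<Omega> u / ?X powr (2 / ?q)"
    unfolding sobolev_const_def using u' H10_dirichlet_nonneg
    by (intro cINF_lower bdd_belowI2[where m = 0]) auto
  then have "sobolev_const \<Omega> * ?X powr (2 / ?q) \<le> dirichlet \<Omega> u" using X by (simp add: pos_le_divide_eq)
  then have "(sobolev_const \<Omega> * ?X powr (2 / ?q)) powr (?q / 2) \<le> dirichlet \<Omega> u powr (?q / 2)"
    using sobolev_const_pos crit_exp_gt by (intro powr_mono2) auto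
  also have "(sobolev_const \<Omega> * ?X powr (2 / ?q)) powr (?q / 2) = sobolev_const \<Omega> powr (?q / 2) * ?X"
    using sobolev_const_pos X crit_exp_gt by (simp add: powr_mult powr_powr)
  finally have "sobolev_const \<Omega> powr (- (?q / 2)) * (sobolev_const \<Omega> powr (?q / 2) * ?X)
      \<le> sobolev_const \<Omega> powr (- (?q / 2)) * dirichlet \<Omega> u powr (?q / 2)"
    by (rule mult_left_mono) simp
  moreover have "sobolev_const \<Omega> powr (- (?q / 2)) * (sobolev_const \<Omega> powr (?q / 2) * ?X) = ?X"
    using sobolev_const_pos by (simp add: powr_minus)
  ultimately show ?thesis by simp
qed

text \<open>The case of integral 0 includes the default value for a non-integrable power; the left
  side then vanishes. Otherwise u is not 0 almost everywhere and competes in the infimum.\<close>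

lemma lambda1_bound:
  assumes u: "u \<in> H10 \<Omega>"
  shows "lambda1 \<Omega> \<gamma> * (LINT x|M. \<bar>u x\<bar> powr (2 * \<gamma>)) \<le> dirichlet \<Omega> u powr \<gamma>"
proof (cases "(LINT x|M. \<bar>u x\<bar> powr (2 * \<gamma>)) = 0")
  case False
  let ?X = "LINT x|M. \<bar>u x\<bar> powr (2 * \<gamma>)"
  have "?X \<ge> 0" by simp
  then have X: "?X > 0" using False by linarith
  have "\<not> (AE x in M. u x = 0)"
  proof
    assume "AE x in M. u x = 0"
    then have "?X = 0" by (intro integral_eq_zero_AE) (auto elim!: eventually_mono)
    then show False using False by simp
  qed
  then have "lambda1 \<Omega> \<gamma> \<le> dirichlet \<Omega> u powr \<gamma> / ?X"
    unfolding lambda1_def using u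
    by (intro cINF_lower bdd_belowI2[where m = 0]) (auto simp: H10_nonzero_def)
  then show ?thesis using X by (simp add: pos_le_divide_eq)
qed simp

lemma H10_L2_le: 
  assumes "u \<in> H10 \<Omega>"
  shows "L2_sq M u \<le> measure M (space M) + (LINT x|M. \<bar>u x\<bar> powr crit_exp DIM('a))"
proof -
  have "L2_sq M u \<le> (LINT x|M. 1 + \<bar>u x\<bar> powr crit_exp DIM('a))"
    by (rule integral_mono)
      (use has_L2_gradD(1)[OF H10_has_L2_grad(1)[OF assms]] H10_Lq[OF assms] power2_le_1_plus_powr[of "crit_exp DIM('a)"] crit_exp_gt
        in \<open>auto simp: square_integrable_def\<close>)
  then show ?thesis using H10_Lq[OF assms] by simp
qed

text \<open>Each u n is replaced by a test function within 1/(n+1). The energies bound the gradients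
  in L^2, the Sobolev inequality bounds the functions, and finite measure turns both into L^1 bounds
  for \<open>Rellich_L1\<close>. The differences tend to 0 in L^2, so a further subsequence
  transfers the convergence back to u.\<close>

lemma Rellich_AE:
  fixes u :: "nat \<Rightarrow> 'a \<Rightarrow> real"
  assumes u: "\<And>n. u n \<in> H10 \<Omega>" and B: "\<And>n. dirichlet \<Omega> (u n) \<le> B"
  obtains r v where "strict_mono r" "v \<in> borel_measurable M" "AE x in M. (\<lambda>n. u (r n) x) \<longlonglongrightarrow> v x"
proof -
  let ?q = "crit_exp DIM('a)"
  let ?\<mu> = "measure M (space M)"
  define Q where "Q n \<phi> D \<longleftrightarrow> \<phi> \<in> test_functions \<Omega> \<and> (\<forall>x. GDERIV \<phi> x :> D x) \<and>
      L2_sq M (\<lambda>x. u n x - \<phi> x) + L2_sq M (\<lambda>x. weak_grad \<Omega> (u n) x - D x) < 1 / real (Suc n)" for n :: nat and \<phi> D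
  have "\<exists>\<phi> D. Q n \<phi> D" for n
  proof -
    have "1 / real (Suc n) > 0" by simp
    then show ?thesis using H10_has_L2_grad(2)[OF u[of n]] unfolding approx_def Q_def by blast
  qed
  then obtain \<phi> D where "\<And>n. Q n (\<phi> n) (D n)" by metis
  then have \<phi>: "\<And>n. \<phi> n \<in> test_functions \<Omega>" "\<And>n x. GDERIV (\<phi> n) x :> D n x"
    and s: "\<And>n. L2_sq M (\<lambda>x. u n x - \<phi> n x) + L2_sq M (\<lambda>x. weak_grad \<Omega> (u n) x - D n x) < 1 / real (Suc n)"
    unfolding Q_def by blast+
  note sq = test_square_integrable[OF \<phi>]
  have "\<exists>K. C1_compact_support (\<phi> n) (D n) K \<and> K \<subseteq> \<Omega>" for n
    by (rule test_function_C1_grad[OF \<phi>(1,2)[of n]]) blast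
  then obtain K where K: "\<And>n. C1_compact_support (\<phi> n) (D n) (K n)" "\<And>n. K n \<subseteq> \<Omega>" by metis
  \<comment> \<open>The squared triangle inequality gives twice the energy bound plus twice an error
    of at most 1.\<close>
  have D_bound: "L2_sq M (D n) \<le> 2 * B + 2" for n
  proof -
    have "L2_sq M (\<lambda>x. (D n x - weak_grad \<Omega> (u n) x) + weak_grad \<Omega> (u n) x)
        \<le> 2 * L2_sq M (\<lambda>x. D n x - weak_grad \<Omega> (u n) x) + 2 * L2_sq M (weak_grad \<Omega> (u n))"
      by (intro L2_sq_triangle square_integrable_diff sq has_L2_gradD(2)[OF H10_has_L2_grad(1)[OF u]])
    moreover have "L2_sq M (\<lambda>x. D n x - weak_grad \<Omega> (u n) x) = L2_sq M (\<lambda>x. weak_grad \<Omega> (u n) x - D n x)"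
      by (rule L2_sq_diff_commute)
    moreover have "1 / real (Suc n) \<le> 1" by simp
    moreover have "L2_sq M (weak_grad \<Omega> (u n)) \<le> B" using B[of n] by (simp add: dirichlet_def)
    moreover have "L2_sq M (\<lambda>x. (D n x - weak_grad \<Omega> (u n) x) + weak_grad \<Omega> (u n) x) = L2_sq M (D n)" by simp
    ultimately show ?thesis
      using s[of n] L2_sq_nonneg[of M "\<lambda>x. u n x - \<phi> n x"] by linarith
  qed
  obtain C where C: "C > 0" "\<And>u. u \<in> H10 \<Omega> \<Longrightarrow> (LINT x|M. \<bar>u x\<bar> powr ?q) \<le> C * dirichlet \<Omega> u powr (?q / 2)"
    using Sobolev_H10 by metis
  have B0: "2 * B + 2 \<ge> 0" using D_bound[of 0] L2_sq_nonneg[of M "D 0"] by linarith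
  define P where "P = ?\<mu> + C * (2 * B + 2) powr (?q / 2)"
  have \<phi>_bound: "L2_sq M (\<phi> n) \<le> P" for n
  proof -
    have "dirichlet \<Omega> (\<phi> n) \<le> 2 * B + 2" using has_L2_grad_weak_grad(3)[OF has_L2_grad_test[OF \<phi>]] D_bound by simp
    then have "dirichlet \<Omega> (\<phi> n) powr (?q / 2) \<le> (2 * B + 2) powr (?q / 2)"
      using H10_dirichlet_nonneg crit_exp_gt by (intro powr_mono2) auto
    then have "C * dirichlet \<Omega> (\<phi> n) powr (?q / 2) \<le> C * (2 * B + 2) powr (?q / 2)"
      using C(1) by (intro mult_left_mono) auto
    then show ?thesis
      using H10_L2_le[OF test_in_H10[OF \<phi>(1)], of n] C(2)[OF test_in_H10[OF \<phi>(1)], of n] unfolding P_def by linarith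
  qed
  define B' where "B' = max (sqrt (?\<mu> * P)) (sqrt (?\<mu> * (2 * B + 2)))"
  have out: "\<phi> n x = 0" "D n x = 0" if "x \<notin> \<Omega>" for n x
    using C1_compact_support.supp[OF K(1)] C1_compact_support.supp_D[OF K(1)] K(2) that by blast+
  have b1: "(LINT x|lborel. \<bar>\<phi> n x\<bar>) \<le> B'" for n
  proof -
    have "(LINT x|lborel. \<bar>\<phi> n x\<bar>) = (LINT x|M. norm (\<phi> n x))"
      unfolding real_norm_def
      using out C1_compact_support.measurable_phi[OF K(1)[of n]] by (intro borel_supp_lebesgue_on(1)[symmetric] sets_\<Omega>) auto
    moreover have "(LINT x|M. norm (\<phi> n x))\<^sup>2 \<le> ?\<mu> * P"
      using square_integrable_L1(2)[OF sq(1)[of n]] mult_left_mono[OF \<phi>_bound measure_nonneg] by (rule order_trans)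
    ultimately show ?thesis unfolding B'_def by (simp add: real_le_rsqrt le_max_iff_disj)
  qed
  have b2: "(LINT x|lborel. norm (D n x)) \<le> B'" for n
  proof -
    have "(LINT x|lborel. norm (D n x)) = (LINT x|M. norm (D n x))"
      using out C1_compact_support.measurable_D[OF K(1)[of n]] by (intro borel_supp_lebesgue_on(1)[symmetric] sets_\<Omega>) auto
    moreover have "(LINT x|M. norm (D n x))\<^sup>2 \<le> ?\<mu> * (2 * B + 2)"
      using square_integrable_L1(2)[OF sq(2)[of n]] mult_left_mono[OF D_bound measure_nonneg] by (rule order_trans)
    ultimately show ?thesis unfolding B'_def by (simp add: real_le_rsqrt le_max_iff_disj)
  qed
  obtain k where k: "strict_mono k" "AE x in lborel. Cauchy (\<lambda>n. \<phi> (k n) x)"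
    by (rule Rellich_L1[OF K bounded_\<Omega> borel_open[OF open_\<Omega>] b1 b2]) (rule that)
  have l: "(\<lambda>n. 1 / real (Suc n)) \<longlonglongrightarrow> 0" using LIMSEQ_Suc[OF lim_1_over_n] by simp
  have "(\<lambda>n. L2_sq M (\<lambda>x. u n x - \<phi> n x)) \<longlonglongrightarrow> 0"
  proof (rule tendsto_sandwich[OF _ _ tendsto_const l])
    show "\<forall>\<^sub>F n in sequentially. L2_sq M (\<lambda>x. u n x - \<phi> n x) \<le> 1 / real (Suc n)"
    proof (intro always_eventually allI)
      fix n
      show "L2_sq M (\<lambda>x. u n x - \<phi> n x) \<le> 1 / real (Suc n)"
        using s[of n] L2_sq_nonneg[of M "\<lambda>x. weak_grad \<Omega> (u n) x - D n x"] by linarith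
    qed
  qed simp
  from LIMSEQ_subseq_LIMSEQ[OF this k(1)]
  have lim0: "(\<lambda>n. L2_sq M (\<lambda>x. (u (k n) x - \<phi> (k n) x) - 0)) \<longlonglongrightarrow> 0" by (simp add: o_def)
  have sq0: "square_integrable M (\<lambda>x. 0::real)" by (simp add: square_integrable_def)
  have sqd: "square_integrable M (\<lambda>x. u (k n) x - \<phi> (k n) x)" for n
    by (intro square_integrable_diff sq has_L2_gradD(1)[OF H10_has_L2_grad(1)[OF u]])
  obtain r where r: "strict_mono r" "AE x in M. (\<lambda>n. u (k (r n)) x - \<phi> (k (r n)) x) \<longlonglongrightarrow> 0"
    by (rule L2_convergent_AE_subseq[OF sqd sq0 lim0]) (rule that)
  define v where "v x = lim (\<lambda>n. u (k (r n)) x)" for x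
  have [measurable]: "u n \<in> borel_measurable M" for n using H10_measurable[OF u] .
  have "v \<in> borel_measurable M" unfolding v_def by measurable
  moreover have "AE x in M. (\<lambda>n. u ((k \<circ> r) n) x) \<longlonglongrightarrow> v x"
    using r(2) AE_lborel_imp_M[OF k(2)]
  proof eventually_elim
    case (elim x)
    have "convergent (\<lambda>n. \<phi> (k n) x)" using elim(2) by (simp add: Cauchy_convergent_iff)
    then obtain l where "(\<lambda>n. \<phi> (k n) x) \<longlonglongrightarrow> l" by (auto simp: convergent_def)
    from LIMSEQ_subseq_LIMSEQ[OF this r(1)] have "(\<lambda>n. \<phi> (k (r n)) x) \<longlonglongrightarrow> l" by (simp add: o_def)
    from tendsto_add[OF elim(1) this] have "convergent (\<lambda>n. u (k (r n)) x)" by (auto simp: convergent_def)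
    then show ?case by (simp add: v_def convergent_LIMSEQ_iff)
  qed
  moreover have "strict_mono (k \<circ> r)" using k(1) r(1) by (rule strict_mono_o)
  ultimately show thesis using that by blast
qed

text \<open>The pairing of gradients with a fixed test function passes to the limit as soon as the
  functions, rather than their gradients, converge in $L^2$.\<close>

lemma test_Laplacian:
  assumes "\<psi> \<in> test_functions \<Omega>" "\<And>x. GDERIV \<psi> x :> E x"
  obtains \<Lambda> where "square_integrable M \<Lambda>"
    "\<And>u g. has_L2_grad u g \<Longrightarrow> (LINT x|M. g x \<bullet> E x) = - (LINT x|M. u x \<bullet> \<Lambda> x)"
proof -
  have test: "(\<lambda>x. E x \<bullet> b) \<in> test_functions \<Omega>" if "b \<in> Basis" for b
    by (rule test_function_partial[OF assms that])
  then have "\<forall>b\<in>Basis. \<exists>F. \<forall>x. GDERIV (\<lambda>x. E x \<bullet> b) x :> F x"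
    using test_function_grad by blast
  then obtain F where F: "\<And>b x. b \<in> Basis \<Longrightarrow> GDERIV (\<lambda>x. E x \<bullet> b) x :> F b x" by metis
  have sqE: "square_integrable M (\<lambda>x. E x \<bullet> b)" and sqF: "square_integrable M (F b)" if "b \<in> Basis" for b
    using test_square_integrable[OF test[OF that] F[OF that]] by auto
  have sqFb: "square_integrable M (\<lambda>x. F b x \<bullet> b)" if b: "b \<in> Basis" for b
  proof -
    obtain G K where "C1_compact_support (\<lambda>x. F b x \<bullet> b) G K" "K \<subseteq> \<Omega>"
      by (rule test_function_C1[OF test_function_partial[OF test[OF b] F[OF b] b]])
    then show ?thesis by (rule C1_lebesgue_on(1))
  qed
  \<comment> \<open>The Laplacian of \<psi>: F b is the gradient of the partial derivative in
    direction b.\<close>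
  define \<Lambda> where "\<Lambda> x = (\<Sum>b\<in>Basis. F b x \<bullet> b)" for x
  have "square_integrable M (\<lambda>x. \<Sum>b\<in>B. F b x \<bullet> b)" if "finite B" "B \<subseteq> Basis" for B
    using that
  proof (induction B)
    case empty
    then show ?case by (simp add: square_integrable_def)
  next
    case (insert b B)
    then show ?case using square_integrable_add[OF sqFb[of b]] by simp
  qed
  then have sq\<Lambda>: "square_integrable M \<Lambda>" unfolding \<Lambda>_def by simp
  have "(LINT x|M. g x \<bullet> E x) = - (LINT x|M. u x \<bullet> \<Lambda> x)" if has_L2_grad: "has_L2_grad u g" for u g
  proof -
    note sq = has_L2_gradD(1,2)[OF has_L2_grad]
    have int: "integrable M (\<lambda>x. (g x \<bullet> b) * (E x \<bullet> b))" and int': "integrable M (\<lambda>x. u x * (F b x \<bullet> b))"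
      and eq: "(LINT x|M. (g x \<bullet> b) * (E x \<bullet> b)) = - (LINT x|M. u x * (F b x \<bullet> b))" if b: "b \<in> Basis" for b
    proof -
      have i1: "integrable M (\<lambda>x. (E x \<bullet> b) *\<^sub>R g x)" by (rule square_integrable_mult_scaleR[OF sqE[OF b] sq(2)])
      have i2: "integrable M (\<lambda>x. u x *\<^sub>R F b x)" by (rule square_integrable_mult_scaleR[OF sq(1) sqF[OF b]])
      show "integrable M (\<lambda>x. (g x \<bullet> b) * (E x \<bullet> b))" 
      proof -
        have "integrable M (\<lambda>x. ((E x \<bullet> b) *\<^sub>R g x) \<bullet> b)" by (rule integrable_inner_left) (rule i1)
        then show ?thesis by (simp add: mult.commute)
      qed
      show "integrable M (\<lambda>x. u x * (F b x \<bullet> b))" 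
      proof -
        have "integrable M (\<lambda>x. (u x *\<^sub>R F b x) \<bullet> b)" by (rule integrable_inner_left) (rule i2)
        then show ?thesis by simp
      qed
      have "(LINT x|M. u x *\<^sub>R F b x) \<bullet> b = (- (LINT x|M. (E x \<bullet> b) *\<^sub>R g x)) \<bullet> b"
        using has_L2_gradD(3)[OF has_L2_grad test[OF b] F[OF b]] by simp
      moreover have "(LINT x|M. (u x *\<^sub>R F b x) \<bullet> b) = (LINT x|M. u x *\<^sub>R F b x) \<bullet> b"
        by (rule integral_inner_left) (rule i2)
      moreover have "(LINT x|M. ((E x \<bullet> b) *\<^sub>R g x) \<bullet> b) = (LINT x|M. (E x \<bullet> b) *\<^sub>R g x) \<bullet> b"
        by (rule integral_inner_left) (rule i1)
      ultimately have "(LINT x|M. (u x *\<^sub>R F b x) \<bullet> b) = - (LINT x|M. ((E x \<bullet> b) *\<^sub>R g x) \<bullet> b)"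
        by simp
      then show "(LINT x|M. (g x \<bullet> b) * (E x \<bullet> b)) = - (LINT x|M. u x * (F b x \<bullet> b))"
        by (simp add: mult.commute)
    qed
    have "(LINT x|M. g x \<bullet> E x) = (LINT x|M. (\<Sum>b\<in>Basis. (g x \<bullet> b) * (E x \<bullet> b)))"
      by (subst euclidean_inner) simp
    also have "\<dots> = (\<Sum>b\<in>Basis. (LINT x|M. (g x \<bullet> b) * (E x \<bullet> b)))"
      by (rule Bochner_Integration.integral_sum) (rule int)
    also have "\<dots> = (\<Sum>b\<in>Basis. - (LINT x|M. u x * (F b x \<bullet> b)))" by (rule sum.cong[OF refl eq])
    also have "\<dots> = - (LINT x|M. (\<Sum>b\<in>Basis. u x * (F b x \<bullet> b)))"
      by (subst Bochner_Integration.integral_sum) (use int' in \<open>auto simp: sum_negf\<close>)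
    also have "\<dots> = - (LINT x|M. u x \<bullet> \<Lambda> x)" by (simp add: \<Lambda>_def sum_distrib_left)
    finally show ?thesis .
  qed
  then show thesis using that sq\<Lambda> by blast
qed

end

context bounded_domain begin

text \<open>\<open>Rellich_AE\<close> supplies an almost everywhere limit v, to which the
  subsequence converges in L^2 because the critical integrals are bounded and 2 is below the
  critical exponent. Membership of v in the space and convergence of the pairings are proved
  separately, the latter by approximating w by test functions.\<close>

lemma weak_compactness:
  fixes u :: "nat \<Rightarrow> 'a \<Rightarrow> real"
  assumes u: "\<And>n. u n \<in> H10 \<Omega>" and B: "\<And>n. dirichlet \<Omega> (u n) \<le> B"
  obtains r v where "strict_mono r" "v \<in> H10 \<Omega>" "AE x in M. (\<lambda>n. u (r n) x) \<longlonglongrightarrow> v x"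
    "\<And>w. w \<in> H10 \<Omega> \<Longrightarrow> (\<lambda>n. ip (u (r n)) w) \<longlonglongrightarrow> ip v w"
proof -
  define q where "q = crit_exp DIM('a)"
  have q: "q > 2" using crit_exp_gt by (simp add: q_def)
  obtain r v where r: "strict_mono r" and v[measurable]: "v \<in> borel_measurable M"
    and lim: "AE x in M. (\<lambda>n. u (r n) x) \<longlonglongrightarrow> v x"
    by (rule Rellich_AE[OF u B]) (rule that)
  define U where "U n = u (r n)" for n
  have U: "U n \<in> H10 \<Omega>" "dirichlet \<Omega> (U n) \<le> B" for n using u B by (auto simp: U_def)
  have [measurable]: "U n \<in> borel_measurable M" for n using H10_measurable[OF U(1)] .
  have limU: "AE x in M. (\<lambda>n. U n x) \<longlonglongrightarrow> v x" using lim by (simp add: U_def)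
  obtain C where C: "C > 0" "\<And>u. u \<in> H10 \<Omega> \<Longrightarrow> (LINT x|M. \<bar>u x\<bar> powr q) \<le> C * dirichlet \<Omega> u powr (q / 2)"
    unfolding q_def using Sobolev_H10 by metis
  define A where "A = C * B powr (q / 2)"
  have Uq: "integrable M (\<lambda>x. \<bar>U n x\<bar> powr q)" "(LINT x|M. \<bar>U n x\<bar> powr q) \<le> A" for n
  proof -
    show "integrable M (\<lambda>x. \<bar>U n x\<bar> powr q)" unfolding q_def by (rule H10_Lq[OF U(1)])
    have "dirichlet \<Omega> (U n) powr (q / 2) \<le> B powr (q / 2)"
      using U(2) H10_dirichlet_nonneg q by (intro powr_mono2) auto
    then have "C * dirichlet \<Omega> (U n) powr (q / 2) \<le> A" unfolding A_def using C(1) by (intro mult_left_mono) auto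
    then show "(LINT x|M. \<bar>U n x\<bar> powr q) \<le> A" using C(2)[OF U(1)[of n]] by linarith
  qed
  have vq: "integrable M (\<lambda>x. \<bar>v x\<bar> powr q)"
  proof (rule integrable_Fatou(1)[OF Uq(1)])
    show "AE x in M. (\<lambda>n. \<bar>U n x\<bar> powr q) \<longlonglongrightarrow> \<bar>v x\<bar> powr q"
      using limU by eventually_elim (use q in \<open>auto intro: tendsto_abs_powr\<close>)
    show "\<forall>\<^sub>F n in sequentially. (LINT x|M. \<bar>U n x\<bar> powr q) \<le> A" using Uq(2) by simp
  qed auto
  have sqU: "square_integrable M (U n)" "square_integrable M (weak_grad \<Omega> (U n))" for n
    using has_L2_gradD(1,2)[OF H10_has_L2_grad(1)[OF U(1)]] by auto
  have sqv: "square_integrable M v"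
    unfolding square_integrable_def
  proof
    show "integrable M (\<lambda>x. (norm (v x))\<^sup>2)"
    proof (rule Bochner_Integration.integrable_bound)
      show "integrable M (\<lambda>x. 1 + \<bar>v x\<bar> powr q)" using vq by simp
      show "AE x in M. norm ((norm (v x))\<^sup>2) \<le> norm (1 + \<bar>v x\<bar> powr q)"
        using power2_le_1_plus_powr[of q] q by (intro AE_I2) simp
    qed simp
  qed (rule v)
  have L2lim: "(\<lambda>n. L2_sq M (\<lambda>x. U n x - v x)) \<longlonglongrightarrow> 0"
  proof -
    have "(\<lambda>n. LINT x|M. (norm (U n x - v x))\<^sup>2) \<longlonglongrightarrow> (LINT x|M. 0)"
    proof (rule almost_dominated_convergence(3)[where a = "\<lambda>n x. \<bar>U n x\<bar> powr q" and B = A])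
      show "AE x in M. (\<lambda>n. (norm (U n x - v x))\<^sup>2) \<longlonglongrightarrow> 0"
        using limU
      proof eventually_elim
        case (elim x)
        have "(\<lambda>n. (norm (U n x - v x))\<^sup>2) \<longlonglongrightarrow> (norm (v x - v x))\<^sup>2" by (intro tendsto_intros elim)
        then show ?case by simp
      qed
      fix \<epsilon> :: real assume "\<epsilon> > 0"
      then obtain c where c: "c \<ge> 0" "\<And>t. t \<ge> 0 \<Longrightarrow> t powr 2 \<le> \<epsilon> / 2 * t powr q + c"
        using powr_eps_bound[of "\<epsilon> / 2" 2 q] q by (metis half_gt_zero zero_le_numeral)
      show "\<exists>G. integrable M G \<and> (\<forall>n. AE x in M. \<bar>(norm (U n x - v x))\<^sup>2\<bar> \<le> \<epsilon> * \<bar>U n x\<bar> powr q + G x)"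
      proof (intro exI conjI allI AE_I2)
        show "integrable M (\<lambda>x. 2 * c + 2 * (norm (v x))\<^sup>2)" using sqv by (simp add: square_integrable_def)
        fix n x
        have "(norm (U n x - v x))\<^sup>2 \<le> 2 * (norm (U n x))\<^sup>2 + 2 * (norm (v x))\<^sup>2"
          using norm_sum_squared_le[of "U n x" "- v x"] by simp
        moreover have "(norm (U n x))\<^sup>2 \<le> \<epsilon> / 2 * \<bar>U n x\<bar> powr q + c" using c(2)[of "\<bar>U n x\<bar>"] by simp
        ultimately show "\<bar>(norm (U n x - v x))\<^sup>2\<bar> \<le> \<epsilon> * \<bar>U n x\<bar> powr q + (2 * c + 2 * (norm (v x))\<^sup>2)" by simp
      qed
    qed (use Uq in auto)
    then show ?thesis by simp
  qed
  have v_H10: "v \<in> H10 \<Omega>"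
  proof -
    \<comment> \<open>Functions of the space whose L^2 distance from v is bounded by a quantity
      tending to 0: convex sets, nonempty because they contain members of the sequence. Their least
      energies \<open>d n\<close> increase and are bounded by B, hence converge; near-minimisers
      will have Cauchy gradients.\<close>
    define S where "S n = {w \<in> H10 \<Omega>. L2_sq M (\<lambda>x. w x - v x) \<le> 1 / real (Suc n)}" for n
    define d where "d n = (INF w\<in>S n. dirichlet \<Omega> w)" for n
    have bdd: "bdd_below (dirichlet \<Omega> ` S n)" for n
      using H10_dirichlet_nonneg by (intro bdd_belowI2[where m = 0]) auto
    have US: "\<exists>j. U j \<in> S n" for n
    proof -
      have "\<forall>\<^sub>F j in sequentially. L2_sq M (\<lambda>x. U j x - v x) < 1 / real (Suc n)"
        by (rule order_tendstoD(2)[OF L2lim]) simp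
      then obtain j where "L2_sq M (\<lambda>x. U j x - v x) < 1 / real (Suc n)"
        using eventually_happens'[OF sequentially_bot] by blast
      then show ?thesis using U(1) unfolding S_def by (intro exI[of _ j]) simp
    qed
    have d_le: "d n \<le> dirichlet \<Omega> w" if "w \<in> S n" for n w
      unfolding d_def by (rule cINF_lower[OF bdd that])
    have dB: "d n \<le> B" for n using US[of n] d_le U(2) order_trans by blast
    have S_mono: "S m \<subseteq> S n" if "n \<le> m" for n m
    proof -
      have "1 / real (Suc m) \<le> 1 / real (Suc n)" using that by (simp add: frac_le)
      then show ?thesis unfolding S_def by (auto intro: order_trans)
    qed
    have "S n \<noteq> {}" for n using US[of n] by blast
    then have "incseq d"
      unfolding incseq_def d_def using bdd S_mono by (intro allI impI cINF_superset_mono) auto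
    then obtain L where L: "d \<longlonglongrightarrow> L" "\<forall>n. d n \<le> L"
      using incseq_convergent[of d B] dB by auto
    have "\<exists>w\<in>S n. dirichlet \<Omega> w < d n + 1 / real (Suc n)" for n
      using cINF_less_iff[OF _ bdd, of n "d n + 1 / real (Suc n)"] US[of n] unfolding d_def by fastforce
    then obtain w where w: "\<And>n. w n \<in> S n" "\<And>n. dirichlet \<Omega> (w n) < d n + 1 / real (Suc n)" by metis
    have wH: "w n \<in> H10 \<Omega>" and wv: "L2_sq M (\<lambda>x. w n x - v x) \<le> 1 / real (Suc n)" for n
      using w(1) by (auto simp: S_def)
    have sqw: "square_integrable M (w n)" "square_integrable M (weak_grad \<Omega> (w n))" for n
      using has_L2_gradD(1,2)[OF H10_has_L2_grad(1)[OF wH]] by auto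
    \<comment> \<open>Parallelogram argument: the midpoint of w n and w m again lies in S n, so its
      energy is at least \<open>d n\<close>, and this leaves little room for the energy of the
      difference.\<close>
    have diff: "L2_sq M (\<lambda>x. weak_grad \<Omega> (w n) x - weak_grad \<Omega> (w m) x) \<le> 2 * (L - d n) + 4 / real (Suc n)"
      if "n \<le> m" for n m
    proof -
      have inv: "1 / real (Suc m) \<le> 1 / real (Suc n)" using that by (simp add: frac_le)
      define z where "z x = 1/2 * (w n x + w m x)" for x
      have "z \<in> H10 \<Omega>" unfolding z_def using H10_scale[OF H10_add[OF wH wH]] .
      moreover have "L2_sq M (\<lambda>x. z x - v x) \<le> 1 / real (Suc n)"
      proof -
        have "L2_sq M (\<lambda>x. z x - v x) = L2_sq M (\<lambda>x. (1/2) *\<^sub>R (w n x - v x) + (1/2) *\<^sub>R (w m x - v x))"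
          by (rule arg_cong[where f = "L2_sq M"]) (auto simp: z_def field_simps)
        also have "\<dots> \<le> 2 * L2_sq M (\<lambda>x. (1/2) *\<^sub>R (w n x - v x)) + 2 * L2_sq M (\<lambda>x. (1/2) *\<^sub>R (w m x - v x))"
          by (intro L2_sq_triangle square_integrable_scaleR square_integrable_diff sqw sqv)
        also have "\<dots> = 1/2 * L2_sq M (\<lambda>x. w n x - v x) + 1/2 * L2_sq M (\<lambda>x. w m x - v x)"
          unfolding L2_sq_scaleR by (simp add: power2_eq_square)
        finally show ?thesis using wv[of n] wv[of m] inv by linarith
      qed
      ultimately have "d n \<le> dirichlet \<Omega> z" by (intro d_le) (simp add: S_def)
      also have "dirichlet \<Omega> z = 1/4 * dirichlet \<Omega> (\<lambda>x. w n x + w m x)"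
        unfolding z_def by (subst dirichlet_scale[OF H10_add[OF wH wH]]) (simp add: power2_eq_square)
      also have "dirichlet \<Omega> (\<lambda>x. w n x + w m x) = dirichlet \<Omega> (w n) + 2 * ip (w n) (w m) + dirichlet \<Omega> (w m)"
        using dirichlet_add_scale[OF wH wH, of n 1 m] by simp
      finally have "4 * d n \<le> dirichlet \<Omega> (w n) + 2 * ip (w n) (w m) + dirichlet \<Omega> (w m)" by simp
      moreover have "L2_sq M (\<lambda>x. weak_grad \<Omega> (w n) x - weak_grad \<Omega> (w m) x) = dirichlet \<Omega> (w n) - 2 * ip (w n) (w m) + dirichlet \<Omega> (w m)"
        using has_L2_grad_weak_grad(3)[OF has_L2_grad_diff[OF H10_has_L2_grad(1)[OF wH] H10_has_L2_grad(1)[OF wH]], of n m] dirichlet_diff[OF wH wH, of n m] by simp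
      moreover have "d m \<le> L" using L(2) by blast
      moreover define \<delta> \<delta>' where "\<delta> = 1 / real (Suc n)" and "\<delta>' = 1 / real (Suc m)"
      moreover have "dirichlet \<Omega> (w n) < d n + \<delta>" "dirichlet \<Omega> (w m) < d m + \<delta>'" "\<delta>' \<le> \<delta>"
        using w(2) inv by (simp_all add: \<delta>_def \<delta>'_def)
      ultimately have "L2_sq M (\<lambda>x. weak_grad \<Omega> (w n) x - weak_grad \<Omega> (w m) x) \<le> 2 * (L - d n) + 4 * \<delta>"
        by argo
      then show ?thesis by (simp add: \<delta>_def)
    qed
    have "\<exists>N. \<forall>i\<ge>N. \<forall>j\<ge>N. L2_sq M (\<lambda>x. weak_grad \<Omega> (w i) x - weak_grad \<Omega> (w j) x) < e" if e: "e > 0" for e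
    proof -
      have "(\<lambda>n. 2 * (L - d n) + 4 * (1 / real (Suc n))) \<longlonglongrightarrow> 2 * (L - L) + 4 * 0"
        using LIMSEQ_Suc[OF lim_1_over_n] by (intro tendsto_intros L) auto
      then have "\<forall>\<^sub>F n in sequentially. 2 * (L - d n) + 4 * (1 / real (Suc n)) < e"
        using e by (intro order_tendstoD(2)) auto
      then obtain N where N: "\<And>n. n \<ge> N \<Longrightarrow> 2 * (L - d n) + 4 / real (Suc n) < e"
        by (auto simp: eventually_sequentially)
      have "L2_sq M (\<lambda>x. weak_grad \<Omega> (w i) x - weak_grad \<Omega> (w j) x) < e" if "i \<ge> N" "j \<ge> N" for i j
      proof (cases "i \<le> j")
        case True
        then show ?thesis using diff[OF True] N[OF that(1)] by linarith
      next
        case False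
        then have "j \<le> i" by simp
        from diff[OF this] N[OF that(2)] L2_sq_diff_commute[of M "weak_grad \<Omega> (w i)" "weak_grad \<Omega> (w j)"]
        show ?thesis by linarith
      qed
      then show ?thesis by blast
    qed
    then obtain g where g: "square_integrable M g" "(\<lambda>n. L2_sq M (\<lambda>x. weak_grad \<Omega> (w n) x - g x)) \<longlonglongrightarrow> 0"
      using L2_complete[of "\<lambda>n. weak_grad \<Omega> (w n)"] sqw(2) by blast
    have "(\<lambda>n. L2_sq M (\<lambda>x. w n x - v x)) \<longlonglongrightarrow> 0"
    proof (rule tendsto_sandwich[OF _ _ tendsto_const])
      show "(\<lambda>n. 1 / real (Suc n)) \<longlonglongrightarrow> 0" using LIMSEQ_Suc[OF lim_1_over_n] by simp
      show "\<forall>\<^sub>F n in sequentially. L2_sq M (\<lambda>x. w n x - v x) \<le> 1 / real (Suc n)"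
        by (intro always_eventually allI wv)
    qed simp
    then show ?thesis by (intro H10_limit(1)[OF wH H10_has_L2_grad(1)[OF wH] sqv g(1) _ g(2)])
  qed
  have weak: "(\<lambda>n. ip (U n) w) \<longlonglongrightarrow> ip v w" if w: "w \<in> H10 \<Omega>" for w
  proof (rule LIMSEQ_I)
    fix e :: real assume e: "e > 0"
    \<comment> \<open>The energy of v is not yet compared with B, so the constant dominates
      both.\<close>
    define B' where "B' = max B (dirichlet \<Omega> v)"
    have B': "B' \<ge> 0" "B' \<ge> B" "B' \<ge> dirichlet \<Omega> v" using H10_dirichlet_nonneg[of v] by (auto simp: B'_def)
    \<comment> \<open>Cauchy-Schwarz multiplies this by an energy at most B' + 1 and takes a root,
      leaving e/4.\<close>
    have "(e / 4)\<^sup>2 / (B' + 1) > 0" using e B' by (intro divide_pos_pos) auto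
    then obtain \<psi> E where \<psi>: "\<psi> \<in> test_functions \<Omega>" "\<And>x. GDERIV \<psi> x :> E x"
      and small: "L2_sq M (\<lambda>x. w x - \<psi> x) + L2_sq M (\<lambda>x. weak_grad \<Omega> w x - E x) < (e / 4)\<^sup>2 / (B' + 1)"
      using H10_has_L2_grad(2)[OF w] unfolding approx_def by blast
    note sqE = test_square_integrable(2)[OF \<psi>]
    note sqw = has_L2_gradD(2)[OF H10_has_L2_grad(1)[OF w]]
    obtain \<Lambda> where \<Lambda>: "square_integrable M \<Lambda>" "\<And>u g. has_L2_grad u g \<Longrightarrow> (LINT x|M. g x \<bullet> E x) = - (LINT x|M. u x \<bullet> \<Lambda> x)"
      by (rule test_Laplacian[OF \<psi>]) (rule that)
    have close: "\<bar>ip y w - (LINT x|M. weak_grad \<Omega> y x \<bullet> E x)\<bar> \<le> e / 4"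
      if y: "y \<in> H10 \<Omega>" "dirichlet \<Omega> y \<le> B'" for y
    proof -
      note sqy = has_L2_gradD(2)[OF H10_has_L2_grad(1)[OF y(1)]]
      have eq: "ip y w - (LINT x|M. weak_grad \<Omega> y x \<bullet> E x) = (LINT x|M. weak_grad \<Omega> y x \<bullet> (weak_grad \<Omega> w x - E x))"
        unfolding ip_def inner_diff_right
        by (rule Bochner_Integration.integral_diff[symmetric]) (intro square_integrable_inner sqy sqw sqE)+
      have "(LINT x|M. weak_grad \<Omega> y x \<bullet> (weak_grad \<Omega> w x - E x))\<^sup>2 \<le> dirichlet \<Omega> y * L2_sq M (\<lambda>x. weak_grad \<Omega> w x - E x)"
        unfolding dirichlet_def by (rule L2_Cauchy_Schwarz[OF sqy square_integrable_diff[OF sqw sqE]])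
      also have "\<dots> \<le> (B' + 1) * ((e / 4)\<^sup>2 / (B' + 1))"
      proof (rule mult_mono)
        show "L2_sq M (\<lambda>x. weak_grad \<Omega> w x - E x) \<le> (e / 4)\<^sup>2 / (B' + 1)"
          using small L2_sq_nonneg[of M "\<lambda>x. w x - \<psi> x"] by linarith
      qed (use y(2) B' in auto)
      also have "\<dots> = (e / 4)\<^sup>2" using B' by simp
      finally have "(ip y w - (LINT x|M. weak_grad \<Omega> y x \<bullet> E x))\<^sup>2 \<le> (e / 4)\<^sup>2" unfolding eq .
      then show ?thesis using e abs_le_square_iff[of "ip y w - (LINT x|M. weak_grad \<Omega> y x \<bullet> E x)" "e / 4"] by simp
    qed
    have "(\<lambda>n. - (LINT x|M. U n x \<bullet> \<Lambda> x)) \<longlonglongrightarrow> - (LINT x|M. v x \<bullet> \<Lambda> x)"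
      by (intro tendsto_minus L2_inner_tendsto sqU sqv \<Lambda> L2lim)
    then have "(\<lambda>n. LINT x|M. weak_grad \<Omega> (U n) x \<bullet> E x) \<longlonglongrightarrow> (LINT x|M. weak_grad \<Omega> v x \<bullet> E x)"
      using \<Lambda>(2)[OF H10_has_L2_grad(1)[OF U(1)]] \<Lambda>(2)[OF H10_has_L2_grad(1)[OF v_H10]] by simp
    from LIMSEQ_D[OF this, of "e / 4"] e obtain N where
      N: "\<And>n. n \<ge> N \<Longrightarrow> \<bar>(LINT x|M. weak_grad \<Omega> (U n) x \<bullet> E x) - (LINT x|M. weak_grad \<Omega> v x \<bullet> E x)\<bar> < e / 4" by auto
    have "norm (ip (U n) w - ip v w) < e" if "n \<ge> N" for n
    proof -
      have "\<bar>ip (U n) w - (LINT x|M. weak_grad \<Omega> (U n) x \<bullet> E x)\<bar> \<le> e / 4"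
        using U B' by (intro close) (auto intro: order_trans)
      moreover have "\<bar>ip v w - (LINT x|M. weak_grad \<Omega> v x \<bullet> E x)\<bar> \<le> e / 4"
        using v_H10 B' by (intro close)
      ultimately show ?thesis using N[OF that] e unfolding real_norm_def by linarith
    qed
    then show "\<exists>N. \<forall>n\<ge>N. norm (ip (U n) w - ip v w) < e" by blast
  qed
  show thesis using that[OF r v_H10 lim] weak unfolding U_def by blast
qed

end

section \<open>Differentiation of integral functionals\<close>

lemma primitive_eq_LINT:
  "primitive g t = (if 0 \<le> t then LINT s|lborel. indicator {0<..<t} s * g s
    else - (LINT s|lborel. indicator {t<..<0} s * g s))"
  unfolding primitive_def interval_lebesgue_integral_def set_lebesgue_integral_def
  by (simp add: zero_ereal_def)

lemma primitive_0: "primitive g 0 = 0"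
  by (simp add: primitive_eq_LINT)

lemma primitive_has_derivative:
  assumes "continuous_on UNIV g"
  shows "(primitive g has_real_derivative g t) (at t)"
proof -
  let ?R = "\<bar>t\<bar> + 1"
  have "((\<lambda>u. LBINT s=0..u. g s) has_vector_derivative g t) (at t within {- ?R..?R})"
    unfolding zero_ereal_def
    by (rule interval_integral_FTC2) (auto intro: continuous_on_subset[OF assms])
  moreover have "at t within {- ?R..?R} = at t"
    by (rule at_within_Icc_at) auto
  ultimately show ?thesis
    unfolding primitive_def by (simp add: has_real_derivative_iff_has_vector_derivative)
qed

text \<open>h is controlled only on [0, infinity), so it is extended to the left by its value at 0;
  the primitives agree on nonnegative arguments, and at 0 the derivative is one-sided.\<close>

lemma primitive_has_derivative_within:
  assumes "continuous_on {0..} h" "t \<ge> 0"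
  shows "(primitive h has_real_derivative h t) (at t within {0..})"
proof -
  define h' where "h' s = h (max 0 s)" for s
  have "continuous_on UNIV h'"
    unfolding h'_def by (rule continuous_on_compose2[OF assms(1)]) (auto intro!: continuous_intros)
  then have "(primitive h' has_real_derivative h t) (at t within {0..})"
    using primitive_has_derivative[of h' t] assms(2) by (auto simp: h'_def intro: has_field_derivative_at_within)
  moreover have "primitive h s = primitive h' s" if "s \<in> {0..}" for s
  proof -
    have "(\<lambda>r. indicator {0<..<s} r * h r) = (\<lambda>r. indicator {0<..<s} r * h' r)"
      by (intro ext) (auto simp: indicator_def h'_def)
    then show ?thesis using that by (simp add: primitive_eq_LINT)
  qed
  ultimately show ?thesis
    using assms(2) by (auto intro: has_field_derivative_transform_within[of _ _ _ _ 1])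
qed

text \<open>Only t = 0 calls for an argument: the difference quotient is at most |t|^(q-1), which
  tends to 0 as q > 1.\<close>

lemma abs_powr_has_derivative:
  fixes q :: real
  assumes "q > 1"
  shows "((\<lambda>t. \<bar>t\<bar> powr q) has_real_derivative q * (sgn t * \<bar>t\<bar> powr (q - 1))) (at t)"
proof -
  consider "t > 0" | "t < 0" | "t = 0" by linarith
  then show ?thesis
  proof cases
    case 1
    then have "((\<lambda>t. t powr q) has_real_derivative q * (sgn t * \<bar>t\<bar> powr (q - 1))) (at t)"
      using has_real_derivative_powr[of t q] by simp
    then show ?thesis
      by (rule has_field_derivative_transform_within_open[where S = "{0<..}"]) (use 1 in auto)
  next
    case 2
    have "((\<lambda>t. (- t) powr q) has_real_derivative q * (- t) powr (q - 1) * (-1)) (at t)"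
      using 2 by (intro DERIV_chain2[OF has_real_derivative_powr]) (auto intro!: derivative_eq_intros)
    then have "((\<lambda>t. (- t) powr q) has_real_derivative q * (sgn t * \<bar>t\<bar> powr (q - 1))) (at t)"
      using 2 by simp
    then show ?thesis
      by (rule has_field_derivative_transform_within_open[where S = "{..<0}"]) (use 2 in auto)
  next
    case 3
    have "((\<lambda>h. \<bar>h\<bar> powr (q - 1)) \<longlongrightarrow> \<bar>0\<bar> powr (q - 1)) (at (0::real))"
      using assms by (intro tendsto_abs_powr tendsto_ident_at) auto
    then have lim: "((\<lambda>h. \<bar>h\<bar> powr (q - 1)) \<longlongrightarrow> 0) (at (0::real))" by simp
    have "((\<lambda>h. \<bar>h\<bar> powr q / h) \<longlongrightarrow> 0) (at 0)"
    proof (rule Lim_null_comparison[OF _ lim])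
      show "\<forall>\<^sub>F h in at 0. norm (\<bar>h\<bar> powr q / h) \<le> \<bar>h\<bar> powr (q - 1)"
        unfolding eventually_at_filter
      proof (intro always_eventually allI impI)
        fix h :: real assume "h \<noteq> 0"
        then have "\<bar>h\<bar> powr (q - 1) = \<bar>h\<bar> powr q / \<bar>h\<bar>" by (simp add: powr_diff)
        then show "norm (\<bar>h\<bar> powr q / h) \<le> \<bar>h\<bar> powr (q - 1)" by simp
      qed
    qed
    then have "((\<lambda>t. \<bar>t\<bar> powr q) has_real_derivative 0) (at 0)"
      unfolding DERIV_def by simp
    then show ?thesis unfolding 3 by simp
  qed
qed

lemma real_increment_bound:
  fixes G g :: "real \<Rightarrow> real"
  assumes "\<And>t. (G has_real_derivative g t) (at t)" "\<And>t. \<bar>t\<bar> \<le> \<bar>a\<bar> + \<bar>b\<bar> \<Longrightarrow> \<bar>g t\<bar> \<le> B"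
  shows "\<bar>G (a + b) - G a\<bar> \<le> B * \<bar>b\<bar>"
proof -
  have "norm (G (a + b) - G a) \<le> B * norm ((a + b) - a)"
  proof (rule field_differentiable_bound[where S = "cball 0 (\<bar>a\<bar> + \<bar>b\<bar>)" and f' = g])
    show "(G has_real_derivative g z) (at z within cball 0 (\<bar>a\<bar> + \<bar>b\<bar>))" for z
      using assms(1) by (rule has_field_derivative_at_within)
  qed (use assms(2) in auto)
  then show ?thesis by simp
qed

text \<open>Compare b with \<epsilon> a: if b is at most that, the product is at most \<epsilon>
  a^q; otherwise a < b/\<epsilon> and the product is controlled by b^q. This is a form of Young's
  inequality with an explicit constant.\<close>

lemma powr_mult_eps:
  fixes a b \<epsilon> q :: real
  assumes "a \<ge> 0" "b \<ge> 0" "\<epsilon> > 0" "q > 1"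
  shows "a powr (q - 1) * b \<le> \<epsilon> * a powr q + (1 / \<epsilon>) powr (q - 1) * b powr q"
proof -
  have split: "x powr (q - 1) * x = x powr q" if "x \<ge> 0" for x
    using that assms(4) by (cases "x = 0") (auto simp: powr_diff)
  show ?thesis
  proof (cases "b \<le> \<epsilon> * a")
    case True
    then have "a powr (q - 1) * b \<le> a powr (q - 1) * (\<epsilon> * a)" by (intro mult_left_mono) auto
    also have "\<dots> = \<epsilon> * a powr q" using split[OF assms(1)] by (simp add: mult_ac)
    finally show ?thesis by (simp add: add_increasing2)
  next
    case False
    then have "a \<le> (1 / \<epsilon>) * b" using assms(3) by (simp add: field_simps)
    then have "a powr (q - 1) * b \<le> ((1 / \<epsilon>) * b) powr (q - 1) * b"
      using assms by (intro mult_right_mono powr_mono2) auto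
    also have "((1 / \<epsilon>) * b) powr (q - 1) = (1 / \<epsilon>) powr (q - 1) * b powr (q - 1)"
      by (rule powr_mult)
    also have "(1 / \<epsilon>) powr (q - 1) * b powr (q - 1) * b = (1 / \<epsilon>) powr (q - 1) * (b powr (q - 1) * b)"
      by (rule mult.assoc)
    finally show ?thesis using split[OF assms(2)] assms(3) by (simp add: add_increasing)
  qed
qed

lemma powr_add_le:
  fixes a b q :: real
  assumes "a \<ge> 0" "b \<ge> 0" "q \<ge> 0"
  shows "(a + b) powr q \<le> 2 powr q * (a powr q + b powr q)"
proof -
  have "(a + b) powr q \<le> (2 * max a b) powr q" using assms by (intro powr_mono2) auto
  also have "\<dots> = 2 powr q * (max a b) powr q" using assms by (simp add: powr_mult)
  also have "(max a b) powr q \<le> a powr q + b powr q" by (simp add: max_def)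
  finally show ?thesis by simp
qed

text \<open>The mean value theorem bounds the difference by q (|a| + |b|)^(q-1) |b|;
  \<open>powr_mult_eps\<close> shifts all but a small multiple of |a|^q into |b|^q.\<close>

lemma Brezis_Lieb_pointwise:
  fixes \<epsilon> q :: real
  assumes "\<epsilon> > 0" "q > 1"
  obtains C where "C \<ge> 0" "\<And>a b. \<bar>\<bar>a + b\<bar> powr q - \<bar>a\<bar> powr q\<bar> \<le> \<epsilon> * \<bar>a\<bar> powr q + C * \<bar>b\<bar> powr q"
proof -
  \<comment> \<open>Compensates the factor q from the derivative and 2^q from splitting (|a| +
    |b|)^q.\<close>
  define \<delta> where "\<delta> = \<epsilon> / (q * 2 powr q)"
  have \<delta>: "\<delta> > 0" "q * \<delta> * 2 powr q = \<epsilon>" using assms by (simp_all add: \<delta>_def)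
  define C where "C = \<epsilon> + q * (1 / \<delta>) powr (q - 1)"
  have "\<bar>\<bar>a + b\<bar> powr q - \<bar>a\<bar> powr q\<bar> \<le> \<epsilon> * \<bar>a\<bar> powr q + C * \<bar>b\<bar> powr q" for a b
  proof -
    have "\<bar>\<bar>a + b\<bar> powr q - \<bar>a\<bar> powr q\<bar> \<le> (q * (\<bar>a\<bar> + \<bar>b\<bar>) powr (q - 1)) * \<bar>b\<bar>"
    proof (rule real_increment_bound[where G = "\<lambda>t. \<bar>t\<bar> powr q", OF abs_powr_has_derivative[OF assms(2)]])
      fix t :: real assume t: "\<bar>t\<bar> \<le> \<bar>a\<bar> + \<bar>b\<bar>"
      have "\<bar>q * (sgn t * \<bar>t\<bar> powr (q - 1))\<bar> \<le> q * \<bar>t\<bar> powr (q - 1)"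
        using assms(2) by (auto simp: abs_mult sgn_real_def)
      also have "\<dots> \<le> q * (\<bar>a\<bar> + \<bar>b\<bar>) powr (q - 1)" using t assms(2) by (intro mult_left_mono powr_mono2) auto
      finally show "\<bar>q * (sgn t * \<bar>t\<bar> powr (q - 1))\<bar> \<le> q * (\<bar>a\<bar> + \<bar>b\<bar>) powr (q - 1)" .
    qed
    also have "\<dots> = q * ((\<bar>a\<bar> + \<bar>b\<bar>) powr (q - 1) * \<bar>b\<bar>)" by simp
    also have "\<dots> \<le> q * (\<delta> * (\<bar>a\<bar> + \<bar>b\<bar>) powr q + (1 / \<delta>) powr (q - 1) * \<bar>b\<bar> powr q)"
      using assms \<delta> by (intro mult_left_mono powr_mult_eps) auto
    also have "\<dots> \<le> q * (\<delta> * (2 powr q * (\<bar>a\<bar> powr q + \<bar>b\<bar> powr q)) + (1 / \<delta>) powr (q - 1) * \<bar>b\<bar> powr q)"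
      using assms \<delta> by (intro mult_left_mono add_right_mono powr_add_le) auto
    also have "\<dots> = (q * \<delta> * 2 powr q) * (\<bar>a\<bar> powr q + \<bar>b\<bar> powr q) + q * (1 / \<delta>) powr (q - 1) * \<bar>b\<bar> powr q"
      by (simp only: distrib_left mult.assoc)
    also have "\<dots> = \<epsilon> * \<bar>a\<bar> powr q + C * \<bar>b\<bar> powr q"
      unfolding \<delta>(2) C_def by (simp add: algebra_simps)
    finally show ?thesis .
  qed
  moreover have "C \<ge> 0" using assms by (simp add: C_def)
  ultimately show thesis using that by blast
qed

text \<open>Stated for an abstract integrand so that it serves both the lower-order term and the
  critical power. The mean value theorem bounds the difference quotients by a fixed integrable
  function, and dominated convergence applies; the steps 1/(k+1) suffice because the limit will be
  compared with a given derivative.\<close>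

lemma (in finite_measure) integral_Gateaux:
  fixes G g :: "'a \<Rightarrow> real \<Rightarrow> real" and u v :: "'a \<Rightarrow> real" and q c :: real
  assumes q: "q > 1" and c: "c \<ge> 0"
    and deriv: "AE x in M. \<forall>t. (G x has_real_derivative g x t) (at t)"
    and growth: "AE x in M. \<forall>t. \<bar>g x t\<bar> \<le> c * (1 + \<bar>t\<bar> powr (q - 1))"
    and G0: "\<And>x. G x 0 = 0"
    and G_meas: "\<And>w. w \<in> borel_measurable M \<Longrightarrow> (\<lambda>x. G x (w x)) \<in> borel_measurable M"
    and u: "u \<in> borel_measurable M" "integrable M (\<lambda>x. \<bar>u x\<bar> powr q)"
    and v: "v \<in> borel_measurable M" "integrable M (\<lambda>x. \<bar>v x\<bar> powr q)"
    and g_meas: "(\<lambda>x. g x (u x)) \<in> borel_measurable M"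
  shows "integrable M (\<lambda>x. G x (u x))"
    and "integrable M (\<lambda>x. g x (u x) * v x)"
    and "(\<lambda>n. ((LINT x|M. G x (u x + 1 / real (Suc n) * v x)) - (LINT x|M. G x (u x))) / (1 / real (Suc n)))
      \<longlonglongrightarrow> (LINT x|M. g x (u x) * v x)"
proof -
  note [measurable] = u(1) v(1) g_meas
  \<comment> \<open>One majorant for three purposes: P u v dominates the difference quotients and
    g(u) v, and P 0 w dominates G(w) itself.\<close>
  define P where "P a b = c * (\<bar>b\<bar> + (\<bar>a\<bar> + \<bar>b\<bar>) powr q)" for a b :: real
  have incr: "AE x in M. \<forall>a b. \<bar>G x (a + b) - G x a\<bar> \<le> c * (1 + (\<bar>a\<bar> + \<bar>b\<bar>) powr (q - 1)) * \<bar>b\<bar>"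
    using deriv growth
  proof eventually_elim
    case (elim x)
    show ?case
    proof (intro allI)
      fix a b
      show "\<bar>G x (a + b) - G x a\<bar> \<le> c * (1 + (\<bar>a\<bar> + \<bar>b\<bar>) powr (q - 1)) * \<bar>b\<bar>"
      proof (rule real_increment_bound[where g = "g x"])
        show "(G x has_real_derivative g x t) (at t)" for t using elim(1) by blast
        fix t :: real assume "\<bar>t\<bar> \<le> \<bar>a\<bar> + \<bar>b\<bar>"
        then have "c * (1 + \<bar>t\<bar> powr (q - 1)) \<le> c * (1 + (\<bar>a\<bar> + \<bar>b\<bar>) powr (q - 1))"
          using q c by (intro mult_left_mono add_left_mono powr_mono2) auto
        then show "\<bar>g x t\<bar> \<le> c * (1 + (\<bar>a\<bar> + \<bar>b\<bar>) powr (q - 1))" using elim(2) order_trans by blast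
      qed
    qed
  qed
  have split: "t powr (q - 1) * t = t powr q" if "t \<ge> 0" for t
    using that q by (cases "t = 0") (auto simp: powr_diff)
  have cP: "c * (1 + (\<bar>a\<bar> + \<bar>b\<bar>) powr (q - 1)) * \<bar>b\<bar> \<le> P a b" for a b
  proof -
    have "(\<bar>a\<bar> + \<bar>b\<bar>) powr (q - 1) * \<bar>b\<bar> \<le> (\<bar>a\<bar> + \<bar>b\<bar>) powr (q - 1) * (\<bar>a\<bar> + \<bar>b\<bar>)" by (intro mult_left_mono) auto
    also have "\<dots> = (\<bar>a\<bar> + \<bar>b\<bar>) powr q" by (rule split) simp
    finally have "c * ((1 + (\<bar>a\<bar> + \<bar>b\<bar>) powr (q - 1)) * \<bar>b\<bar>) \<le> P a b"
      unfolding P_def using c by (intro mult_left_mono) (auto simp: distrib_right)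
    then show ?thesis by (simp add: mult.assoc)
  qed
  have le1: "t \<le> 1 + t powr q" if "t \<ge> 0" for t
    using powr_interpolation[of t 1 1 q] that q by simp
  have P_int: "integrable M (\<lambda>x. P (a x) (b x))"
    if [measurable]: "a \<in> borel_measurable M" "b \<in> borel_measurable M"
      and i: "integrable M (\<lambda>x. \<bar>a x\<bar> powr q)" "integrable M (\<lambda>x. \<bar>b x\<bar> powr q)" for a b :: "'a \<Rightarrow> real"
  proof (rule Bochner_Integration.integrable_bound)
    show "integrable M (\<lambda>x. c * ((1 + \<bar>b x\<bar> powr q) + 2 powr q * (\<bar>a x\<bar> powr q + \<bar>b x\<bar> powr q)))"
      using i by simp
    show "AE x in M. norm (P (a x) (b x)) \<le> norm (c * ((1 + \<bar>b x\<bar> powr q) + 2 powr q * (\<bar>a x\<bar> powr q + \<bar>b x\<bar> powr q)))"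
    proof (rule AE_I2)
      fix x
      have "P (a x) (b x) \<le> c * ((1 + \<bar>b x\<bar> powr q) + 2 powr q * (\<bar>a x\<bar> powr q + \<bar>b x\<bar> powr q))"
        unfolding P_def using c q by (intro mult_left_mono add_mono le1 powr_add_le) auto
      moreover have "P (a x) (b x) \<ge> 0" unfolding P_def using c by simp
      ultimately show "norm (P (a x) (b x)) \<le> norm (c * ((1 + \<bar>b x\<bar> powr q) + 2 powr q * (\<bar>a x\<bar> powr q + \<bar>b x\<bar> powr q)))"
        by simp
    qed
    show "(\<lambda>x. P (a x) (b x)) \<in> borel_measurable M" unfolding P_def by measurable
  qed
  have G_int: "integrable M (\<lambda>x. G x (w x))"
    if w: "w \<in> borel_measurable M" "integrable M (\<lambda>x. \<bar>w x\<bar> powr q)" for w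
  proof (rule Bochner_Integration.integrable_bound)
    show "integrable M (\<lambda>x. P 0 (w x))" using P_int[OF _ w(1) _ w(2), of "\<lambda>_. 0"] q by simp
    show "AE x in M. norm (G x (w x)) \<le> norm (P 0 (w x))"
      using incr
    proof eventually_elim
      case (elim x)
      have "\<bar>G x (0 + w x) - G x 0\<bar> \<le> P 0 (w x)" using elim cP order_trans by blast
      then show ?case using G0 by simp
    qed
  qed (rule G_meas[OF w(1)])
  show "integrable M (\<lambda>x. G x (u x))" by (rule G_int[OF u])
  let ?e = "\<lambda>n. 1 / real (Suc n)"
  have Gn: "integrable M (\<lambda>x. G x (u x + ?e n * v x))" for n
  proof (rule G_int)
    show "integrable M (\<lambda>x. \<bar>u x + ?e n * v x\<bar> powr q)"
    proof (rule Bochner_Integration.integrable_bound)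
      show "integrable M (\<lambda>x. 2 powr q * (\<bar>u x\<bar> powr q + \<bar>v x\<bar> powr q))" using u v by simp
      show "AE x in M. norm (\<bar>u x + ?e n * v x\<bar> powr q) \<le> norm (2 powr q * (\<bar>u x\<bar> powr q + \<bar>v x\<bar> powr q))"
      proof (rule AE_I2)
        fix x
        have "\<bar>?e n * v x\<bar> \<le> \<bar>v x\<bar>" unfolding abs_mult by (intro mult_left_le_one_le) auto
        then have "\<bar>u x + ?e n * v x\<bar> \<le> \<bar>u x\<bar> + \<bar>v x\<bar>" by linarith
        then have "\<bar>u x + ?e n * v x\<bar> powr q \<le> (\<bar>u x\<bar> + \<bar>v x\<bar>) powr q" using q by (intro powr_mono2) auto
        also have "\<dots> \<le> 2 powr q * (\<bar>u x\<bar> powr q + \<bar>v x\<bar> powr q)" using q by (intro powr_add_le) auto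
        finally show "norm (\<bar>u x + ?e n * v x\<bar> powr q) \<le> norm (2 powr q * (\<bar>u x\<bar> powr q + \<bar>v x\<bar> powr q))" by simp
      qed
    qed measurable
  qed measurable
  have quot: "((LINT x|M. G x (u x + ?e n * v x)) - (LINT x|M. G x (u x))) / ?e n
      = (LINT x|M. (G x (u x + ?e n * v x) - G x (u x)) / ?e n)" for n
    using Gn G_int[OF u] by simp
  have gv: "AE x in M. \<bar>g x (u x) * v x\<bar> \<le> P (u x) (v x)"
    using growth
  proof eventually_elim
    case (elim x)
    have "c * (1 + \<bar>u x\<bar> powr (q - 1)) \<le> c * (1 + (\<bar>u x\<bar> + \<bar>v x\<bar>) powr (q - 1))"
      using q c by (intro mult_left_mono add_left_mono powr_mono2) auto
    then have "\<bar>g x (u x)\<bar> \<le> c * (1 + (\<bar>u x\<bar> + \<bar>v x\<bar>) powr (q - 1))" using elim order_trans by blast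
    then have "\<bar>g x (u x)\<bar> * \<bar>v x\<bar> \<le> c * (1 + (\<bar>u x\<bar> + \<bar>v x\<bar>) powr (q - 1)) * \<bar>v x\<bar>" by (rule mult_right_mono) simp
    then show ?case using cP[of "u x" "v x"] by (simp add: abs_mult)
  qed
  show "integrable M (\<lambda>x. g x (u x) * v x)"
    by (rule Bochner_Integration.integrable_bound[OF P_int[OF u(1) v(1) u(2) v(2)]])
      (use gv in \<open>auto elim!: eventually_mono\<close>)
  have "(\<lambda>n. LINT x|M. (G x (u x + ?e n * v x) - G x (u x)) / ?e n) \<longlonglongrightarrow> (LINT x|M. g x (u x) * v x)"
  proof (rule integral_dominated_convergence[where w = "\<lambda>x. P (u x) (v x)"])
    show "integrable M (\<lambda>x. P (u x) (v x))" by (rule P_int[OF u(1) v(1) u(2) v(2)])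
    show "AE x in M. (\<lambda>n. (G x (u x + ?e n * v x) - G x (u x)) / ?e n) \<longlonglongrightarrow> g x (u x) * v x"
      using deriv
    proof eventually_elim
      case (elim x)
      have "((\<lambda>t. G x (u x + t * v x)) has_real_derivative g x (u x + 0 * v x) * v x) (at 0)"
        using elim by (intro DERIV_chain2[where f = "G x"]) (auto intro!: derivative_eq_intros)
      then have "(\<lambda>h. (G x (u x + h * v x) - G x (u x)) / h) \<midarrow>0\<rightarrow> g x (u x) * v x"
        by (simp add: DERIV_def)
      moreover have "filterlim (\<lambda>n. 1 / real (Suc n)) (at 0) sequentially"
        using LIMSEQ_Suc[OF lim_1_over_n] by (auto simp: filterlim_at)
      ultimately show ?case by (rule filterlim_compose)
    qed
    show "AE x in M. norm ((G x (u x + ?e n * v x) - G x (u x)) / ?e n) \<le> P (u x) (v x)" for n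
      using incr
    proof eventually_elim
      case (elim x)
      have e: "\<bar>?e n * v x\<bar> \<le> \<bar>v x\<bar>" unfolding abs_mult by (intro mult_left_le_one_le) auto
      have "\<bar>G x (u x + ?e n * v x) - G x (u x)\<bar> \<le> c * (1 + (\<bar>u x\<bar> + \<bar>?e n * v x\<bar>) powr (q - 1)) * \<bar>?e n * v x\<bar>"
        using elim by blast
      also have "\<dots> \<le> c * (1 + (\<bar>u x\<bar> + \<bar>v x\<bar>) powr (q - 1)) * \<bar>?e n * v x\<bar>"
        using e q c by (intro mult_right_mono mult_left_mono add_left_mono powr_mono2) auto
      also have "\<dots> = ?e n * (c * (1 + (\<bar>u x\<bar> + \<bar>v x\<bar>) powr (q - 1)) * \<bar>v x\<bar>)" by (simp add: abs_mult)
      also have "\<dots> \<le> ?e n * P (u x) (v x)" by (intro mult_left_mono cP) simp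
      finally have "\<bar>G x (u x + ?e n * v x) - G x (u x)\<bar> / ?e n \<le> P (u x) (v x)" by (simp add: field_simps)
      then show ?case by (simp add: abs_mult)
    qed
    show "(\<lambda>x. (G x (u x + ?e n * v x) - G x (u x)) / ?e n) \<in> borel_measurable M" for n
      using Gn G_int[OF u] by (intro borel_measurable_divide borel_measurable_diff borel_measurable_integrable) auto
  qed measurable
  then show "(\<lambda>n. ((LINT x|M. G x (u x + ?e n * v x)) - (LINT x|M. G x (u x))) / ?e n) \<longlonglongrightarrow> (LINT x|M. g x (u x) * v x)"
    unfolding quot .
qed

text \<open>Continuity in t makes f the limit of f(x, t_k), where t_k is t rounded down to a
  multiple of 1/(k+1). For fixed k the number t_k ranges over a countable set, so the approximant is
  measurable piece by piece.\<close>

lemma caratheodory_joint_measurable: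
  fixes f :: "'a \<Rightarrow> real \<Rightarrow> real"
  assumes f: "\<And>t. (\<lambda>x. f x t) \<in> borel_measurable M" and cont: "\<And>x. continuous_on UNIV (f x)"
  shows "(\<lambda>(x, t). f x t) \<in> borel_measurable (M \<Otimes>\<^sub>M borel)"
proof (rule borel_measurable_LIMSEQ_real)
  let ?r = "\<lambda>k t. real_of_int \<lfloor>real (Suc k) * t\<rfloor> / real (Suc k)"
  fix k :: nat
  have "(\<lambda>p. f (fst p) (real_of_int i / real (Suc k))) \<in> borel_measurable (M \<Otimes>\<^sub>M borel)" for i :: int
    using measurable_compose[OF measurable_fst f] .
  moreover have "(\<lambda>p. \<lfloor>real (Suc k) * snd p\<rfloor>) \<in> measurable (M \<Otimes>\<^sub>M borel) (count_space UNIV)"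
    by measurable
  ultimately have "(\<lambda>p. f (fst p) (real_of_int \<lfloor>real (Suc k) * snd p\<rfloor> / real (Suc k))) \<in> borel_measurable (M \<Otimes>\<^sub>M borel)"
    by (rule measurable_compose_countable[where f = "\<lambda>i p. f (fst p) (real_of_int i / real (Suc k))"])
  then show "(\<lambda>p. f (fst p) (?r k (snd p))) \<in> borel_measurable (M \<Otimes>\<^sub>M borel)" .
next
  fix p :: "'a \<times> real"
  have "(\<lambda>k. real_of_int \<lfloor>real (Suc k) * snd p\<rfloor> / real (Suc k)) \<longlonglongrightarrow> snd p"
  proof (rule LIM_zero_cancel, rule Lim_null_comparison)
    show "(\<lambda>k. 1 / real (Suc k)) \<longlonglongrightarrow> 0" using LIMSEQ_Suc[OF lim_1_over_n] by simp
    show "\<forall>\<^sub>F k in sequentially. norm (real_of_int \<lfloor>real (Suc k) * snd p\<rfloor> / real (Suc k) - snd p) \<le> 1 / real (Suc k)"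
    proof (intro always_eventually allI)
      fix k
      have "\<bar>real_of_int \<lfloor>real (Suc k) * snd p\<rfloor> - real (Suc k) * snd p\<bar> \<le> 1" by linarith
      then have "\<bar>real_of_int \<lfloor>real (Suc k) * snd p\<rfloor> - real (Suc k) * snd p\<bar> / real (Suc k) \<le> 1 / real (Suc k)"
        by (rule divide_right_mono) simp
      moreover have "real_of_int \<lfloor>real (Suc k) * snd p\<rfloor> / real (Suc k) - snd p
          = (real_of_int \<lfloor>real (Suc k) * snd p\<rfloor> - real (Suc k) * snd p) / real (Suc k)"
        unfolding diff_divide_distrib by simp
      ultimately show "norm (real_of_int \<lfloor>real (Suc k) * snd p\<rfloor> / real (Suc k) - snd p) \<le> 1 / real (Suc k)"
        unfolding real_norm_def by (simp only: abs_divide abs_of_nat)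
    qed
  qed
  moreover have "isCont (f (fst p)) (snd p)" using cont by (simp add: continuous_on_eq_continuous_at)
  ultimately have "(\<lambda>k. f (fst p) (real_of_int \<lfloor>real (Suc k) * snd p\<rfloor> / real (Suc k))) \<longlonglongrightarrow> f (fst p) (snd p)"
    by (rule isCont_tendsto_compose[rotated])
  then show "(\<lambda>k. f (fst p) (real_of_int \<lfloor>real (Suc k) * snd p\<rfloor> / real (Suc k))) \<longlonglongrightarrow> (case p of (x, t) \<Rightarrow> f x t)"
    by (simp add: case_prod_beta)
qed

context bounded_domain begin

text \<open>f is replaced by 0 on the null set of x where it is not continuous in t, which makes it
  jointly measurable; completeness of the measure carries the result back. The primitive is a
  parameter integral of the modified function.\<close>

lemma caratheodory_measurable:
  assumes f: "caratheodory \<Omega> f" and w: "w \<in> borel_measurable M"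
  shows "(\<lambda>x. f x (w x)) \<in> borel_measurable M" "(\<lambda>x. primitive (f x) (w x)) \<in> borel_measurable M"
proof -
  define f' where "f' x t = (if continuous_on UNIV (f x) then f x t else 0)" for x t
  have ae: "AE x in M. continuous_on UNIV (f x)" using f by (simp add: caratheodory_def)
  have "(\<lambda>x. f' x t) \<in> borel_measurable M" for t
  proof (rule borel_measurable_lebesgue_on_AE[OF _ sets_\<Omega>])
    show "(\<lambda>x. f x t) \<in> borel_measurable M" using f by (simp add: caratheodory_def)
    show "AE x in M. f x t = f' x t" using ae by eventually_elim (simp add: f'_def)
  qed
  moreover have "continuous_on UNIV (f' x)" for x
    unfolding f'_def by (cases "continuous_on UNIV (f x)") auto
  ultimately have joint[measurable]: "(\<lambda>(x, t). f' x t) \<in> borel_measurable (M \<Otimes>\<^sub>M borel)"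
    by (rule caratheodory_joint_measurable)
  have [measurable]: "w \<in> borel_measurable M" by (rule w)
  have "(\<lambda>x. f' x (w x)) \<in> borel_measurable M"
    using measurable_compose[OF measurable_Pair[OF measurable_ident_sets[OF refl] w] joint] by simp
  then show "(\<lambda>x. f x (w x)) \<in> borel_measurable M"
    by (rule borel_measurable_lebesgue_on_AE[OF _ sets_\<Omega>]) (use ae in \<open>auto elim!: eventually_mono simp: f'_def\<close>)
  have joint': "(\<lambda>(x, t). f' x t) \<in> borel_measurable (M \<Otimes>\<^sub>M lborel)"
    using joint by (simp cong: measurable_cong_sets)
  \<comment> \<open>Written with a fixed subset of the product, the moving integration domain
    becomes a jointly measurable integrand.\<close>
  have "(\<lambda>x. LINT s|lborel. indicator {p. 0 < snd p \<and> snd p < w (fst p)} (x, s) * f' x s) \<in> borel_measurable M"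
    by (rule lborel.borel_measurable_lebesgue_integral) (use joint' in measurable)
  moreover have "(\<lambda>x. LINT s|lborel. indicator {p. 0 < snd p \<and> snd p < w (fst p)} (x, s) * f' x s)
      = (\<lambda>x. LINT s|lborel. indicator {0<..<w x} s * f' x s)"
    by (intro ext Bochner_Integration.integral_cong refl) (simp add: indicator_def)
  ultimately have m1: "(\<lambda>x. LINT s|lborel. indicator {0<..<w x} s * f' x s) \<in> borel_measurable M" by (simp only:)
  have "(\<lambda>x. LINT s|lborel. indicator {p. w (fst p) < snd p \<and> snd p < 0} (x, s) * f' x s) \<in> borel_measurable M"
    by (rule lborel.borel_measurable_lebesgue_integral) (use joint' in measurable)
  moreover have "(\<lambda>x. LINT s|lborel. indicator {p. w (fst p) < snd p \<and> snd p < 0} (x, s) * f' x s)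
      = (\<lambda>x. LINT s|lborel. indicator {w x<..<0} s * f' x s)"
    by (intro ext Bochner_Integration.integral_cong refl) (simp add: indicator_def)
  ultimately have m2: "(\<lambda>x. LINT s|lborel. indicator {w x<..<0} s * f' x s) \<in> borel_measurable M" by (simp only:)
  note [measurable] = m1 m2
  have "(\<lambda>x. primitive (f' x) (w x)) \<in> borel_measurable M"
    unfolding primitive_eq_LINT by measurable
  then show "(\<lambda>x. primitive (f x) (w x)) \<in> borel_measurable M"
  proof (rule borel_measurable_lebesgue_on_AE[OF _ sets_\<Omega>])
    show "AE x in M. primitive (f' x) (w x) = primitive (f x) (w x)"
      using ae by eventually_elim (simp add: f'_def[abs_def])
  qed
qed

end

section \<open>The Kirchhoff functional\<close>

text \<open>The limits at 0 and infinity give points where the ratio lies above and below s, the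
  intermediate value theorem a crossing, and strict monotonicity its uniqueness and the description
  of the sublevel set. The limits are extended reals since the one at 0 may be infinite.\<close>

lemma ratio_crossing:
  fixes h :: "real \<Rightarrow> real" and s r :: real
  assumes h: "continuous_on {0..} h"
    and anti: "strict_antimono_on {0<..} (\<lambda>t. h t / t powr r)"
    and l: "((\<lambda>t. ereal (h t / t powr r)) \<longlongrightarrow> l) at_top" "l < ereal s"
    and l0: "((\<lambda>t. ereal (h t / t powr r)) \<longlongrightarrow> l0) (at_right 0)" "ereal s < l0"
  obtains t0 where "t0 > 0" "\<And>t. t > 0 \<Longrightarrow> h t = s * t powr r \<longleftrightarrow> t = t0"
    "\<And>t. t > 0 \<Longrightarrow> h t \<le> s * t powr r \<longleftrightarrow> t0 \<le> t"
proof -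
  define g where "g t = h t / t powr r" for t
  have anti': "g y < g x" if "0 < x" "x < y" for x y
    using monotone_onD[OF anti, of x y] that by (simp add: g_def)
  have "\<forall>\<^sub>F t in at_top. ereal (g t) < ereal s" unfolding g_def by (rule order_tendstoD(2)[OF l])
  then have "\<forall>\<^sub>F t in at_top. g t < s \<and> t > 0"
    using eventually_gt_at_top[of "0::real"] by eventually_elim simp
  then obtain b where b: "g b < s" "b > 0" by (metis (mono_tags, lifting) eventually_at_top_linorder order_refl)
  have "\<forall>\<^sub>F t in at_right 0. ereal s < ereal (g t)" unfolding g_def by (rule order_tendstoD(1)[OF l0])
  then have "\<forall>\<^sub>F t in at_right 0. s < g t \<and> t > 0"
    using eventually_at_right_less[of "0::real"] by eventually_elim simp
  then obtain a where a: "s < g a" "a > 0"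
    using eventually_happens'[of "at_right (0::real)"] trivial_limit_at_right_real[of "0::real"] by blast
  have "a < b" using anti'[of b a] a b by (cases a b rule: linorder_cases) auto
  have "continuous_on {a..b} g"
    unfolding g_def using a(2)
    by (intro continuous_on_divide continuous_on_subset[OF h] continuous_on_powr continuous_on_id continuous_on_const) auto
  then obtain t0 where t0: "a \<le> t0" "t0 \<le> b" "g t0 = s"
    using IVT2'[of g b s a] a b \<open>a < b\<close> by auto
  have pos: "t0 > 0" using t0 a by simp
  have iff: "h t = s * t powr r \<longleftrightarrow> g t = s" "h t \<le> s * t powr r \<longleftrightarrow> g t \<le> s" if "t > 0" for t
    using that by (simp_all add: g_def field_simps)
  have "g t = s \<longleftrightarrow> t = t0" "g t \<le> s \<longleftrightarrow> t0 \<le> t" if "t > 0" for t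
    using anti'[of t t0] anti'[of t0 t] that pos t0(3) by (cases t t0 rule: linorder_cases; auto)+
  then show thesis using that[OF pos] iff by simp
qed

locale kirchhoff = bounded_domain \<Omega> for \<Omega> :: "'a::euclidean_space set" +
  fixes h :: "real \<Rightarrow> real" and f :: "'a \<Rightarrow> real \<Rightarrow> real" and c1 c2 p :: real
    and n :: nat and \<alpha> \<gamma> \<mu> :: "nat \<Rightarrow> real"
  assumes h_nonneg: "\<forall>t\<ge>0. h t \<ge> 0"
    and h_cont: "continuous_on {0..} h"
    and h_mono: "mono_on {0..} h"
    and f_car: "caratheodory \<Omega> f"
    and growth_const: "c1 > 0" "c2 > 0" "1 < p" "p < crit_exp DIM('a)"
    and f_growth: "AE x in lebesgue_on \<Omega>. \<forall>t. \<bar>f x t\<bar> \<le> c1 * \<bar>t\<bar> powr (p - 1) + c2"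
    and A1_alpha: "\<forall>i\<in>{1..n}. \<alpha> i > 0"
    and A1_gamma: "\<forall>i\<in>{1..n}. 1 \<le> \<gamma> i \<and> \<gamma> i < crit_exp DIM('a) / 2"
    and A1_mu: "\<forall>i\<in>{1..n}. \<mu> i \<le> lambda1 \<Omega> (\<gamma> i)" "\<exists>i\<in>{1..n}. \<mu> i < lambda1 \<Omega> (\<gamma> i)"
    and A1_K: "\<forall>t\<ge>0. K_fun DIM('a) h t \<ge> (\<Sum>i=1..n. \<alpha> i * t powr \<gamma> i)"
    and A1_F: "AE x in lebesgue_on \<Omega>. \<forall>t. primitive (f x) t - 1 / crit_exp DIM('a) * (t * f x t)
        \<le> (\<Sum>i=1..n. \<mu> i * \<alpha> i * \<bar>t\<bar> powr (2 * \<gamma> i))"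
    and A2: "\<forall>t1\<ge>0. \<forall>t2\<ge>0. K_fun DIM('a) h (t1 + t2) \<ge> K_fun DIM('a) h t1 + K_fun DIM('a) h t2"
begin

abbreviation "J u \<equiv> J_fun \<Omega> h f u"

lemma alpha_nonneg: "Suc 0 \<le> i \<Longrightarrow> i \<le> n \<Longrightarrow> \<alpha> i \<ge> 0"
  using A1_alpha by (intro less_imp_le) simp

lemma K_nonneg: "t \<ge> 0 \<Longrightarrow> K_fun DIM('a) h t \<ge> 0"
proof -
  assume t: "t \<ge> 0"
  have "0 \<le> (\<Sum>i=1..n. \<alpha> i * t powr \<gamma> i)" by (intro sum_nonneg mult_nonneg_nonneg) (auto simp: alpha_nonneg)
  also have "\<dots> \<le> K_fun DIM('a) h t" using A1_K t by blast
  finally show ?thesis .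
qed

lemma c_star_le: "t \<in> I_set \<Omega> h \<Longrightarrow> c_star \<Omega> h \<le> K_fun DIM('a) h t"
  unfolding c_star_def using K_nonneg
  by (intro cINF_lower bdd_belowI2[where m = 0]) (auto simp: I_set_def)

text \<open>By \<open>ratio_crossing\<close> the set I is the half-line from t0. K is superadditive
  and nonnegative, hence nondecreasing, so the infimum is attained at t0. It is positive by the
  lower bound in (A1), whose sum is nonempty because some index satisfies the strict
  inequality.\<close>

lemma c_star_crossing:
  assumes anti: "strict_antimono_on {0<..} (\<lambda>t. h t / t powr (crit_exp DIM('a) / 2 - 1))"
    and l: "((\<lambda>t. ereal (h t / t powr (crit_exp DIM('a) / 2 - 1))) \<longlongrightarrow> l) at_top"
      "l < ereal (sobolev_const \<Omega> powr (- (crit_exp DIM('a) / 2)))"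
    and l0: "((\<lambda>t. ereal (h t / t powr (crit_exp DIM('a) / 2 - 1))) \<longlongrightarrow> l0) (at_right 0)"
      "ereal (sobolev_const \<Omega> powr (- (crit_exp DIM('a) / 2))) < l0"
  shows "(\<exists>t0>0. (\<forall>t>0. h t = sobolev_const \<Omega> powr (- (crit_exp DIM('a) / 2))
                       * t powr (crit_exp DIM('a) / 2 - 1) \<longleftrightarrow> t = t0) \<and>
        c_star \<Omega> h = K_fun DIM('a) h t0) \<and> c_star \<Omega> h > 0"
proof -
  obtain t0 where t0: "t0 > 0" "\<And>t. t > 0 \<Longrightarrow> h t = sobolev_const \<Omega> powr (- (crit_exp DIM('a) / 2))
      * t powr (crit_exp DIM('a) / 2 - 1) \<longleftrightarrow> t = t0"
    "\<And>t. t > 0 \<Longrightarrow> h t \<le> sobolev_const \<Omega> powr (- (crit_exp DIM('a) / 2))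
      * t powr (crit_exp DIM('a) / 2 - 1) \<longleftrightarrow> t0 \<le> t"
    by (rule ratio_crossing[OF h_cont anti l l0]) (rule that)
  have I: "I_set \<Omega> h = {t0..}"
    unfolding I_set_def using t0(1,3) by force
  have "K_fun DIM('a) h t0 \<le> K_fun DIM('a) h t" if "t0 \<le> t" for t
  proof -
    have "K_fun DIM('a) h t0 + K_fun DIM('a) h (t - t0) \<le> K_fun DIM('a) h (t0 + (t - t0))" using A2[rule_format, of t0 "t - t0"] t0(1) that by simp
    then show ?thesis using K_nonneg[of "t - t0"] that by simp
  qed
  then have c: "c_star \<Omega> h = K_fun DIM('a) h t0"
    unfolding c_star_def I by (intro cInf_eq_minimum) auto
  have "0 < (\<Sum>i=1..n. \<alpha> i * t0 powr \<gamma> i)"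
    using A1_alpha A1_mu(2) t0(1) by (intro sum_pos) auto
  also have "\<dots> \<le> K_fun DIM('a) h t0" using A1_K t0(1) by simp
  finally show ?thesis using c t0(1,2) by auto
qed

section \<open>Growth bounds and the derivative of J\<close>

lemma f_cont: "AE x in M. continuous_on UNIV (f x)"
  using f_car by (simp add: caratheodory_def)

lemma F_growth: "AE x in M. \<forall>t. \<bar>primitive (f x) t\<bar> \<le> c1 * \<bar>t\<bar> powr p + c2 * \<bar>t\<bar>"
  using f_growth f_cont
proof eventually_elim
  case (elim x)
  show ?case
  proof
    fix t
    have "\<bar>primitive (f x) (0 + t) - primitive (f x) 0\<bar> \<le> (c1 * \<bar>t\<bar> powr (p - 1) + c2) * \<bar>t\<bar>"
    proof (rule real_increment_bound[OF primitive_has_derivative[OF elim(2)]])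
      fix s :: real assume "\<bar>s\<bar> \<le> \<bar>0\<bar> + \<bar>t\<bar>"
      then have "c1 * \<bar>s\<bar> powr (p - 1) + c2 \<le> c1 * \<bar>t\<bar> powr (p - 1) + c2"
        using growth_const by (intro add_right_mono mult_left_mono powr_mono2) auto
      then show "\<bar>f x s\<bar> \<le> c1 * \<bar>t\<bar> powr (p - 1) + c2" using elim(1) order_trans by blast
    qed
    moreover have "\<bar>t\<bar> powr (p - 1) * \<bar>t\<bar> = \<bar>t\<bar> powr p" by (cases "t = 0") (auto simp: powr_diff)
    ultimately show "\<bar>primitive (f x) t\<bar> \<le> c1 * \<bar>t\<bar> powr p + c2 * \<bar>t\<bar>"
      by (simp add: primitive_0 distrib_right mult.assoc)
  qed
qed

text \<open>The subcritical bound is weakened to the critical exponent so that integrability of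
  |u|^q serves for the differentiation of every integral term.\<close>

lemma f_growth_crit: "AE x in M. \<forall>t. \<bar>f x t\<bar> \<le> (c1 + c2) * (1 + \<bar>t\<bar> powr (crit_exp DIM('a) - 1))"
  using f_growth
proof eventually_elim
  case (elim x)
  show ?case
  proof
    fix t
    have "\<bar>t\<bar> powr (p - 1) \<le> 1 + \<bar>t\<bar> powr (crit_exp DIM('a) - 1)"
      using powr_interpolation[of "\<bar>t\<bar>" 1 "p - 1" "crit_exp DIM('a) - 1"] growth_const by simp
    then have "c1 * \<bar>t\<bar> powr (p - 1) \<le> c1 * (1 + \<bar>t\<bar> powr (crit_exp DIM('a) - 1))"
      using growth_const by (intro mult_left_mono) auto
    moreover have "c2 \<le> c2 * (1 + \<bar>t\<bar> powr (crit_exp DIM('a) - 1))" using growth_const by simp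
    ultimately show "\<bar>f x t\<bar> \<le> (c1 + c2) * (1 + \<bar>t\<bar> powr (crit_exp DIM('a) - 1))"
      unfolding distrib_right[of c1 c2] using elim[rule_format, of t] by linarith
  qed
qed

text \<open>The candidate for J'(u)v. The critical term |u|^(q-2) u v is written in the form in
  which \<open>abs_powr_has_derivative\<close> produces it.\<close>

definition dJ :: "('a \<Rightarrow> real) \<Rightarrow> ('a \<Rightarrow> real) \<Rightarrow> real" where
  "dJ u v = h (dirichlet \<Omega> u) * ip u v - (LINT x|M. f x (u x) * v x)
    - (LINT x|M. sgn (u x) * \<bar>u x\<bar> powr (crit_exp DIM('a) - 1) * v x)"

lemma F_Gateaux:
  assumes u: "u \<in> H10 \<Omega>" and v: "v \<in> H10 \<Omega>"
  shows "integrable M (\<lambda>x. primitive (f x) (u x))" "integrable M (\<lambda>x. f x (u x) * v x)"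
    "(\<lambda>k. ((LINT x|M. primitive (f x) (u x + 1 / real (Suc k) * v x)) - (LINT x|M. primitive (f x) (u x))) / (1 / real (Suc k)))
      \<longlonglongrightarrow> (LINT x|M. f x (u x) * v x)"
proof -
  have d: "AE x in M. \<forall>t. (primitive (f x) has_real_derivative f x t) (at t)"
    using f_cont by eventually_elim (blast intro: primitive_has_derivative)
  have q: "crit_exp DIM('a) > 1" using crit_exp_gt by simp
  have c: "c1 + c2 \<ge> 0" using growth_const by simp
  note G = integral_Gateaux[OF q c d f_growth_crit primitive_0 caratheodory_measurable(2)[OF f_car]
      H10_measurable[OF u] H10_Lq[OF u] H10_measurable[OF v] H10_Lq[OF v] caratheodory_measurable(1)[OF f_car H10_measurable[OF u]]]
  show "integrable M (\<lambda>x. primitive (f x) (u x))" "integrable M (\<lambda>x. f x (u x) * v x)"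
    "(\<lambda>k. ((LINT x|M. primitive (f x) (u x + 1 / real (Suc k) * v x)) - (LINT x|M. primitive (f x) (u x))) / (1 / real (Suc k)))
      \<longlonglongrightarrow> (LINT x|M. f x (u x) * v x)"
    by (rule G(1), assumption) (rule G(2), assumption, rule G(3))
qed

lemma crit_Gateaux:
  assumes u: "u \<in> H10 \<Omega>" and v: "v \<in> H10 \<Omega>"
  defines "q \<equiv> crit_exp DIM('a)"
  shows "integrable M (\<lambda>x. sgn (u x) * \<bar>u x\<bar> powr (q - 1) * v x)"
    "(\<lambda>k. ((LINT x|M. \<bar>u x + 1 / real (Suc k) * v x\<bar> powr q) - (LINT x|M. \<bar>u x\<bar> powr q)) / (1 / real (Suc k)))
      \<longlonglongrightarrow> q * (LINT x|M. sgn (u x) * \<bar>u x\<bar> powr (q - 1) * v x)"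
proof -
  have q: "q > 1" using crit_exp_gt by (simp add: q_def)
  note [measurable] = H10_measurable[OF u]
  have d: "AE x in M. \<forall>t. ((\<lambda>t. \<bar>t\<bar> powr q) has_real_derivative q * (sgn t * \<bar>t\<bar> powr (q - 1))) (at t)"
    by (intro AE_I2 allI abs_powr_has_derivative q)
  have g: "AE x in M. \<forall>t. \<bar>q * (sgn t * \<bar>t\<bar> powr (q - 1))\<bar> \<le> q * (1 + \<bar>t\<bar> powr (q - 1))"
    using q by (intro AE_I2 allI) (auto simp: abs_mult sgn_real_def)
  have m: "(\<lambda>x. \<bar>w x\<bar> powr q) \<in> borel_measurable M" if [measurable]: "w \<in> borel_measurable M" for w :: "'a \<Rightarrow> real"
    by measurable
  have m': "(\<lambda>x. q * (sgn (u x) * \<bar>u x\<bar> powr (q - 1))) \<in> borel_measurable M" by measurable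
  have q0: "q \<ge> 0" and z: "\<bar>0\<bar> powr q = (0::real)" using q by simp_all
  note G = integral_Gateaux[where G = "\<lambda>x t. \<bar>t\<bar> powr q" and g = "\<lambda>x t. q * (sgn t * \<bar>t\<bar> powr (q - 1))",
      OF q q0 d g z m H10_measurable[OF u] H10_Lq[OF u, folded q_def] H10_measurable[OF v] H10_Lq[OF v, folded q_def] m']
  have eq: "q * (sgn (u x) * \<bar>u x\<bar> powr (q - 1)) * v x = q * (sgn (u x) * \<bar>u x\<bar> powr (q - 1) * v x)" for x by simp
  show "integrable M (\<lambda>x. sgn (u x) * \<bar>u x\<bar> powr (q - 1) * v x)"
  proof -
    have "integrable M (\<lambda>x. q * (sgn (u x) * \<bar>u x\<bar> powr (q - 1)) * v x)" by (rule G(2))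
    then have "integrable M (\<lambda>x. q * (sgn (u x) * \<bar>u x\<bar> powr (q - 1) * v x))" unfolding eq .
    from integrable_mult_right[OF this, of "1 / q"] show ?thesis using q by simp
  qed
  show "(\<lambda>k. ((LINT x|M. \<bar>u x + 1 / real (Suc k) * v x\<bar> powr q) - (LINT x|M. \<bar>u x\<bar> powr q)) / (1 / real (Suc k)))
      \<longlonglongrightarrow> q * (LINT x|M. sgn (u x) * \<bar>u x\<bar> powr (q - 1) * v x)"
  proof -
    have "(\<lambda>k. ((LINT x|M. \<bar>u x + 1 / real (Suc k) * v x\<bar> powr q) - (LINT x|M. \<bar>u x\<bar> powr q)) / (1 / real (Suc k)))
      \<longlonglongrightarrow> (LINT x|M. q * (sgn (u x) * \<bar>u x\<bar> powr (q - 1)) * v x)" by (rule G(3))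
    then show ?thesis unfolding eq integral_mult_right_zero .
  qed
qed

text \<open>Along the line u + t v the energy is a quadratic polynomial in t with values in [0,
  infinity), so the chain rule applies with the derivative of the primitive relative to that
  half-line, even when the energy of u is 0.\<close>

lemma H_Gateaux:
  assumes u: "u \<in> H10 \<Omega>" and v: "v \<in> H10 \<Omega>"
  shows "(\<lambda>k. (primitive h (dirichlet \<Omega> (\<lambda>x. u x + 1 / real (Suc k) * v x)) - primitive h (dirichlet \<Omega> u)) / (1 / real (Suc k)))
    \<longlonglongrightarrow> 2 * (h (dirichlet \<Omega> u) * ip u v)"
proof -
  define P where "P t = dirichlet \<Omega> u + 2 * t * ip u v + t\<^sup>2 * dirichlet \<Omega> v" for t
  have P: "P t = dirichlet \<Omega> (\<lambda>x. u x + t * v x)" for t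
    unfolding P_def using dirichlet_add_scale[OF u v] by simp
  have P0: "P 0 = dirichlet \<Omega> u" by (simp add: P_def)
  have "P ` UNIV \<subseteq> {0..}" using P H10_dirichlet_nonneg by auto
  then have "(primitive h has_real_derivative h (P 0)) (at (P 0) within P ` UNIV)"
    using primitive_has_derivative_within[OF h_cont H10_dirichlet_nonneg[of u]]
    unfolding P0 by (rule DERIV_subset[rotated])
  moreover have "(P has_real_derivative 2 * ip u v) (at 0 within UNIV)"
    unfolding P_def by (auto intro!: derivative_eq_intros)
  ultimately have "(primitive h \<circ> P has_real_derivative h (P 0) * (2 * ip u v)) (at 0)"
    by (rule DERIV_image_chain)
  then have "(\<lambda>t. (primitive h (P (0 + t)) - primitive h (P 0)) / t) \<midarrow>0\<rightarrow> h (P 0) * (2 * ip u v)"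
    unfolding DERIV_def o_def .
  moreover have "filterlim (\<lambda>n. 1 / real (Suc n)) (at 0) sequentially"
    using LIMSEQ_Suc[OF lim_1_over_n] by (auto simp: filterlim_at)
  ultimately have "(\<lambda>k. (primitive h (P (0 + 1 / real (Suc k))) - primitive h (P 0)) / (1 / real (Suc k))) \<longlonglongrightarrow> h (P 0) * (2 * ip u v)"
    by (rule filterlim_compose)
  then show ?thesis unfolding P0 by (simp add: P mult_ac)
qed

lemma J_Gateaux:
  assumes u: "u \<in> H10 \<Omega>" and v: "v \<in> H10 \<Omega>"
  shows "(\<lambda>k. (J (\<lambda>x. u x + 1 / real (Suc k) * v x) - J u) / (1 / real (Suc k))) \<longlonglongrightarrow> dJ u v"
proof -
  let ?q = "crit_exp DIM('a)"
  let ?e = "\<lambda>k. 1 / real (Suc k)"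
  let ?h = "\<lambda>k. (primitive h (dirichlet \<Omega> (\<lambda>x. u x + ?e k * v x)) - primitive h (dirichlet \<Omega> u)) / ?e k"
  let ?F = "\<lambda>k. ((LINT x|M. primitive (f x) (u x + ?e k * v x)) - (LINT x|M. primitive (f x) (u x))) / ?e k"
  let ?C = "\<lambda>k. ((LINT x|M. \<bar>u x + ?e k * v x\<bar> powr ?q) - (LINT x|M. \<bar>u x\<bar> powr ?q)) / ?e k"
  have "(\<lambda>k. 1/2 * ?h k - ?F k - 1 / ?q * ?C k) \<longlonglongrightarrow> 1/2 * (2 * (h (dirichlet \<Omega> u) * ip u v))
      - (LINT x|M. f x (u x) * v x) - 1 / ?q * (?q * (LINT x|M. sgn (u x) * \<bar>u x\<bar> powr (?q - 1) * v x))"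
    by (intro tendsto_intros H_Gateaux F_Gateaux crit_Gateaux u v)
  moreover have "1/2 * (2 * (h (dirichlet \<Omega> u) * ip u v))
      - (LINT x|M. f x (u x) * v x) - 1 / ?q * (?q * (LINT x|M. sgn (u x) * \<bar>u x\<bar> powr (?q - 1) * v x)) = dJ u v"
    using crit_exp_gt by (simp add: dJ_def)
  moreover have "(J (\<lambda>x. u x + ?e k * v x) - J u) / ?e k = 1/2 * ?h k - ?F k - 1 / ?q * ?C k" for k
  proof -
    have alg: "(1/2 * a1 - a2 - c * a3 - (1/2 * b1 - b2 - c * b3)) / e = 1/2 * ((a1 - b1) / e) - (a2 - b2) / e - c * ((a3 - b3) / e)"
      for a1 a2 a3 b1 b2 b3 c e :: real
      by (simp add: diff_divide_distrib right_diff_distrib)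
    show ?thesis unfolding J_fun_def by (rule alg)
  qed
  ultimately show ?thesis by simp
qed

lemma H10_norm_scale: "v \<in> H10 \<Omega> \<Longrightarrow> H10_norm \<Omega> (\<lambda>x. a * v x) = \<bar>a\<bar> * H10_norm \<Omega> v"
  unfolding H10_norm_def by (simp add: dirichlet_scale real_sqrt_mult)

lemma H10_norm_nonneg: "H10_norm \<Omega> v \<ge> 0"
  by (simp add: H10_norm_def H10_dirichlet_nonneg)

text \<open>Any derivative L of J at u gives the limit of the difference quotients in direction v,
  and this limit is \<open>dJ u v\<close>. Palais-Smale sequences thus come with an explicit formula
  for their derivatives.\<close>

lemma derivative_eq_dJ:
  assumes L: "H10_has_derivative \<Omega> J L u" and u: "u \<in> H10 \<Omega>" and v: "v \<in> H10 \<Omega>"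
  shows "L v = dJ u v"
proof (rule LIMSEQ_unique[OF _ J_Gateaux[OF u v]], rule LIMSEQ_I)
  let ?e = "\<lambda>k. 1 / real (Suc k)"
  fix e :: real assume e: "e > 0"
  have L_scale: "L (\<lambda>x. a * v x) = a * L v" for a
    using L v unfolding H10_has_derivative_def H10_dual_def by blast
  \<comment> \<open>Chosen so that \<epsilon> times the norm of v is below e; the added 1 covers
    norm 0.\<close>
  define \<epsilon> where "\<epsilon> = e / (2 * (H10_norm \<Omega> v + 1))"
  have N1: "H10_norm \<Omega> v + 1 > 0" using H10_norm_nonneg[of v] by linarith
  have \<epsilon>: "\<epsilon> > 0" using e N1 by (simp add: \<epsilon>_def)
  have "\<epsilon> * (H10_norm \<Omega> v + 1) = e / 2" using N1 by (simp add: \<epsilon>_def field_simps)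
  then have \<epsilon>': "\<epsilon> * H10_norm \<Omega> v < e" using \<epsilon> e by (simp add: distrib_left)
  obtain \<delta> where \<delta>: "\<delta> > 0" "\<And>w. w \<in> H10 \<Omega> \<Longrightarrow> H10_norm \<Omega> w < \<delta> \<Longrightarrow> \<bar>J (\<lambda>x. u x + w x) - J u - L w\<bar> \<le> \<epsilon> * H10_norm \<Omega> w"
    using L \<epsilon> unfolding H10_has_derivative_def by blast
  have "(\<lambda>k. ?e k * H10_norm \<Omega> v) \<longlonglongrightarrow> 0 * H10_norm \<Omega> v"
    using LIMSEQ_Suc[OF lim_1_over_n] by (intro tendsto_intros) auto
  then have "\<forall>\<^sub>F k in sequentially. ?e k * H10_norm \<Omega> v < \<delta>"
    using \<delta>(1) by (intro order_tendstoD(2)) auto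
  then obtain N where N: "\<And>k. k \<ge> N \<Longrightarrow> ?e k * H10_norm \<Omega> v < \<delta>" by (auto simp: eventually_sequentially)
  have "norm ((J (\<lambda>x. u x + ?e k * v x) - J u) / ?e k - L v) < e" if "k \<ge> N" for k
  proof -
    have ek: "?e k > 0" by simp
    have "\<bar>J (\<lambda>x. u x + ?e k * v x) - J u - L (\<lambda>x. ?e k * v x)\<bar> \<le> \<epsilon> * H10_norm \<Omega> (\<lambda>x. ?e k * v x)"
      using N[OF that] by (intro \<delta>(2) H10_scale v) (unfold H10_norm_scale[OF v], simp)
    then have "\<bar>J (\<lambda>x. u x + ?e k * v x) - J u - ?e k * L v\<bar> \<le> \<epsilon> * (?e k * H10_norm \<Omega> v)"
      unfolding L_scale H10_norm_scale[OF v] by simp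
    then have "\<bar>J (\<lambda>x. u x + ?e k * v x) - J u - ?e k * L v\<bar> / ?e k \<le> \<epsilon> * (?e k * H10_norm \<Omega> v) / ?e k"
      using ek by (intro divide_right_mono) auto
    also have "\<dots> = \<epsilon> * H10_norm \<Omega> v" using ek by simp
    finally have "\<bar>(J (\<lambda>x. u x + ?e k * v x) - J u - ?e k * L v) / ?e k\<bar> \<le> \<epsilon> * H10_norm \<Omega> v"
      by (simp only: abs_divide abs_of_pos[OF ek])
    moreover have "(J (\<lambda>x. u x + ?e k * v x) - J u - ?e k * L v) / ?e k = (J (\<lambda>x. u x + ?e k * v x) - J u) / ?e k - L v"
      by (simp only: diff_divide_distrib nonzero_mult_div_cancel_left[OF less_imp_neq[OF ek, symmetric]])
    ultimately show ?thesis using \<epsilon>' by simp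
  qed
  then show "\<exists>N. \<forall>k\<ge>N. norm ((J (\<lambda>x. u x + ?e k * v x) - J u) / ?e k - L v) < e" by blast
qed

text \<open>Normalise v. The supremum is a genuine bound because the functional is bounded, and that
  boundedness also forces L v = 0 when v has norm 0.\<close>

lemma dual_norm_bound:
  assumes L: "H10_dual \<Omega> L" and v: "v \<in> H10 \<Omega>"
  shows "\<bar>L v\<bar> \<le> H10_dual_norm \<Omega> L * H10_norm \<Omega> v"
proof -
  obtain C where C: "\<And>v. v \<in> H10 \<Omega> \<Longrightarrow> \<bar>L v\<bar> \<le> C * H10_norm \<Omega> v" using L unfolding H10_dual_def by blast
  show ?thesis
  proof (cases "H10_norm \<Omega> v = 0")
    case True
    then show ?thesis using C[OF v] by simp
  next
    case False
    then have pos: "H10_norm \<Omega> v > 0" using H10_norm_nonneg[of v] by simp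
    define w where "w x = (1 / H10_norm \<Omega> v) * v x" for x
    have w: "w \<in> H10 \<Omega>" "H10_norm \<Omega> w = 1"
    proof -
      show "w \<in> H10 \<Omega>" unfolding w_def by (rule H10_scale[OF v])
      show "H10_norm \<Omega> w = 1" unfolding w_def H10_norm_scale[OF v] using pos by simp
    qed
    have bdd: "bdd_above ((\<lambda>v. \<bar>L v\<bar>) ` {v \<in> H10 \<Omega>. H10_norm \<Omega> v \<le> 1})"
    proof (rule bdd_aboveI2[where M = "\<bar>C\<bar>"])
      fix y assume y: "y \<in> {v \<in> H10 \<Omega>. H10_norm \<Omega> v \<le> 1}"
      then have "\<bar>L y\<bar> \<le> C * H10_norm \<Omega> y" using C by blast
      also have "\<dots> \<le> \<bar>C\<bar> * H10_norm \<Omega> y" by (intro mult_right_mono H10_norm_nonneg) simp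
      also have "\<dots> \<le> \<bar>C\<bar> * 1" using y by (intro mult_left_mono) auto
      finally show "\<bar>L y\<bar> \<le> \<bar>C\<bar>" by simp
    qed
    have "\<bar>L w\<bar> \<le> H10_dual_norm \<Omega> L"
      unfolding H10_dual_norm_def using w by (intro cSUP_upper[OF _ bdd]) auto
    moreover have "L w = (1 / H10_norm \<Omega> v) * L v"
      unfolding w_def using L v unfolding H10_dual_def by blast
    ultimately show ?thesis using pos by (simp add: abs_mult field_simps)
  qed
qed

text \<open>The critical integrals cancel because sgn t |t|^(q-1) t = |t|^q, and the two terms with
  h combine to K.\<close>

lemma energy_identity:
  assumes u: "u \<in> H10 \<Omega>"
  shows "J u - 1 / crit_exp DIM('a) * dJ u u = K_fun DIM('a) h (dirichlet \<Omega> u)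
    - (LINT x|M. primitive (f x) (u x) - 1 / crit_exp DIM('a) * (u x * f x (u x)))"
proof -
  let ?q = "crit_exp DIM('a)"
  have "sgn (u x) * \<bar>u x\<bar> powr (?q - 1) * u x = \<bar>u x\<bar> powr ?q" for x
    by (cases "u x = 0") (auto simp: powr_diff sgn_real_def)
  then have crit: "(LINT x|M. sgn (u x) * \<bar>u x\<bar> powr (?q - 1) * u x) = (LINT x|M. \<bar>u x\<bar> powr ?q)" by simp
  have "(LINT x|M. primitive (f x) (u x) - 1 / ?q * (u x * f x (u x)))
      = (LINT x|M. primitive (f x) (u x)) - 1 / ?q * (LINT x|M. f x (u x) * u x)"
    using F_Gateaux(1,2)[OF u u] by (simp add: mult.commute)
  then show ?thesis
    unfolding J_fun_def dJ_def K_fun_def crit ip_self by (simp add: algebra_simps)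
qed

section \<open>Lower bounds for the energy from (A1)\<close>

lemma nonlinear_part_le:
  assumes u: "u \<in> H10 \<Omega>"
  shows "(LINT x|M. primitive (f x) (u x) - 1 / crit_exp DIM('a) * (u x * f x (u x)))
    \<le> (\<Sum>i=1..n. \<alpha> i * (\<mu> i * (LINT x|M. \<bar>u x\<bar> powr (2 * \<gamma> i))))"
proof -
  let ?q = "crit_exp DIM('a)"
  note [measurable] = H10_measurable[OF u]
  have int: "integrable M (\<lambda>x. \<bar>u x\<bar> powr (2 * \<gamma> i))" if "i \<in> {1..n}" for i
  proof (rule Bochner_Integration.integrable_bound)
    show "integrable M (\<lambda>x. 1 + \<bar>u x\<bar> powr ?q)" using H10_Lq[OF u] by simp
    have "0 \<le> 2 * \<gamma> i" "2 * \<gamma> i \<le> ?q" using bspec[OF A1_gamma that] by linarith+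
    then show "AE x in M. norm (\<bar>u x\<bar> powr (2 * \<gamma> i)) \<le> norm (1 + \<bar>u x\<bar> powr ?q)"
      using powr_interpolation[where T = 1 and p = "2 * \<gamma> i" and q = ?q, OF abs_ge_zero] by (intro AE_I2) (simp add: add.commute)
  qed measurable
  have "(LINT x|M. primitive (f x) (u x) - 1 / ?q * (u x * f x (u x)))
      \<le> (LINT x|M. (\<Sum>i=1..n. \<mu> i * \<alpha> i * \<bar>u x\<bar> powr (2 * \<gamma> i)))"
  proof (rule integral_mono_AE)
    show "integrable M (\<lambda>x. primitive (f x) (u x) - 1 / ?q * (u x * f x (u x)))"
      using F_Gateaux(1,2)[OF u u] by (simp add: mult.commute)
    show "integrable M (\<lambda>x. \<Sum>i=1..n. \<mu> i * \<alpha> i * \<bar>u x\<bar> powr (2 * \<gamma> i))"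
      by (intro Bochner_Integration.integrable_sum integrable_mult_right int)
    show "AE x in M. primitive (f x) (u x) - 1 / ?q * (u x * f x (u x)) \<le> (\<Sum>i=1..n. \<mu> i * \<alpha> i * \<bar>u x\<bar> powr (2 * \<gamma> i))"
      using A1_F by eventually_elim blast
  qed
  also have "\<dots> = (\<Sum>i=1..n. (LINT x|M. \<mu> i * \<alpha> i * \<bar>u x\<bar> powr (2 * \<gamma> i)))"
    by (intro Bochner_Integration.integral_sum integrable_mult_right int)
  also have "\<dots> = (\<Sum>i=1..n. \<alpha> i * (\<mu> i * (LINT x|M. \<bar>u x\<bar> powr (2 * \<gamma> i))))"
    by (intro sum.cong refl) simp
  finally show ?thesis .
qed

lemma mu_bound:
  assumes u: "u \<in> H10 \<Omega>" and i: "i \<in> {1..n}"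
  shows "\<mu> i * (LINT x|M. \<bar>u x\<bar> powr (2 * \<gamma> i)) \<le> dirichlet \<Omega> u powr \<gamma> i"
proof -
  have "\<mu> i * (LINT x|M. \<bar>u x\<bar> powr (2 * \<gamma> i)) \<le> lambda1 \<Omega> (\<gamma> i) * (LINT x|M. \<bar>u x\<bar> powr (2 * \<gamma> i))"
    using A1_mu(1) i by (intro mult_right_mono) auto
  also have "\<dots> \<le> dirichlet \<Omega> u powr \<gamma> i" by (rule lambda1_bound[OF u])
  finally show ?thesis .
qed

text \<open>Applied to the weak limit v, this makes its share of the energy nonnegative.\<close>

lemma energy_nonneg:
  assumes u: "u \<in> H10 \<Omega>"
  shows "(LINT x|M. primitive (f x) (u x) - 1 / crit_exp DIM('a) * (u x * f x (u x))) \<le> K_fun DIM('a) h (dirichlet \<Omega> u)"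
proof -
  have "(LINT x|M. primitive (f x) (u x) - 1 / crit_exp DIM('a) * (u x * f x (u x)))
      \<le> (\<Sum>i=1..n. \<alpha> i * (\<mu> i * (LINT x|M. \<bar>u x\<bar> powr (2 * \<gamma> i))))"
    by (rule nonlinear_part_le[OF u])
  also have "\<dots> \<le> (\<Sum>i=1..n. \<alpha> i * dirichlet \<Omega> u powr \<gamma> i)"
    by (intro sum_mono mult_left_mono mu_bound u) (auto simp: alpha_nonneg)
  also have "\<dots> \<le> K_fun DIM('a) h (dirichlet \<Omega> u)" using A1_K H10_dirichlet_nonneg by blast
  finally show ?thesis .
qed

text \<open>All summands of the difference between the two bounds from (A1) are nonnegative, and the
  one with the strict inequality retains a fixed fraction \<theta> of its power of the
  energy.\<close>

lemma energy_coercive: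
  obtains \<delta> i where "\<delta> > 0" "\<gamma> i \<ge> 1"
    "\<And>u. u \<in> H10 \<Omega> \<Longrightarrow> \<delta> * dirichlet \<Omega> u powr \<gamma> i
      \<le> K_fun DIM('a) h (dirichlet \<Omega> u) - (LINT x|M. primitive (f x) (u x) - 1 / crit_exp DIM('a) * (u x * f x (u x)))"
proof -
  obtain i where i: "i \<in> {1..n}" "\<mu> i < lambda1 \<Omega> (\<gamma> i)" using A1_mu(2) by blast
  \<comment> \<open>For \<mu> i <= 0 the nonlinear summand is not positive and the whole power
    remains; otherwise \<open>lambda1\<close> exceeds \<mu> i > 0 and division by it is
    safe.\<close>
  define \<theta> where "\<theta> = (if \<mu> i \<le> 0 then 1 else 1 - \<mu> i / lambda1 \<Omega> (\<gamma> i))"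
  have \<theta>: "\<theta> > 0" using i(2) by (auto simp: \<theta>_def field_simps)
  have gap: "\<mu> i * (LINT x|M. \<bar>u x\<bar> powr (2 * \<gamma> i)) \<le> dirichlet \<Omega> u powr \<gamma> i - \<theta> * dirichlet \<Omega> u powr \<gamma> i"
    if u: "u \<in> H10 \<Omega>" for u
  proof (cases "\<mu> i \<le> 0")
    case True
    have "0 \<le> (LINT x|M. \<bar>u x\<bar> powr (2 * \<gamma> i))" by simp
    then show ?thesis using True by (simp add: \<theta>_def mult_nonpos_nonneg)
  next
    case False
    then have l: "lambda1 \<Omega> (\<gamma> i) > 0" using i(2) by linarith
    have "(LINT x|M. \<bar>u x\<bar> powr (2 * \<gamma> i)) \<le> dirichlet \<Omega> u powr \<gamma> i / lambda1 \<Omega> (\<gamma> i)"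
      using lambda1_bound[OF u, of "\<gamma> i"] l by (simp add: pos_le_divide_eq mult.commute)
    then have "\<mu> i * (LINT x|M. \<bar>u x\<bar> powr (2 * \<gamma> i)) \<le> \<mu> i * (dirichlet \<Omega> u powr \<gamma> i / lambda1 \<Omega> (\<gamma> i))"
      using False by (intro mult_left_mono) auto
    then show ?thesis using False by (simp add: \<theta>_def algebra_simps)
  qed
  have "\<alpha> i * \<theta> * dirichlet \<Omega> u powr \<gamma> i
      \<le> K_fun DIM('a) h (dirichlet \<Omega> u) - (LINT x|M. primitive (f x) (u x) - 1 / crit_exp DIM('a) * (u x * f x (u x)))"
    if u: "u \<in> H10 \<Omega>" for u
  proof -
    let ?d = "\<lambda>j. dirichlet \<Omega> u powr \<gamma> j" and ?m = "\<lambda>j. \<mu> j * (LINT x|M. \<bar>u x\<bar> powr (2 * \<gamma> j))"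
    have "\<alpha> i * \<theta> * ?d i \<le> \<alpha> i * (?d i - ?m i)"
      unfolding mult.assoc using gap[OF u] alpha_nonneg i(1) by (intro mult_left_mono) auto
    also have "\<dots> \<le> (\<Sum>j=1..n. \<alpha> j * (?d j - ?m j))"
      using alpha_nonneg mu_bound[OF u] i(1) by (intro member_le_sum mult_nonneg_nonneg) auto
    also have "\<dots> = (\<Sum>j=1..n. \<alpha> j * ?d j) - (\<Sum>j=1..n. \<alpha> j * ?m j)"
      by (simp add: right_diff_distrib sum_subtractf)
    also have "\<dots> \<le> K_fun DIM('a) h (dirichlet \<Omega> u) - (LINT x|M. primitive (f x) (u x) - 1 / crit_exp DIM('a) * (u x * f x (u x)))"
      using A1_K H10_dirichlet_nonneg[of u] nonlinear_part_le[OF u] by (intro diff_mono) auto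
    finally show ?thesis .
  qed
  moreover have "\<alpha> i * \<theta> > 0" using \<theta> A1_alpha i(1) by simp
  moreover have "\<gamma> i \<ge> 1" using A1_gamma i(1) by blast
  ultimately show thesis using that by blast
qed

text \<open>If the norm N is at least 1, then \<gamma> i >= 1 gives \<delta> N^2 <= B1 + |B2| N <=
  (B1 + |B2|) N, which bounds N. The term linear in N reflects that only the dual norm of the
  derivative is controlled.\<close>

lemma PS_bounded:
  assumes u: "\<And>j. u j \<in> H10 \<Omega>" and J: "\<And>j. \<bar>J (u j)\<bar> \<le> B1"
    and dJ: "\<And>j. \<bar>dJ (u j) (u j)\<bar> \<le> B2 * H10_norm \<Omega> (u j)"
  obtains B where "\<And>j. dirichlet \<Omega> (u j) \<le> B"
proof -
  obtain \<delta> i where \<delta>: "\<delta> > 0" "\<gamma> i \<ge> 1"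
    "\<And>u. u \<in> H10 \<Omega> \<Longrightarrow> \<delta> * dirichlet \<Omega> u powr \<gamma> i
      \<le> K_fun DIM('a) h (dirichlet \<Omega> u) - (LINT x|M. primitive (f x) (u x) - 1 / crit_exp DIM('a) * (u x * f x (u x)))"
    by (rule energy_coercive) (rule that)
  have q: "crit_exp DIM('a) > 1" using crit_exp_gt by simp
  have "dirichlet \<Omega> (u j) \<le> max 1 (((B1 + \<bar>B2\<bar>) / \<delta>)\<^sup>2)" for j
  proof (cases "dirichlet \<Omega> (u j) \<le> 1")
    case False
    define N where "N = H10_norm \<Omega> (u j)"
    have N2: "N\<^sup>2 = dirichlet \<Omega> (u j)" by (simp add: N_def H10_norm_sq)
    have N1: "N \<ge> 1" using False N2 H10_norm_nonneg[of "u j"] power_le_one[of N 2] unfolding N_def by force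
    have "\<delta> * N\<^sup>2 \<le> \<delta> * dirichlet \<Omega> (u j) powr \<gamma> i"
      unfolding N2 using False \<delta>(1,2) powr_mono[of 1 "\<gamma> i" "dirichlet \<Omega> (u j)"] by (intro mult_left_mono) auto
    also have "\<dots> \<le> J (u j) - 1 / crit_exp DIM('a) * dJ (u j) (u j)"
      unfolding energy_identity[OF u] by (rule \<delta>(3)[OF u])
    also have "\<dots> \<le> B1 + \<bar>B2\<bar> * N"
    proof -
      have "\<bar>1 / crit_exp DIM('a) * dJ (u j) (u j)\<bar> \<le> \<bar>dJ (u j) (u j)\<bar>"
        unfolding abs_mult using q by (intro mult_left_le_one_le) auto
      also have "\<dots> \<le> B2 * N" using dJ by (simp add: N_def)
      also have "\<dots> \<le> \<bar>B2\<bar> * N" using N1 by (intro mult_right_mono) auto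
      finally show ?thesis using J[of j] by linarith
    qed
    also have "\<dots> \<le> (B1 + \<bar>B2\<bar>) * N"
    proof -
      have "B1 \<ge> 0" using J[of j] by linarith
      then have "B1 * 1 \<le> B1 * N" using N1 by (intro mult_left_mono) auto
      then show ?thesis by (simp add: distrib_right)
    qed
    finally have "\<delta> * N \<le> B1 + \<bar>B2\<bar>" using N1 by (simp add: power2_eq_square)
    then have "N \<le> (B1 + \<bar>B2\<bar>) / \<delta>" using \<delta>(1) by (simp add: pos_le_divide_eq mult.commute)
    then have "N\<^sup>2 \<le> ((B1 + \<bar>B2\<bar>) / \<delta>)\<^sup>2" using N1 by (intro power_mono) auto
    then show ?thesis using N2 by simp
  qed simp
  then show thesis using that by blast
qed

end

section \<open>Passage to the limit and compactness\<close>

context kirchhoff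
begin

text \<open>\<open>almost_dominated_convergence\<close> with the critical powers of the sequence as
  the L^1-bounded part; their integrals are bounded by the Sobolev inequality and the energy bound.
  The subcritical, pairing and Brezis-Lieb limits differ in how they verify
  \<open>dom\<close>.\<close>

lemma superposition_tendsto:
  fixes g :: "'a \<Rightarrow> real \<Rightarrow> real"
  assumes U: "\<And>k. U k \<in> H10 \<Omega>" "\<And>k. dirichlet \<Omega> (U k) \<le> B" and v: "v \<in> H10 \<Omega>"
    and lim: "AE x in M. (\<lambda>k. U k x) \<longlonglongrightarrow> v x"
    and cont: "AE x in M. continuous_on UNIV (g x)"
    and meas: "\<And>w. w \<in> borel_measurable M \<Longrightarrow> (\<lambda>x. g x (w x)) \<in> borel_measurable M"
    and dom: "\<And>\<epsilon>. \<epsilon> > 0 \<Longrightarrow> \<exists>G. integrable M G \<and>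
      (AE x in M. \<forall>t. \<bar>g x t\<bar> \<le> \<epsilon> * \<bar>t\<bar> powr crit_exp DIM('a) + G x)"
  shows "(\<lambda>k. LINT x|M. g x (U k x)) \<longlonglongrightarrow> (LINT x|M. g x (v x))"
proof -
  let ?q = "crit_exp DIM('a)"
  obtain C where C: "C > 0" "\<And>u. u \<in> H10 \<Omega> \<Longrightarrow> (LINT x|M. \<bar>u x\<bar> powr ?q) \<le> C * dirichlet \<Omega> u powr (?q / 2)"
    using Sobolev_H10 by metis
  show ?thesis
  proof (rule almost_dominated_convergence(3)[where a = "\<lambda>k x. \<bar>U k x\<bar> powr ?q" and B = "C * B powr (?q / 2)"])
    show "(\<lambda>x. g x (U k x)) \<in> borel_measurable M" for k by (rule meas[OF H10_measurable[OF U(1)]])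
    show "(\<lambda>x. g x (v x)) \<in> borel_measurable M" by (rule meas[OF H10_measurable[OF v]])
    show "AE x in M. (\<lambda>k. g x (U k x)) \<longlonglongrightarrow> g x (v x)"
      using lim cont
    proof eventually_elim
      case (elim x)
      then have "isCont (g x) (v x)" by (simp add: continuous_on_eq_continuous_at)
      from isCont_tendsto_compose[OF this elim(1)] show ?case .
    qed
    show "integrable M (\<lambda>x. \<bar>U k x\<bar> powr ?q)" for k by (rule H10_Lq[OF U(1)])
    show "0 \<le> \<bar>U k x\<bar> powr ?q" for k x by simp
    show "(LINT x|M. \<bar>U k x\<bar> powr ?q) \<le> C * B powr (?q / 2)" for k
    proof -
      have "(LINT x|M. \<bar>U k x\<bar> powr ?q) \<le> C * dirichlet \<Omega> (U k) powr (?q / 2)" by (rule C(2)[OF U(1)])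
      also have "\<dots> \<le> C * B powr (?q / 2)"
        using C(1) crit_exp_gt U(2) H10_dirichlet_nonneg by (intro mult_left_mono powr_mono2) auto
      finally show ?thesis .
    qed
    show "\<exists>G. integrable M G \<and> (\<forall>k. AE x in M. \<bar>g x (U k x)\<bar> \<le> \<epsilon> * \<bar>U k x\<bar> powr ?q + G x)" if \<epsilon>: "\<epsilon> > 0" for \<epsilon>
    proof -
      obtain G where G: "integrable M G" "AE x in M. \<forall>t. \<bar>g x t\<bar> \<le> \<epsilon> * \<bar>t\<bar> powr ?q + G x"
        using dom[OF \<epsilon>] by blast
      have "AE x in M. \<bar>g x (U k x)\<bar> \<le> \<epsilon> * \<bar>U k x\<bar> powr ?q + G x" for k
        using G(2) by eventually_elim blast
      with G(1) show ?thesis by blast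
    qed
  qed
qed

text \<open>Both exponents p and 1 lie strictly below the critical one, so each term is at most half
  of \<epsilon> |t|^q plus a constant, and constants are integrable on a bounded domain.\<close>

lemma subcritical_tendsto:
  fixes g :: "'a \<Rightarrow> real \<Rightarrow> real"
  assumes U: "\<And>k. U k \<in> H10 \<Omega>" "\<And>k. dirichlet \<Omega> (U k) \<le> B" and v: "v \<in> H10 \<Omega>"
    and lim: "AE x in M. (\<lambda>k. U k x) \<longlonglongrightarrow> v x"
    and cont: "AE x in M. continuous_on UNIV (g x)"
    and meas: "\<And>w. w \<in> borel_measurable M \<Longrightarrow> (\<lambda>x. g x (w x)) \<in> borel_measurable M"
    and growth: "AE x in M. \<forall>t. \<bar>g x t\<bar> \<le> c1 * \<bar>t\<bar> powr p + c2 * \<bar>t\<bar>"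
  shows "(\<lambda>k. LINT x|M. g x (U k x)) \<longlonglongrightarrow> (LINT x|M. g x (v x))"
proof (rule superposition_tendsto[OF U v lim cont meas])
  fix \<epsilon> :: real assume \<epsilon>: "\<epsilon> > 0"
  let ?q = "crit_exp DIM('a)"
  obtain C where C: "C \<ge> 0" "\<And>t. t \<ge> 0 \<Longrightarrow> t powr p \<le> \<epsilon> / (2 * c1) * t powr ?q + C"
    using \<epsilon> growth_const by (elim powr_eps_bound[of "\<epsilon> / (2 * c1)" p ?q, rotated -1]) auto
  obtain C' where C': "C' \<ge> 0" "\<And>t. t \<ge> 0 \<Longrightarrow> t powr 1 \<le> \<epsilon> / (2 * c2) * t powr ?q + C'"
    using \<epsilon> growth_const by (elim powr_eps_bound[of "\<epsilon> / (2 * c2)" 1 ?q, rotated -1]) auto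
  have "c1 * \<bar>t\<bar> powr p + c2 * \<bar>t\<bar> \<le> \<epsilon> * \<bar>t\<bar> powr ?q + (c1 * C + c2 * C')" for t
  proof -
    have "c1 * \<bar>t\<bar> powr p \<le> c1 * (\<epsilon> / (2 * c1) * \<bar>t\<bar> powr ?q + C)"
      "c2 * \<bar>t\<bar> \<le> c2 * (\<epsilon> / (2 * c2) * \<bar>t\<bar> powr ?q + C')"
      using C(2)[of "\<bar>t\<bar>"] C'(2)[of "\<bar>t\<bar>"] growth_const by (intro mult_left_mono; simp)+
    then show ?thesis using growth_const by (simp add: distrib_left)
  qed
  then have "AE x in M. \<forall>t. \<bar>g x t\<bar> \<le> \<epsilon> * \<bar>t\<bar> powr ?q + (c1 * C + c2 * C')"
    using growth by (auto elim!: eventually_mono intro: order_trans)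
  then show "\<exists>G. integrable M G \<and> (AE x in M. \<forall>t. \<bar>g x t\<bar> \<le> \<epsilon> * \<bar>t\<bar> powr ?q + G x)"
    by (intro exI[of _ "\<lambda>_. c1 * C + c2 * C'"]) simp
qed

text \<open>Critical growth is admissible here because one factor is the fixed function v:
  \<open>powr_mult_eps\<close> leaves \<epsilon> |t|^q and puts the rest into |v|^q.\<close>

lemma pairing_tendsto:
  fixes g :: "'a \<Rightarrow> real \<Rightarrow> real"
  assumes U: "\<And>k. U k \<in> H10 \<Omega>" "\<And>k. dirichlet \<Omega> (U k) \<le> B" and v: "v \<in> H10 \<Omega>"
    and lim: "AE x in M. (\<lambda>k. U k x) \<longlonglongrightarrow> v x"
    and cont: "AE x in M. continuous_on UNIV (g x)"
    and meas: "\<And>w. w \<in> borel_measurable M \<Longrightarrow> (\<lambda>x. g x (w x)) \<in> borel_measurable M"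
    and c: "c > 0"
    and growth: "AE x in M. \<forall>t. \<bar>g x t\<bar> \<le> c * (1 + \<bar>t\<bar> powr (crit_exp DIM('a) - 1))"
  shows "(\<lambda>k. LINT x|M. g x (U k x) * v x) \<longlonglongrightarrow> (LINT x|M. g x (v x) * v x)"
proof (rule superposition_tendsto[where g = "\<lambda>x t. g x t * v x", OF U v lim])
  show "AE x in M. continuous_on UNIV (\<lambda>t. g x t * v x)"
    using cont by eventually_elim (intro continuous_intros)
  show "(\<lambda>x. g x (w x) * v x) \<in> borel_measurable M" if "w \<in> borel_measurable M" for w
    using meas[OF that] H10_measurable[OF v] by measurable
next
  fix \<epsilon> :: real assume \<epsilon>: "\<epsilon> > 0"
  let ?q = "crit_exp DIM('a)"
  have q: "?q > 1" using crit_exp_gt by simp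
  define E where "E = (1 / (\<epsilon> / c)) powr (?q - 1)"
  define G where "G x = c * (1 + \<bar>v x\<bar> powr ?q) + c * E * \<bar>v x\<bar> powr ?q" for x
  have "integrable M G" unfolding G_def using H10_Lq[OF v] by (intro Bochner_Integration.integrable_add integrable_mult_right) auto
  moreover have "AE x in M. \<forall>t. \<bar>g x t * v x\<bar> \<le> \<epsilon> * \<bar>t\<bar> powr ?q + G x"
    using growth
  proof eventually_elim
    case (elim x)
    show ?case
    proof
      fix t
      have "\<bar>g x t * v x\<bar> \<le> c * (1 + \<bar>t\<bar> powr (?q - 1)) * \<bar>v x\<bar>"
        unfolding abs_mult using elim by (intro mult_right_mono) auto
      also have "\<dots> = c * \<bar>v x\<bar> + c * (\<bar>t\<bar> powr (?q - 1) * \<bar>v x\<bar>)" by (simp add: algebra_simps)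
      also have "\<dots> \<le> c * (1 + \<bar>v x\<bar> powr ?q) + c * (\<epsilon> / c * \<bar>t\<bar> powr ?q + E * \<bar>v x\<bar> powr ?q)"
        unfolding E_def using c \<epsilon> q powr_interpolation[of "\<bar>v x\<bar>" 1 1 ?q]
        by (intro add_mono mult_left_mono powr_mult_eps) auto
      also have "\<dots> = \<epsilon> * \<bar>t\<bar> powr ?q + G x" using c by (simp add: G_def algebra_simps)
      finally show "\<bar>g x t * v x\<bar> \<le> \<epsilon> * \<bar>t\<bar> powr ?q + G x" .
    qed
  qed
  ultimately show "\<exists>G. integrable M G \<and> (AE x in M. \<forall>t. \<bar>g x t * v x\<bar> \<le> \<epsilon> * \<bar>t\<bar> powr ?q + G x)" by blast
qed

text \<open>The two critical integrals of the moving functions need not converge separately, but the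
  difference of the powers is at most \<epsilon> |U|^q + C |v|^q in modulus by
  \<open>Brezis_Lieb_pointwise\<close>; at the limit the first power vanishes and -|v|^q
  remains.\<close>

lemma Brezis_Lieb:
  assumes U: "\<And>k. U k \<in> H10 \<Omega>" "\<And>k. dirichlet \<Omega> (U k) \<le> B" and v: "v \<in> H10 \<Omega>"
    and lim: "AE x in M. (\<lambda>k. U k x) \<longlonglongrightarrow> v x"
  defines "q \<equiv> crit_exp DIM('a)"
  shows "(\<lambda>k. (LINT x|M. \<bar>U k x - v x\<bar> powr q) - (LINT x|M. \<bar>U k x\<bar> powr q)) \<longlonglongrightarrow> - (LINT x|M. \<bar>v x\<bar> powr q)"
proof -
  have q: "q > 1" using crit_exp_gt by (simp add: q_def)
  note [measurable] = H10_measurable[OF v]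
  have "(\<lambda>k. LINT x|M. \<bar>U k x - v x\<bar> powr q - \<bar>U k x\<bar> powr q) \<longlonglongrightarrow> (LINT x|M. \<bar>v x - v x\<bar> powr q - \<bar>v x\<bar> powr q)"
  proof (rule superposition_tendsto[where g = "\<lambda>x t. \<bar>t - v x\<bar> powr q - \<bar>t\<bar> powr q", OF U v lim])
    show "AE x in M. continuous_on UNIV (\<lambda>t. \<bar>t - v x\<bar> powr q - \<bar>t\<bar> powr q)"
      using q unfolding continuous_on_def by (intro AE_I2 ballI tendsto_intros tendsto_abs_powr) auto
    show "(\<lambda>x. \<bar>w x - v x\<bar> powr q - \<bar>w x\<bar> powr q) \<in> borel_measurable M" if [measurable]: "w \<in> borel_measurable M" for w
      by measurable
    fix \<epsilon> :: real assume \<epsilon>: "\<epsilon> > 0"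
    obtain C where C: "C \<ge> 0" "\<And>a b. \<bar>\<bar>a + b\<bar> powr q - \<bar>a\<bar> powr q\<bar> \<le> \<epsilon> * \<bar>a\<bar> powr q + C * \<bar>b\<bar> powr q"
      by (rule Brezis_Lieb_pointwise[OF \<epsilon> q]) (rule that)
    have "\<bar>\<bar>t - v x\<bar> powr q - \<bar>t\<bar> powr q\<bar> \<le> \<epsilon> * \<bar>t\<bar> powr q + C * \<bar>v x\<bar> powr q" for x t
      using C(2)[of t "- v x"] by simp
    then show "\<exists>G. integrable M G \<and> (AE x in M. \<forall>t. \<bar>\<bar>t - v x\<bar> powr q - \<bar>t\<bar> powr q\<bar> \<le> \<epsilon> * \<bar>t\<bar> powr crit_exp DIM('a) + G x)"
      using H10_Lq[OF v] unfolding q_def[symmetric] by (intro exI[of _ "\<lambda>x. C * \<bar>v x\<bar> powr q"]) simp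
  qed
  moreover have "(LINT x|M. \<bar>U k x - v x\<bar> powr q - \<bar>U k x\<bar> powr q) = (LINT x|M. \<bar>U k x - v x\<bar> powr q) - (LINT x|M. \<bar>U k x\<bar> powr q)" for k
    unfolding q_def by (intro Bochner_Integration.integral_diff H10_Lq H10_diff U v)
  ultimately show ?thesis using q by simp
qed

text \<open>The energies tend to T, which may differ from the energy of v, so the coefficient h(T)
  appears in both limits of dJ. In the second one the critical integral of U has no known limit;
  adding the critical integral of U - v compensates it by \<open>Brezis_Lieb\<close>.\<close>

lemma dJ_tendsto:
  assumes U: "\<And>k. U k \<in> H10 \<Omega>" "\<And>k. dirichlet \<Omega> (U k) \<le> B" and v: "v \<in> H10 \<Omega>"
    and lim: "AE x in M. (\<lambda>k. U k x) \<longlonglongrightarrow> v x"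
    and weak: "(\<lambda>k. ip (U k) v) \<longlonglongrightarrow> ip v v"
    and T: "(\<lambda>k. dirichlet \<Omega> (U k)) \<longlonglongrightarrow> T"
  shows "(\<lambda>k. dJ (U k) v) \<longlonglongrightarrow> h T * dirichlet \<Omega> v - (LINT x|M. f x (v x) * v x) - (LINT x|M. \<bar>v x\<bar> powr crit_exp DIM('a))"
    "(\<lambda>k. dJ (U k) (U k) + (LINT x|M. \<bar>U k x - v x\<bar> powr crit_exp DIM('a)))
      \<longlonglongrightarrow> h T * T - (LINT x|M. f x (v x) * v x) - (LINT x|M. \<bar>v x\<bar> powr crit_exp DIM('a))"
    "(\<lambda>k. LINT x|M. primitive (f x) (U k x) - 1 / crit_exp DIM('a) * (U k x * f x (U k x)))
      \<longlonglongrightarrow> (LINT x|M. primitive (f x) (v x) - 1 / crit_exp DIM('a) * (v x * f x (v x)))"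
    "h T \<ge> 0" "T \<ge> 0" "(\<lambda>k. K_fun DIM('a) h (dirichlet \<Omega> (U k))) \<longlonglongrightarrow> K_fun DIM('a) h T"
proof -
  let ?q = "crit_exp DIM('a)"
  have q: "?q > 2" by (rule crit_exp_gt)
  show T0: "T \<ge> 0" using T by (rule LIMSEQ_le_const) (auto simp: H10_dirichlet_nonneg)
  then show "h T \<ge> 0" using h_nonneg by blast
  have ev: "\<forall>\<^sub>F k in sequentially. dirichlet \<Omega> (U k) \<in> {0..}" using H10_dirichlet_nonneg by simp
  have hT: "(\<lambda>k. h (dirichlet \<Omega> (U k))) \<longlonglongrightarrow> h T"
    by (rule continuous_on_tendsto_compose[OF h_cont T _ ev]) (use T0 in simp)
  have pT: "(\<lambda>k. primitive h (dirichlet \<Omega> (U k))) \<longlonglongrightarrow> primitive h T"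
  proof (rule continuous_on_tendsto_compose[OF _ T _ ev])
    show "continuous_on {0..} (primitive h)"
      unfolding continuous_on_eq_continuous_within
      using primitive_has_derivative_within[OF h_cont] by (auto intro: DERIV_continuous)
  qed (use T0 in simp)
  show "(\<lambda>k. K_fun DIM('a) h (dirichlet \<Omega> (U k))) \<longlonglongrightarrow> K_fun DIM('a) h T"
    unfolding K_fun_def by (intro tendsto_intros hT pT T)
  have sgn_eq: "sgn t * \<bar>t\<bar> powr (?q - 1) * t = \<bar>t\<bar> powr ?q" for t :: real
    by (cases "t = 0") (auto simp: powr_diff sgn_real_def)
  \<comment> \<open>The odd power is a difference of powers of the positive and the negative part,
    each continuous because the exponent q - 1 is positive.\<close>
  have sgn_cont: "continuous_on UNIV (\<lambda>t::real. sgn t * \<bar>t\<bar> powr (?q - 1))"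
  proof -
    have "sgn t * \<bar>t\<bar> powr (?q - 1) = (max t 0) powr (?q - 1) - (max (- t) 0) powr (?q - 1)" for t :: real
      by (auto simp: sgn_real_def max_def)
    moreover have "continuous_on UNIV (\<lambda>t::real. (max t 0) powr (?q - 1) - (max (- t) 0) powr (?q - 1))"
      using q by (intro continuous_intros continuous_on_powr') auto
    ultimately show ?thesis by simp
  qed
  have crit: "(\<lambda>k. LINT x|M. sgn (U k x) * \<bar>U k x\<bar> powr (?q - 1) * v x) \<longlonglongrightarrow> (LINT x|M. sgn (v x) * \<bar>v x\<bar> powr (?q - 1) * v x)"
  proof (rule pairing_tendsto[where g = "\<lambda>x t. sgn t * \<bar>t\<bar> powr (?q - 1)" and c = 1, OF U v lim])
    show "AE x in M. continuous_on UNIV (\<lambda>t::real. sgn t * \<bar>t\<bar> powr (?q - 1))" using sgn_cont by simp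
    show "(\<lambda>x. sgn (w x) * \<bar>w x\<bar> powr (?q - 1)) \<in> borel_measurable M" if [measurable]: "w \<in> borel_measurable M" for w
      by measurable
  qed (auto simp: abs_mult sgn_real_def)
  have f1: "(\<lambda>k. LINT x|M. f x (U k x) * v x) \<longlonglongrightarrow> (LINT x|M. f x (v x) * v x)"
    by (rule pairing_tendsto[OF U v lim f_cont caratheodory_measurable(1)[OF f_car] _ f_growth_crit])
      (use growth_const in simp_all)
  have f2: "(\<lambda>k. LINT x|M. f x (U k x) * U k x) \<longlonglongrightarrow> (LINT x|M. f x (v x) * v x)"
  proof (rule subcritical_tendsto[where g = "\<lambda>x t. f x t * t", OF U v lim])
    show "AE x in M. continuous_on UNIV (\<lambda>t. f x t * t)"
      using f_cont by eventually_elim (intro continuous_intros)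
    show "(\<lambda>x. f x (w x) * w x) \<in> borel_measurable M" if "w \<in> borel_measurable M" for w
      using caratheodory_measurable(1)[OF f_car that] that by measurable
    show "AE x in M. \<forall>t. \<bar>f x t * t\<bar> \<le> c1 * \<bar>t\<bar> powr p + c2 * \<bar>t\<bar>"
      using f_growth
    proof eventually_elim
      case (elim x)
      show ?case
      proof
        fix t
        have "\<bar>f x t * t\<bar> \<le> (c1 * \<bar>t\<bar> powr (p - 1) + c2) * \<bar>t\<bar>"
          unfolding abs_mult using elim by (intro mult_right_mono) auto
        also have "\<dots> = c1 * \<bar>t\<bar> powr p + c2 * \<bar>t\<bar>"
          by (cases "t = 0") (auto simp: powr_diff distrib_right)
        finally show "\<bar>f x t * t\<bar> \<le> c1 * \<bar>t\<bar> powr p + c2 * \<bar>t\<bar>" .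
      qed
    qed
  qed
  have F: "(\<lambda>k. LINT x|M. primitive (f x) (U k x)) \<longlonglongrightarrow> (LINT x|M. primitive (f x) (v x))"
  proof (rule subcritical_tendsto[OF U v lim _ caratheodory_measurable(2)[OF f_car] F_growth])
    show "AE x in M. continuous_on UNIV (primitive (f x))"
      using f_cont
    proof eventually_elim
      case (elim x)
      show ?case
        unfolding continuous_on_eq_continuous_within
        using primitive_has_derivative[OF elim] by (auto intro: DERIV_continuous has_field_derivative_at_within)
    qed
  qed
  have split: "(LINT x|M. primitive (f x) (u x) - 1 / ?q * (u x * f x (u x)))
      = (LINT x|M. primitive (f x) (u x)) - 1 / ?q * (LINT x|M. f x (u x) * u x)" if u: "u \<in> H10 \<Omega>" for u
    using F_Gateaux(1,2)[OF u u] by (simp add: mult.commute)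
  show "(\<lambda>k. LINT x|M. primitive (f x) (U k x) - 1 / ?q * (U k x * f x (U k x)))
      \<longlonglongrightarrow> (LINT x|M. primitive (f x) (v x) - 1 / ?q * (v x * f x (v x)))"
    unfolding split[OF U(1)] split[OF v] by (intro tendsto_intros F f2)
  show "(\<lambda>k. dJ (U k) v) \<longlonglongrightarrow> h T * dirichlet \<Omega> v - (LINT x|M. f x (v x) * v x) - (LINT x|M. \<bar>v x\<bar> powr ?q)"
    using tendsto_diff[OF tendsto_diff[OF tendsto_mult[OF hT weak] f1] crit] unfolding dJ_def ip_self sgn_eq .
  have "(\<lambda>k. h (dirichlet \<Omega> (U k)) * dirichlet \<Omega> (U k) - (LINT x|M. f x (U k x) * U k x)
      + ((LINT x|M. \<bar>U k x - v x\<bar> powr ?q) - (LINT x|M. \<bar>U k x\<bar> powr ?q)))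
    \<longlonglongrightarrow> h T * T - (LINT x|M. f x (v x) * v x) + - (LINT x|M. \<bar>v x\<bar> powr ?q)"
    by (rule tendsto_add[OF tendsto_diff[OF tendsto_mult[OF hT T] f2] Brezis_Lieb[OF U v lim]])
  then show "(\<lambda>k. dJ (U k) (U k) + (LINT x|M. \<bar>U k x - v x\<bar> powr ?q))
      \<longlonglongrightarrow> h T * T - (LINT x|M. f x (v x) * v x) - (LINT x|M. \<bar>v x\<bar> powr ?q)"
    unfolding dJ_def ip_self sgn_eq by (simp add: algebra_simps)
qed

lemma PS_strong_limit:
  assumes U: "\<And>k. U k \<in> H10 \<Omega>" "\<And>k. dirichlet \<Omega> (U k) \<le> B" and v: "v \<in> H10 \<Omega>"
    and lim: "AE x in M. (\<lambda>k. U k x) \<longlonglongrightarrow> v x"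
    and weak: "(\<lambda>k. ip (U k) v) \<longlonglongrightarrow> ip v v"
    and T: "(\<lambda>k. dirichlet \<Omega> (U k)) \<longlonglongrightarrow> T"
    and J: "(\<lambda>k. J (U k)) \<longlonglongrightarrow> c" and dJU: "(\<lambda>k. dJ (U k) (U k)) \<longlonglongrightarrow> 0" and dJv: "(\<lambda>k. dJ (U k) v) \<longlonglongrightarrow> 0"
    and c: "c < c_star \<Omega> h"
  shows "(\<lambda>k. H10_norm \<Omega> (\<lambda>x. U k x - v x)) \<longlonglongrightarrow> 0"
proof -
  let ?q = "crit_exp DIM('a)"
  note lims = dJ_tendsto[OF U v lim weak T]
  define s where "s = T - dirichlet \<Omega> v"
  have Ds: "(\<lambda>k. dirichlet \<Omega> (\<lambda>x. U k x - v x)) \<longlonglongrightarrow> s"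
  proof -
    have "(\<lambda>k. dirichlet \<Omega> (U k) - 2 * ip (U k) v + dirichlet \<Omega> v) \<longlonglongrightarrow> T - 2 * ip v v + dirichlet \<Omega> v"
      by (intro tendsto_intros T weak)
    then show ?thesis unfolding dirichlet_diff[OF U(1) v] by (simp add: s_def ip_self)
  qed
  have s0: "s \<ge> 0" using Ds by (rule LIMSEQ_le_const) (auto simp: H10_dirichlet_nonneg)
  \<comment> \<open>The limiting identity for v tested with v itself, with coefficient h(T) in place
    of h at the energy of v.\<close>
  have e1: "h T * dirichlet \<Omega> v - (LINT x|M. f x (v x) * v x) - (LINT x|M. \<bar>v x\<bar> powr ?q) = 0"
    by (rule LIMSEQ_unique[OF lims(1) dJv])
  \<comment> \<open>Subtracting \<open>e1\<close> removes the lower-order and critical integrals of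
    v, and only h(T) times s remains.\<close>
  have "(\<lambda>k. LINT x|M. \<bar>U k x - v x\<bar> powr ?q) \<longlonglongrightarrow> h T * s"
  proof -
    have "(\<lambda>k. dJ (U k) (U k) + (LINT x|M. \<bar>U k x - v x\<bar> powr ?q) - dJ (U k) (U k)) \<longlonglongrightarrow> 
      (h T * T - (LINT x|M. f x (v x) * v x) - (LINT x|M. \<bar>v x\<bar> powr ?q)) - 0"
      by (intro tendsto_diff lims(2) dJU)
    moreover have "(h T * T - (LINT x|M. f x (v x) * v x) - (LINT x|M. \<bar>v x\<bar> powr ?q)) - 0 = h T * s"
      using e1 by (simp add: s_def algebra_simps)
    ultimately show ?thesis by simp
  qed
  moreover have "(\<lambda>k. sobolev_const \<Omega> powr (- (?q / 2)) * dirichlet \<Omega> (\<lambda>x. U k x - v x) powr (?q / 2))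
      \<longlonglongrightarrow> sobolev_const \<Omega> powr (- (?q / 2)) * s powr (?q / 2)"
    using crit_exp_gt by (intro tendsto_intros tendsto_powr' Ds) (auto simp: H10_dirichlet_nonneg)
  ultimately have le: "h T * s \<le> sobolev_const \<Omega> powr (- (?q / 2)) * s powr (?q / 2)"
    by (rule LIMSEQ_le) (use sobolev_const_bound[OF H10_diff[OF U(1) v]] in blast)
  have "s = 0"
  proof (rule ccontr)
    assume "s \<noteq> 0"
    then have s: "s > 0" using s0 by simp
    have "s \<le> T" using H10_dirichlet_nonneg[of v] by (simp add: s_def)
    then have "h s \<le> h T" using h_mono s by (auto simp: monotone_on_def)
    \<comment> \<open>Dividing \<open>le\<close> by s > 0 lowers the exponent by one, which is the
      inequality defining \<open>I_set\<close> with h(T) in place of h(s).\<close>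
    also have "h T \<le> sobolev_const \<Omega> powr (- (?q / 2)) * s powr (?q / 2 - 1)"
    proof -
      have "s powr (?q / 2) = s powr (?q / 2 - 1) * s" using s by (simp add: powr_diff)
      then show ?thesis using le s by simp
    qed
    finally have "s \<in> I_set \<Omega> h" using s by (simp add: I_set_def)
    then have "c_star \<Omega> h \<le> K_fun DIM('a) h s" by (rule c_star_le)
    \<comment> \<open>The level is computed from J - dJ/q, in which the critical integrals have
      cancelled, so that every remaining term converges.\<close>
    moreover have "c = K_fun DIM('a) h T - (LINT x|M. primitive (f x) (v x) - 1 / ?q * (v x * f x (v x)))"
    proof (rule LIMSEQ_unique)
      have "(\<lambda>k. J (U k) - 1 / ?q * dJ (U k) (U k)) \<longlonglongrightarrow> c - 1 / ?q * 0"
        by (intro tendsto_intros J dJU)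
      then show "(\<lambda>k. K_fun DIM('a) h (dirichlet \<Omega> (U k))
          - (LINT x|M. primitive (f x) (U k x) - 1 / ?q * (U k x * f x (U k x)))) \<longlonglongrightarrow> c"
        unfolding energy_identity[OF U(1)] by simp
    qed (intro tendsto_diff lims(3,6))
    moreover have "K_fun DIM('a) h s + K_fun DIM('a) h (dirichlet \<Omega> v) \<le> K_fun DIM('a) h T"
      using A2[rule_format, of s "dirichlet \<Omega> v"] s H10_dirichlet_nonneg[of v] by (simp add: s_def)
    moreover note energy_nonneg[OF v] c
    ultimately show False by linarith
  qed
  then have "(\<lambda>k. sqrt (dirichlet \<Omega> (\<lambda>x. U k x - v x))) \<longlonglongrightarrow> sqrt 0" using Ds by (intro tendsto_intros) simp
  then show ?thesis by (simp add: H10_norm_def)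
qed

text \<open>Coercivity bounds the sequence, and two successive extractions give the limit v and the
  limit T of the energies. Dual norms tending to 0 and bounded norms make the derivatives, tested
  with the sequence itself and with v, vanish in the limit.\<close>

lemma palais_smale_below_c_star:
  assumes c: "c < c_star \<Omega> h"
  shows "palais_smale \<Omega> (J_fun \<Omega> h f) c"
  unfolding palais_smale_def
proof (intro allI impI, elim conjE)
  fix u :: "nat \<Rightarrow> 'a \<Rightarrow> real" and L
  assume u: "\<forall>j. u j \<in> H10 \<Omega>" and J: "(\<lambda>j. J (u j)) \<longlonglongrightarrow> c"
    and L: "\<forall>j. H10_has_derivative \<Omega> (J_fun \<Omega> h f) (L j) (u j)"
    and L0: "(\<lambda>j. H10_dual_norm \<Omega> (L j)) \<longlonglongrightarrow> 0"
  have dJ_le: "\<bar>dJ (u j) w\<bar> \<le> H10_dual_norm \<Omega> (L j) * H10_norm \<Omega> w" if w: "w \<in> H10 \<Omega>" for j w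
  proof -
    have "H10_dual \<Omega> (L j)" using L by (simp add: H10_has_derivative_def)
    from dual_norm_bound[OF this w] show ?thesis
      unfolding derivative_eq_dJ[OF L[rule_format] u[rule_format] w] .
  qed
  obtain B1 where B1: "\<And>j. \<bar>J (u j)\<bar> \<le> B1"
    using convergent_imp_Bseq[OF convergentI[OF J]] by (auto simp: Bseq_def)
  obtain B2 where B2: "\<And>j. \<bar>H10_dual_norm \<Omega> (L j)\<bar> \<le> B2"
    using convergent_imp_Bseq[OF convergentI[OF L0]] by (auto simp: Bseq_def)
  have "\<bar>dJ (u j) (u j)\<bar> \<le> B2 * H10_norm \<Omega> (u j)" for j
  proof -
    have "\<bar>dJ (u j) (u j)\<bar> \<le> H10_dual_norm \<Omega> (L j) * H10_norm \<Omega> (u j)" using dJ_le u by blast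
    also have "\<dots> \<le> B2 * H10_norm \<Omega> (u j)"
      using B2[of j] by (intro mult_right_mono H10_norm_nonneg) simp
    finally show ?thesis .
  qed
  then obtain B where B: "\<And>j. dirichlet \<Omega> (u j) \<le> B"
    using PS_bounded[of u B1 B2] u B1 by blast
  obtain r v where r: "strict_mono r" and v: "v \<in> H10 \<Omega>"
    and lim: "AE x in M. (\<lambda>k. u (r k) x) \<longlonglongrightarrow> v x"
    and weak: "\<And>w. w \<in> H10 \<Omega> \<Longrightarrow> (\<lambda>k. ip (u (r k)) w) \<longlonglongrightarrow> ip v w"
    by (rule weak_compactness[OF u[rule_format] B]) (rule that)
  \<comment> \<open>The energies converge only after a further extraction; weak convergence to v
    does not determine their limit.\<close>
  have "bounded (range (\<lambda>k. dirichlet \<Omega> (u (r k))))"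
    unfolding bounded_iff using B H10_dirichlet_nonneg by (intro exI[of _ B]) auto
  then obtain T s where s: "strict_mono s" and T: "((\<lambda>k. dirichlet \<Omega> (u (r k))) \<circ> s) \<longlonglongrightarrow> T"
    using bounded_imp_convergent_subsequence[of "\<lambda>k. dirichlet \<Omega> (u (r k))"] by auto
  define m where "m = r \<circ> s"
  have m: "strict_mono m" unfolding m_def by (rule strict_mono_o[OF r s])
  have L0m: "(\<lambda>k. H10_dual_norm \<Omega> (L (m k))) \<longlonglongrightarrow> 0"
    using LIMSEQ_subseq_LIMSEQ[OF L0 m] by (simp add: o_def)
  have "(\<lambda>k. H10_norm \<Omega> (\<lambda>x. u (m k) x - v x)) \<longlonglongrightarrow> 0"
  proof (rule PS_strong_limit[OF _ _ v])
    show "u (m k) \<in> H10 \<Omega>" "dirichlet \<Omega> (u (m k)) \<le> B" for k using u B by auto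
    show "AE x in M. (\<lambda>k. u (m k) x) \<longlonglongrightarrow> v x"
      using lim
    proof eventually_elim
      case (elim x)
      from LIMSEQ_subseq_LIMSEQ[OF this s] show ?case by (simp add: o_def m_def)
    qed
    show "(\<lambda>k. ip (u (m k)) v) \<longlonglongrightarrow> ip v v"
      using LIMSEQ_subseq_LIMSEQ[OF weak[OF v] s] by (simp add: o_def m_def)
    show "(\<lambda>k. dirichlet \<Omega> (u (m k))) \<longlonglongrightarrow> T" using T by (simp add: o_def m_def)
    show "(\<lambda>k. J (u (m k))) \<longlonglongrightarrow> c" using LIMSEQ_subseq_LIMSEQ[OF J m] by (simp add: o_def)
    show "(\<lambda>k. dJ (u (m k)) (u (m k))) \<longlonglongrightarrow> 0"
    proof (rule Lim_null_comparison)
      show "(\<lambda>k. \<bar>H10_dual_norm \<Omega> (L (m k))\<bar> * sqrt B) \<longlonglongrightarrow> 0"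
        using tendsto_mult[OF tendsto_rabs[OF L0m] tendsto_const[of "sqrt B"]] by simp
      show "\<forall>\<^sub>F k in sequentially. norm (dJ (u (m k)) (u (m k))) \<le> \<bar>H10_dual_norm \<Omega> (L (m k))\<bar> * sqrt B"
      proof (rule always_eventually, rule allI)
        fix k
        have "\<bar>dJ (u (m k)) (u (m k))\<bar> \<le> H10_dual_norm \<Omega> (L (m k)) * H10_norm \<Omega> (u (m k))" using dJ_le u by blast
        also have "\<dots> \<le> \<bar>H10_dual_norm \<Omega> (L (m k))\<bar> * sqrt B"
          unfolding H10_norm_def using B[of "m k"] H10_dirichlet_nonneg by (intro mult_mono) auto
        finally show "norm (dJ (u (m k)) (u (m k))) \<le> \<bar>H10_dual_norm \<Omega> (L (m k))\<bar> * sqrt B" by simp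
      qed
    qed
    show "(\<lambda>k. dJ (u (m k)) v) \<longlonglongrightarrow> 0"
    proof (rule Lim_null_comparison)
      show "(\<lambda>k. H10_dual_norm \<Omega> (L (m k)) * H10_norm \<Omega> v) \<longlonglongrightarrow> 0"
        using tendsto_mult[OF L0m tendsto_const[of "H10_norm \<Omega> v"]] by simp
      show "\<forall>\<^sub>F k in sequentially. norm (dJ (u (m k)) v) \<le> H10_dual_norm \<Omega> (L (m k)) * H10_norm \<Omega> v"
        using dJ_le[OF v] by simp
    qed
    show "c < c_star \<Omega> h" by (rule c)
  qed
  then show "\<exists>r v. strict_mono (r :: nat \<Rightarrow> nat) \<and> v \<in> H10 \<Omega> \<and> (\<lambda>j. H10_norm \<Omega> (\<lambda>x. u (r j) x - v x)) \<longlonglongrightarrow> 0"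
    using m v by blast
qed

end

theorem theorem2p3:
  fixes \<Omega> :: "'a::euclidean_space set"
    and h :: "real \<Rightarrow> real"
    and f :: "'a \<Rightarrow> real \<Rightarrow> real"
    and c1 c2 p :: real
    and n :: nat
    and \<alpha> \<gamma> \<mu> :: "nat \<Rightarrow> real"
  assumes dim: "DIM('a) \<ge> 3"
    and domain: "open \<Omega>" "connected \<Omega>" "\<Omega> \<noteq> {}" "bounded \<Omega>"
    and h_nonneg: "\<forall>t\<ge>0. h t \<ge> 0"
    and h_cont: "continuous_on {0..} h"
    and h_mono: "mono_on {0..} h"
    and f_car: "caratheodory \<Omega> f"
    and growth_const: "c1 > 0" "c2 > 0" "1 < p" "p < crit_exp DIM('a)"
    and f_growth: "AE x in lebesgue_on \<Omega>. \<forall>t. \<bar>f x t\<bar> \<le> c1 * \<bar>t\<bar> powr (p - 1) + c2"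
    and I_nonempty: "I_set \<Omega> h \<noteq> {}"
    and A1_alpha: "\<forall>i\<in>{1..n}. \<alpha> i > 0"
    and A1_gamma: "\<forall>i\<in>{1..n}. 1 \<le> \<gamma> i \<and> \<gamma> i < crit_exp DIM('a) / 2"
      "strict_mono_on {1..n} \<gamma>"
    and A1_mu: "\<forall>i\<in>{1..n}. \<mu> i \<le> lambda1 \<Omega> (\<gamma> i)"
      "\<exists>i\<in>{1..n}. \<mu> i < lambda1 \<Omega> (\<gamma> i)"
    and A1_K: "\<forall>t\<ge>0. K_fun DIM('a) h t \<ge> (\<Sum>i=1..n. \<alpha> i * t powr \<gamma> i)"
    and A1_F: "AE x in lebesgue_on \<Omega>. \<forall>t.
      primitive (f x) t - 1 / crit_exp DIM('a) * (t * f x t)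
        \<le> (\<Sum>i=1..n. \<mu> i * \<alpha> i * \<bar>t\<bar> powr (2 * \<gamma> i))"
    and A2: "\<forall>t1\<ge>0. \<forall>t2\<ge>0.
      K_fun DIM('a) h (t1 + t2) \<ge> K_fun DIM('a) h t1 + K_fun DIM('a) h t2"
  shows "(\<forall>c<c_star \<Omega> h. palais_smale \<Omega> (J_fun \<Omega> h f) c) \<and>
    (strict_antimono_on {0<..} (\<lambda>t. h t / t powr (crit_exp DIM('a) / 2 - 1)) \<and>
     (\<exists>l l0 :: ereal.
        ((\<lambda>t. ereal (h t / t powr (crit_exp DIM('a) / 2 - 1))) \<longlongrightarrow> l) at_top \<and>
        ((\<lambda>t. ereal (h t / t powr (crit_exp DIM('a) / 2 - 1))) \<longlongrightarrow> l0) (at_right 0) \<and>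
        0 \<le> l \<and> l < ereal (sobolev_const \<Omega> powr (- (crit_exp DIM('a) / 2))) \<and>
        ereal (sobolev_const \<Omega> powr (- (crit_exp DIM('a) / 2))) < l0 \<and> l0 \<le> \<infinity>)
     \<longrightarrow>
     (\<exists>t0>0.
        (\<forall>t>0. h t = sobolev_const \<Omega> powr (- (crit_exp DIM('a) / 2))
                       * t powr (crit_exp DIM('a) / 2 - 1) \<longleftrightarrow> t = t0) \<and>
        c_star \<Omega> h = K_fun DIM('a) h t0) \<and>
     c_star \<Omega> h > 0)"
proof -
  interpret kirchhoff \<Omega> h f c1 c2 p n \<alpha> \<gamma> \<mu>
    by unfold_locales (fact assms)+
  show ?thesis
    using palais_smale_below_c_star c_star_crossing by blast
qed

end
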